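(* Let $M$ be a smooth $n$-manifold, $V$ a rank $n$ real vector bundle on $M$ with connection $\nabla$, $X=\mathrm{tot}(V)$, $\widehat X=\mathrm{tot}(V^\vee)$. Let $(\mathcal{J},\mathcal{J}')$ be a generalized almost Kähler pair on $X$ such that both $\mathcal{J}=F^{-1}(\pi^*\underline{\mathcal{J}})F$ and $\mathcal{J}'=F^{-1}(\pi^*\underline{\mathcal{J}}')F$ are $\nabla$-lifted and adapted. Then the pair of mirror structures $(\widehat{\mathcal{J}},\widehat{\mathcal{J}}')$ is a generalized almost Kähler pair on $\widehat X$. On $V\oplus T_M\oplus V^\vee\oplus T_M^\vee$ one has $$-\underline{\mathcal{J}}\,\underline{\mathcal{J}}'=\begin{pmatrix} G_{11}&0&G_{21}&0\\ 0&G_{14}&0&G_{24}\\ G_{31}&0&G_{11}^\vee&0\\ 0&G_{34}&0&G_{14}^\vee\end{pmatrix},$$ with $G_{21},G_{24},G_{31},G_{34}$ symmetric, and on $V^\vee\oplus T_M\oplus V\oplus T_M^\vee$ the corresponding product for the mirror pair is $$-\widehat{\underline{\mathcal{J}}}\,\widehat{\underline{\mathcal{J}}}'=\begin{pmatrix} G_{11}^\vee&0&G_{31}&0\\ 0&G_{14}&0&G_{24}\\ G_{21}&0&G_{11}&0\\ 0&G_{34}&0&G_{14}^\vee\end{pmatrix}.$$ If $(g,b)$ and $(\hat g,\hat b)$ are the metrics and $2$-forms associated with $(\mathcal{J},\mathcal{J}')$ and $(\widehat{\mathcal{J}},\widehat{\mathcal{J}}')$, then $$g=D^\vee\,\pi^*(G_{21}^{-1})\,D+(d\pi)^\vee\,\pi^*(G_{24}^{-1})\,d\pi,$$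 $$b=D^\vee\,\pi^*(G_{11}^\vee G_{21}^{-1})\,D+(d\pi)^\vee\,\pi^*(G_{14}^\vee G_{24}^{-1})\,d\pi,$$ $$\hat g=\widehat D^\vee\,\hat\pi^*(G_{31}^{-1})\,\widehat D+(d\hat\pi)^\vee\,\hat\pi^*(G_{24}^{-1})\,d\hat\pi,$$ $$\hat b=\widehat D^\vee\,\hat\pi^*(G_{11}G_{31}^{-1})\,\widehat D+(d\hat\pi)^\vee\,\hat\pi^*(G_{14}^\vee G_{24}^{-1})\,d\hat\pi.$$ In particular, $g$ and $b$ do not mix the horizontal and vertical directions. Moreover, when $\nabla$ is flat, choose local coordinates $x^i$ on the base and local vertical coordinates adapted to the flat connection, $y^\alpha$ on $X$ and (dual) $\hat y^\alpha$ on $\widehat X$. Then locally $$g=g_{ij}(x)dx^idx^j+h_{\alpha\beta}(x)dy^\alpha dy^\beta,\qquad b=b_{ij}(x)dx^idx^j+B_{\alpha\beta}(x)dy^\alpha dy^\beta,$$ $$\hat g=g_{ij}(x)dx^idx^j+\hat h_{\alpha\beta}(x)d\hat y^\alpha d\hat y^\beta,\qquad \hat b=b_{ij}(x)dx^idx^j+\widehat B_{\alpha\beta}(x)d\hat y^\alpha d\hat y^\beta,$$ and the coefficient matrices satisfy the Buscher transformation rules $$(h+B)\,\hat h\,(h-B)=h,\qquad (h+B)\,\widehat B\,(h-B)=-B,$$ which follow from the identities $$(G_{21}^{-1}+G_{11}^\vee G_{21}^{-1})\,G_{31}^{-1}\,(G_{21}^{-1}-G_{11}^\vee G_{21}^{-1})=G_{21}^{-1},$$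 $$(G_{21}^{-1}+G_{11}^\vee G_{21}^{-1})\,G_{11}G_{31}^{-1}\,(G_{21}^{-1}-G_{11}^\vee G_{21}^{-1})=-G_{11}^\vee G_{21}^{-1}.$$
   Context: A generalized almost complex structure on a real vector bundle $W$ is an automorphism $\mathcal{J}$ of $W\oplus W^\vee$, orthogonal for the canonical pairing (a nonzero multiple of $f(w)+k(v)$ for $v+f,w+k$), with $\mathcal{J}^2=-1$; on a manifold, take $W$ the tangent bundle. A generalized almost Kähler pair on a manifold $N$ is a pair $(\mathcal{J},\mathcal{J}')$ of commuting generalized almost complex structures such that, for $G=-\mathcal{J}\mathcal{J}'$, the symmetric form $(x,y)\mapsto(Gx,y)$ is positive definite, where $(v+f,w+k)=\tfrac12(f(w)+k(v))$. The $(+1)$-eigenbundle of $G$ is the graph of $g+b:T_N\to T_N^\vee$ for a Riemannian metric $g$ and $2$-form $b$ (both viewed as maps $T_N\to T_N^\vee$), and $$G=\begin{pmatrix} -g^{-1}b & g^{-1} \\ g-bg^{-1}b & bg^{-1} \end{pmatrix}.$$ Let $\pi:X=\mathrm{tot}(V)\to M$, with tangent sequence $0\to\pi^*V\xrightarrow{j}T_X\xrightarrow{d\pi}\pi^*T_M\to0$. With $S$ the tautological section of $\pi^*V$, $D=(\pi^*\nabla)(S):T_X\to\pi^*V$ satisfies $D\circ j=1$; let $\alpha:\pi^*T_M\to T_X$ satisfy $d\pi\circ\alpha=1$, $D\circ\alpha=0$. Set $F:T_X\oplus T_X^\vee\to\pi^*V\oplus\pi^*T_M\oplus\pi^*V^\vee\oplus\pi^*T_M^\vee$,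 $F(w+\xi)=(Dw,d\pi\,w,j^\vee\xi,\alpha^\vee\xi)$. A generalized almost complex structure on $X$ is $\nabla$-lifted if it is $\mathcal{J}=F^{-1}(\pi^*\underline{\mathcal{J}})F$ for a generalized almost complex structure $\underline{\mathcal{J}}$ on $V\oplus T_M$, and adapted if $\underline{\mathcal{J}}(V\oplus V^\vee)=T_M\oplus T_M^\vee$. Let $\hat\pi:\widehat X=\mathrm{tot}(V^\vee)\to M$, and let $\widehat D$ and $\widehat F:T_{\widehat X}\oplus T_{\widehat X}^\vee\to\hat\pi^*V^\vee\oplus\hat\pi^*T_M\oplus\hat\pi^*V\oplus\hat\pi^*T_M^\vee$ be obtained by the same construction from $(V^\vee,\nabla^\vee)$. The mirror of $\mathcal{J}=F^{-1}(\pi^*\underline{\mathcal{J}})F$ is $\widehat{\mathcal{J}}=\widehat F^{-1}(\hat\pi^*\widehat{\underline{\mathcal{J}}})\widehat F$ with $\widehat{\underline{\mathcal{J}}}=\tau\underline{\mathcal{J}}\tau^{-1}$, where $\tau:V\oplus T_M\oplus V^\vee\oplus T_M^\vee\to V^\vee\oplus T_M\oplus V\oplus T_M^\vee$ interchanges $V$ and $V^\vee$; likewise for $\mathcal{J}'$. Vertical coordinates adapted to a flat connection $\nabla$: for a local frame $e_\alpha$ of $V$ with $\nabla e_\alpha=0$, $y^\alpha$ are the fiber coordinates on $X$ with respect to $e_\alpha$, and $\hat y^\alpha$ those on $\widehat X$ with respect to the dual frame. The functions $x^i$ on $X$ and $\widehat X$ mean $x^i\circ\pi$ and $x^i\circ\hat\pi$.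 The coefficient matrices are those of the corresponding maps $T\to T^\vee$ in these coordinates. *)

theory Defs
  imports "HOL-Analysis.Analysis"
begin

text \<open>
  Conventions.

  A manifold is given by its atlas, the topology being the one induced by the atlas.

  A vector bundle with typical fibre \<open>'v\<close> is given by its local trivialisations. The fibre over
  every point \<open>p\<close> is the vector space \<open>'v\<close>, and a local trivialisation over \<open>U\<close> is a family of linear
  automorphisms \<open>\<Phi> p\<close> of \<open>'v\<close> for \<open>p \<in> U\<close>, read as \<open>E\<^sub>p \<rightarrow> 'v\<close>. No regularity of \<open>\<Phi> p\<close> in \<open>p\<close> is
  required, only the transition maps are smooth; so the identification of the fibres with \<open>'v\<close> is
  merely a choice of a basis in each fibre, which exists for every vector bundle and has
  no relation to its topology.

  The tangent space at \<open>p\<close> is likewise the model space of the manifold, a tangent vector being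
  represented by its components in one chart chosen at \<open>p\<close>.

  A functional on a Euclidean fibre \<open>'v\<close> is represented by the vector \<open>f\<close> with
  \<open>f(v) = f \<bullet> v\<close>. Thus the dual fibre is again \<open>'v\<close>, the double dual is the bundle itself,
  and the dual (transpose) of a linear map is its \<open>adjoint\<close>.
\<close>

section \<open>Smooth functions and manifolds\<close>

text \<open>The two notions below are meant for open sets \<open>S\<close>.\<close>

primrec Ck_on :: "nat \<Rightarrow> 'a::real_normed_vector set \<Rightarrow> ('a \<Rightarrow> 'c::real_normed_vector) \<Rightarrow> bool" where
  "Ck_on 0 S f = continuous_on S f"
| "Ck_on (Suc k) S f = ((\<forall>x\<in>S. f differentiable (at x)) \<and>
     (\<forall>v. Ck_on k S (\<lambda>x. frechet_derivative f (at x) v)))"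

definition smooth_on :: "'a::real_normed_vector set \<Rightarrow> ('a \<Rightarrow> 'c::real_normed_vector) \<Rightarrow> bool" where
  "smooth_on S f \<longleftrightarrow> (\<forall>k. Ck_on k S f)"

type_synonym ('m, 'b) chart = "'m set \<times> ('m \<Rightarrow> 'b)"
type_synonym ('m, 'b) atlas = "('m, 'b) chart set"

definition carrier_of :: "('m, 'b) atlas \<Rightarrow> 'm set" where
  "carrier_of A = \<Union>(fst ` A)"

definition smooth_atlas :: "('m, 'b::euclidean_space) atlas \<Rightarrow> bool" where
  "smooth_atlas A \<longleftrightarrow>
     (\<forall>(U, \<phi>)\<in>A. inj_on \<phi> U \<and> open (\<phi> ` U)) \<and>
     (\<forall>(U, \<phi>)\<in>A. \<forall>(U', \<psi>)\<in>A. open (\<phi> ` (U \<inter> U')) \<and> smooth_on (\<phi> ` (U \<inter> U')) (\<psi> \<circ> inv_into U \<phi>))"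

definition mtop :: "('m, 'b::euclidean_space) atlas \<Rightarrow> 'm topology" where
  "mtop A = topology (\<lambda>S. S \<subseteq> carrier_of A \<and> (\<forall>(U, \<phi>)\<in>A. open (\<phi> ` (S \<inter> U))))"

lemma openin_mtop:
  assumes "smooth_atlas A"
  shows "openin (mtop A) S \<longleftrightarrow> S \<subseteq> carrier_of A \<and> (\<forall>(U, \<phi>)\<in>A. open (\<phi> ` (S \<inter> U)))"
proof -
  have inj: "inj_on \<phi> U" if "(U, \<phi>) \<in> A" for U \<phi>
    using assms that unfolding smooth_atlas_def by blast
  have "istopology (\<lambda>S. S \<subseteq> carrier_of A \<and> (\<forall>(U, \<phi>)\<in>A. open (\<phi> ` (S \<inter> U))))"
    unfolding istopology_def
  proof (intro conjI allI impI)
    fix S T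
    assume S: "S \<subseteq> carrier_of A \<and> (\<forall>(U, \<phi>)\<in>A. open (\<phi> ` (S \<inter> U)))"
      and T: "T \<subseteq> carrier_of A \<and> (\<forall>(U, \<phi>)\<in>A. open (\<phi> ` (T \<inter> U)))"
    show "S \<inter> T \<subseteq> carrier_of A" using S by blast
    show "\<forall>(U, \<phi>)\<in>A. open (\<phi> ` (S \<inter> T \<inter> U))"
    proof safe
      fix U \<phi> assume c: "(U, \<phi>) \<in> A"
      have "\<phi> ` (S \<inter> T \<inter> U) = \<phi> ` (S \<inter> U) \<inter> \<phi> ` (T \<inter> U)"
        using inj[OF c] by (auto simp: inj_on_def)
      then show "open (\<phi> ` (S \<inter> T \<inter> U))" using S T c by auto
    qed
  next
    fix K assume K: "\<forall>S\<in>K. S \<subseteq> carrier_of A \<and> (\<forall>(U, \<phi>)\<in>A. open (\<phi> ` (S \<inter> U)))"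
    show "\<Union>K \<subseteq> carrier_of A" using K by blast
    show "\<forall>(U, \<phi>)\<in>A. open (\<phi> ` (\<Union>K \<inter> U))"
    proof safe
      fix U \<phi> assume c: "(U, \<phi>) \<in> A"
      have "\<phi> ` (\<Union>K \<inter> U) = (\<Union>S\<in>K. \<phi> ` (S \<inter> U))" by blast
      moreover have "open (\<Union>S\<in>K. \<phi> ` (S \<inter> U))" using K c by blast
      ultimately show "open (\<phi> ` (\<Union>K \<inter> U))" by simp
    qed
  qed
  then show ?thesis by (simp add: mtop_def)
qed

definition smooth_manifold :: "('m, 'b::euclidean_space) atlas \<Rightarrow> bool" where
  "smooth_manifold A \<longleftrightarrow> smooth_atlas A \<and> Hausdorff_space (mtop A) \<and> second_countable (mtop A)"

text \<open>Charts of the maximal atlas.\<close>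

definition smooth_chart :: "('m, 'b::euclidean_space) atlas \<Rightarrow> ('m, 'b) chart \<Rightarrow> bool" where
  "smooth_chart A c \<longleftrightarrow> fst c \<subseteq> carrier_of A \<and> smooth_atlas (insert c A)"

definition smooth_fun ::
  "('m, 'b::euclidean_space) atlas \<Rightarrow> 'm set \<Rightarrow> ('m \<Rightarrow> 'c::real_normed_vector) \<Rightarrow> bool" where
  "smooth_fun A U f \<longleftrightarrow> (\<forall>(U', \<phi>)\<in>A. smooth_on (\<phi> ` (U \<inter> U')) (f \<circ> inv_into U' \<phi>))"

section \<open>Tangent vectors\<close>

definition chart_at :: "('m, 'b) atlas \<Rightarrow> 'm \<Rightarrow> ('m, 'b) chart" where
  "chart_at A p = (SOME c. c \<in> A \<and> p \<in> fst c)"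

text \<open>The differential at \<open>p\<close> of a vector-valued function, on tangent vectors represented in
  \<open>chart_at A p\<close>; and the tangent map of a map between manifolds.\<close>

definition mdiff ::
  "('m, 'b::euclidean_space) atlas \<Rightarrow> ('m \<Rightarrow> 'c::real_normed_vector) \<Rightarrow> 'm \<Rightarrow> 'b \<Rightarrow> 'c" where
  "mdiff A f p =
     (case chart_at A p of (U, \<phi>) \<Rightarrow> frechet_derivative (f \<circ> inv_into U \<phi>) (at (\<phi> p)))"

definition tangent_map ::
  "('x, 'd::euclidean_space) atlas \<Rightarrow> ('m, 'b::euclidean_space) atlas \<Rightarrow> ('x \<Rightarrow> 'm) \<Rightarrow> 'x \<Rightarrow> 'd \<Rightarrow> 'b"
  where "tangent_map X A f x = mdiff X (snd (chart_at A (f x)) \<circ> f) x"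

section \<open>Vector bundles\<close>

type_synonym ('m, 'v) vbundle = "('m set \<times> ('m \<Rightarrow> 'v \<Rightarrow> 'v)) set"

definition vector_bundle ::
  "('m, 'b::euclidean_space) atlas \<Rightarrow> ('m, 'v::euclidean_space) vbundle \<Rightarrow> bool" where
  "vector_bundle A E \<longleftrightarrow>
     \<Union>(fst ` E) = carrier_of A \<and>
     (\<forall>(U, \<Phi>)\<in>E. openin (mtop A) U \<and> (\<forall>p\<in>U. linear (\<Phi> p) \<and> bij (\<Phi> p))) \<and>
     (\<forall>(U, \<Phi>)\<in>E. \<forall>(U', \<Psi>)\<in>E. \<forall>v. smooth_fun A (U \<inter> U') (\<lambda>p. \<Psi> p (inv (\<Phi> p) v)))"

definition triv_at :: "('m, 'v) vbundle \<Rightarrow> 'm \<Rightarrow> 'm set \<times> ('m \<Rightarrow> 'v \<Rightarrow> 'v)" where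
  "triv_at E p = (SOME c. c \<in> E \<and> p \<in> fst c)"

definition tangent_bundle :: "('m, 'b::euclidean_space) atlas \<Rightarrow> ('m, 'b) vbundle" where
  "tangent_bundle A = (\<lambda>(U, \<phi>). (U, mdiff A \<phi>)) ` A"

definition dual_bundle :: "('m, 'v::euclidean_space) vbundle \<Rightarrow> ('m, 'v) vbundle" where
  "dual_bundle E = (\<lambda>(U, \<Phi>). (U, \<lambda>p. inv (adjoint (\<Phi> p)))) ` E"

definition sum_bundle :: "('m, 'v) vbundle \<Rightarrow> ('m, 'w) vbundle \<Rightarrow> ('m, 'v \<times> 'w) vbundle" where
  "sum_bundle E E' = {(U \<inter> U', \<lambda>p. map_prod (\<Phi> p) (\<Psi> p)) | U \<Phi> U' \<Psi>. (U, \<Phi>) \<in> E \<and> (U', \<Psi>) \<in> E'}"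

definition smooth_section ::
  "('m, 'b::euclidean_space) atlas \<Rightarrow> 'm set \<Rightarrow> ('m, 'v::euclidean_space) vbundle \<Rightarrow> ('m \<Rightarrow> 'v) \<Rightarrow> bool" where
  "smooth_section A U E s \<longleftrightarrow> (\<forall>(U', \<Phi>)\<in>E. smooth_fun A (U \<inter> U') (\<lambda>p. \<Phi> p (s p)))"

definition smooth_hom ::
  "('m, 'b::euclidean_space) atlas \<Rightarrow> 'm set \<Rightarrow> ('m, 'v::euclidean_space) vbundle \<Rightarrow>
   ('m, 'w::euclidean_space) vbundle \<Rightarrow> ('m \<Rightarrow> 'v \<Rightarrow> 'w) \<Rightarrow> bool" where
  "smooth_hom A U E E' L \<longleftrightarrow>
     (\<forall>p\<in>U. linear (L p)) \<and>
     (\<forall>(U1, \<Phi>)\<in>E. \<forall>(U2, \<Psi>)\<in>E'. \<forall>v.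
        smooth_fun A (U \<inter> U1 \<inter> U2) (\<lambda>p. \<Psi> p (L p (inv (\<Phi> p) v))))"

definition local_frame ::
  "('m, 'b::euclidean_space) atlas \<Rightarrow> 'm set \<Rightarrow> ('m, 'v::euclidean_space) vbundle \<Rightarrow>
   ('i \<Rightarrow> 'm \<Rightarrow> 'v) \<Rightarrow> bool" where
  "local_frame A U E e \<longleftrightarrow>
     (\<forall>a. smooth_section A U E (e a)) \<and>
     (\<forall>p\<in>U. inj (\<lambda>a. e a p) \<and> independent (range (\<lambda>a. e a p)) \<and> span (range (\<lambda>a. e a p)) = UNIV)"

section \<open>Connections\<close>

text \<open>\<open>N s p w\<close> is the derivative at \<open>p\<close> of the local section \<open>s\<close> in the direction \<open>w\<close>. The third
  clause makes it depend only on \<open>s\<close> near \<open>p\<close>, so that \<open>N\<close> acts on local sections.\<close>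

type_synonym ('m, 'b, 'v) conn = "('m \<Rightarrow> 'v) \<Rightarrow> 'm \<Rightarrow> 'b \<Rightarrow> 'v"

definition connection ::
  "('m, 'b::euclidean_space) atlas \<Rightarrow> ('m, 'v::euclidean_space) vbundle \<Rightarrow> ('m, 'b, 'v) conn \<Rightarrow> bool" where
  "connection A E N \<longleftrightarrow> (\<forall>U. openin (mtop A) U \<longrightarrow>
     (\<forall>s. smooth_section A U E s \<longrightarrow> smooth_hom A U (tangent_bundle A) E (N s)) \<and>
     (\<forall>s t. smooth_section A U E s \<and> smooth_section A U E t \<longrightarrow>
        (\<forall>p\<in>U. \<forall>w. N (\<lambda>q. s q + t q) p w = N s p w + N t p w)) \<and>
     (\<forall>s t. smooth_section A U E s \<and> smooth_section A U E t \<and> (\<forall>q\<in>U. s q = t q) \<longrightarrow>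
        (\<forall>p\<in>U. \<forall>w. N s p w = N t p w)) \<and>
     (\<forall>f s. smooth_fun A U f \<and> smooth_section A U E s \<longrightarrow>
        (\<forall>p\<in>U. \<forall>w. N (\<lambda>q. f q *\<^sub>R s q) p w = mdiff A f p w *\<^sub>R s p + f p *\<^sub>R N s p w)))"

definition dual_connection ::
  "('m, 'b::euclidean_space) atlas \<Rightarrow> ('m, 'v::euclidean_space) vbundle \<Rightarrow> ('m, 'b, 'v) conn \<Rightarrow>
   ('m, 'b, 'v) conn" where
  "dual_connection A E N f p w =
     (THE u. \<forall>U s. openin (mtop A) U \<and> p \<in> U \<and> smooth_section A U E s \<longrightarrow>
        u \<bullet> s p = mdiff A (\<lambda>q. f q \<bullet> s q) p w - f p \<bullet> N s p w)"

definition lie_bracket ::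
  "('m, 'b::euclidean_space) atlas \<Rightarrow> ('m \<Rightarrow> 'b) \<Rightarrow> ('m \<Rightarrow> 'b) \<Rightarrow> 'm \<Rightarrow> 'b" where
  "lie_bracket A P Q p = (let \<phi> = snd (chart_at A p) in
     mdiff A (\<lambda>q. mdiff A \<phi> q (Q q)) p (P p) - mdiff A (\<lambda>q. mdiff A \<phi> q (P q)) p (Q p))"

definition flat_connection ::
  "('m, 'b::euclidean_space) atlas \<Rightarrow> ('m, 'v::euclidean_space) vbundle \<Rightarrow> ('m, 'b, 'v) conn \<Rightarrow> bool" where
  "flat_connection A E N \<longleftrightarrow>
     (\<forall>U P Q s. openin (mtop A) U \<and> smooth_section A U (tangent_bundle A) P \<and>
        smooth_section A U (tangent_bundle A) Q \<and> smooth_section A U E s \<longrightarrow>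
        (\<forall>p\<in>U. N (\<lambda>q. N s q (Q q)) p (P p) - N (\<lambda>q. N s q (P q)) p (Q p)
               - N s p (lie_bracket A P Q p) = 0))"

section \<open>The total space and the splitting of its tangent bundle\<close>

definition total_space ::
  "('m, 'b::euclidean_space) atlas \<Rightarrow> ('m, 'v::euclidean_space) vbundle \<Rightarrow> ('m \<times> 'v, 'b \<times> 'v) atlas" where
  "total_space A E =
     {((U \<inter> U') \<times> UNIV, \<lambda>(p, v). (\<phi> p, \<Phi> p v)) | U \<phi> U' \<Phi>. (U, \<phi>) \<in> A \<and> (U', \<Phi>) \<in> E}"

definition dproj ::
  "('m, 'b::euclidean_space) atlas \<Rightarrow> ('m, 'v::euclidean_space) vbundle \<Rightarrow> 'm \<times> 'v \<Rightarrow> 'b \<times> 'v \<Rightarrow> 'b" where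
  "dproj A E = tangent_map (total_space A E) A fst"

definition vert ::
  "('m, 'b::euclidean_space) atlas \<Rightarrow> ('m, 'v::euclidean_space) vbundle \<Rightarrow> 'm \<times> 'v \<Rightarrow> 'v \<Rightarrow> 'b \<times> 'v" where
  "vert A E x u =
     vector_derivative (\<lambda>t. snd (chart_at (total_space A E) x) (fst x, snd x + t *\<^sub>R u)) (at 0)"

text \<open>The pullback of the connection to the total space, on sections \<open>s\<close> of the pulled back bundle:
  with a local frame \<open>e\<^sub>b = \<Phi>\<^sup>-\<^sup>1 b\<close> of the bundle and \<open>s = \<Sum>\<^sub>b s\<^sup>b \<pi>\<^sup>* e\<^sub>b\<close>, it is
  \<open>\<Sum>\<^sub>b (ds\<^sup>b(w) \<pi>\<^sup>* e\<^sub>b + s\<^sup>b \<nabla>\<^bsub>d\<pi>(w)\<^esub> e\<^sub>b)\<close>.\<close>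

definition pullback_connection ::
  "('m, 'b::euclidean_space) atlas \<Rightarrow> ('m, 'v::euclidean_space) vbundle \<Rightarrow> ('m, 'b, 'v) conn \<Rightarrow>
   ('m \<times> 'v, 'b \<times> 'v, 'v) conn" where
  "pullback_connection A E N s x w = (let p = fst x; \<Phi> = snd (triv_at E p) in
     inv (\<Phi> p) (mdiff (total_space A E) (\<lambda>z. \<Phi> (fst z) (s z)) x w)
     + (\<Sum>b\<in>Basis. (\<Phi> p (s x) \<bullet> b) *\<^sub>R N (\<lambda>q. inv (\<Phi> q) b) p (dproj A E x w)))"

text \<open>The tautological section is \<open>snd\<close>.\<close>

definition vproj ::
  "('m, 'b::euclidean_space) atlas \<Rightarrow> ('m, 'v::euclidean_space) vbundle \<Rightarrow> ('m, 'b, 'v) conn \<Rightarrow>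
   'm \<times> 'v \<Rightarrow> 'b \<times> 'v \<Rightarrow> 'v" where
  "vproj A E N = pullback_connection A E N snd"

definition hlift ::
  "('m, 'b::euclidean_space) atlas \<Rightarrow> ('m, 'v::euclidean_space) vbundle \<Rightarrow> ('m, 'b, 'v) conn \<Rightarrow>
   'm \<times> 'v \<Rightarrow> 'b \<Rightarrow> 'b \<times> 'v" where
  "hlift A E N x = (THE \<alpha>. linear \<alpha> \<and> (\<forall>t. dproj A E x (\<alpha> t) = t) \<and> (\<forall>t. vproj A E N x (\<alpha> t) = 0))"

text \<open>The summands \<open>V \<oplus> TM \<oplus> V\<^sup>\<or> \<oplus> TM\<^sup>\<or>\<close> are grouped as \<open>(V \<oplus> TM) \<oplus> (V \<oplus> TM)\<^sup>\<or>\<close>.\<close>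

definition splitting ::
  "('m, 'b::euclidean_space) atlas \<Rightarrow> ('m, 'v::euclidean_space) vbundle \<Rightarrow> ('m, 'b, 'v) conn \<Rightarrow>
   'm \<times> 'v \<Rightarrow> ('b \<times> 'v) \<times> ('b \<times> 'v) \<Rightarrow> ('v \<times> 'b) \<times> ('v \<times> 'b)" where
  "splitting A E N x = (\<lambda>(w, \<xi>).
     ((vproj A E N x w, dproj A E x w), (adjoint (vert A E x) \<xi>, adjoint (hlift A E N x) \<xi>)))"

section \<open>Generalized almost complex structures and generalized almost Kaehler pairs\<close>

definition gen_pairing :: "'w::euclidean_space \<times> 'w \<Rightarrow> 'w \<times> 'w \<Rightarrow> real" where
  "gen_pairing = (\<lambda>(v, f) (w, k). (f \<bullet> w + k \<bullet> v) / 2)"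

definition gen_almost_complex ::
  "('m, 'b::euclidean_space) atlas \<Rightarrow> ('m, 'w::euclidean_space) vbundle \<Rightarrow>
   ('m \<Rightarrow> 'w \<times> 'w \<Rightarrow> 'w \<times> 'w) \<Rightarrow> bool" where
  "gen_almost_complex A W J \<longleftrightarrow>
     smooth_hom A (carrier_of A) (sum_bundle W (dual_bundle W)) (sum_bundle W (dual_bundle W)) J \<and>
     (\<forall>p\<in>carrier_of A. bij (J p) \<and>
        (\<forall>x y. gen_pairing (J p x) (J p y) = gen_pairing x y) \<and> (\<forall>x. J p (J p x) = - x))"

definition gen_metric ::
  "('m \<Rightarrow> 'w::euclidean_space \<times> 'w \<Rightarrow> 'w \<times> 'w) \<Rightarrow> ('m \<Rightarrow> 'w \<times> 'w \<Rightarrow> 'w \<times> 'w) \<Rightarrow>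
   'm \<Rightarrow> 'w \<times> 'w \<Rightarrow> 'w \<times> 'w" where
  "gen_metric J J' p x = - J p (J' p x)"

definition gen_almost_kaehler ::
  "('m, 'b::euclidean_space) atlas \<Rightarrow> ('m \<Rightarrow> 'b \<times> 'b \<Rightarrow> 'b \<times> 'b) \<Rightarrow> ('m \<Rightarrow> 'b \<times> 'b \<Rightarrow> 'b \<times> 'b) \<Rightarrow> bool" where
  "gen_almost_kaehler A J J' \<longleftrightarrow>
     gen_almost_complex A (tangent_bundle A) J \<and> gen_almost_complex A (tangent_bundle A) J' \<and>
     (\<forall>p\<in>carrier_of A.
        (\<forall>x. J p (J' p x) = J' p (J p x)) \<and>
        (\<forall>x y. gen_pairing (gen_metric J J' p x) y = gen_pairing (gen_metric J J' p y) x) \<and>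
        (\<forall>x. x \<noteq> 0 \<longrightarrow> gen_pairing (gen_metric J J' p x) x > 0))"

text \<open>\<open>g\<close> and \<open>b\<close> are maps from a tangent space to its dual, so \<open>g v \<bullet> w\<close> is the value of the bilinear
  form at \<open>(v, w)\<close>.\<close>

definition metric_and_form ::
  "('w::euclidean_space \<times> 'w \<Rightarrow> 'w \<times> 'w) \<Rightarrow> ('w \<Rightarrow> 'w) \<Rightarrow> ('w \<Rightarrow> 'w) \<Rightarrow> bool" where
  "metric_and_form G g b \<longleftrightarrow>
     linear g \<and> (\<forall>v w. g v \<bullet> w = g w \<bullet> v) \<and> (\<forall>v. v \<noteq> 0 \<longrightarrow> g v \<bullet> v > 0) \<and>
     linear b \<and> (\<forall>v w. b v \<bullet> w = - (b w \<bullet> v)) \<and>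
     {x. G x = x} = range (\<lambda>v. (v, g v + b v))"

definition metric_of ::
  "('m \<Rightarrow> 'w::euclidean_space \<times> 'w \<Rightarrow> 'w \<times> 'w) \<Rightarrow> ('m \<Rightarrow> 'w \<times> 'w \<Rightarrow> 'w \<times> 'w) \<Rightarrow> 'm \<Rightarrow> 'w \<Rightarrow> 'w" where
  "metric_of J J' p = (THE g. \<exists>b. metric_and_form (gen_metric J J' p) g b)"

definition form_of ::
  "('m \<Rightarrow> 'w::euclidean_space \<times> 'w \<Rightarrow> 'w \<times> 'w) \<Rightarrow> ('m \<Rightarrow> 'w \<times> 'w \<Rightarrow> 'w \<times> 'w) \<Rightarrow> 'm \<Rightarrow> 'w \<Rightarrow> 'w" where
  "form_of J J' p = (THE b. \<exists>g. metric_and_form (gen_metric J J' p) g b)"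

section \<open>Lifted, adapted and mirror structures\<close>

definition lift ::
  "('m, 'b::euclidean_space) atlas \<Rightarrow> ('m, 'v::euclidean_space) vbundle \<Rightarrow> ('m, 'b, 'v) conn \<Rightarrow>
   ('m \<Rightarrow> ('v \<times> 'b) \<times> ('v \<times> 'b) \<Rightarrow> ('v \<times> 'b) \<times> ('v \<times> 'b)) \<Rightarrow>
   'm \<times> 'v \<Rightarrow> ('b \<times> 'v) \<times> ('b \<times> 'v) \<Rightarrow> ('b \<times> 'v) \<times> ('b \<times> 'v)" where
  "lift A E N K x = inv (splitting A E N x) \<circ> K (fst x) \<circ> splitting A E N x"

definition lifted_from ::
  "('m, 'b::euclidean_space) atlas \<Rightarrow> ('m, 'v::euclidean_space) vbundle \<Rightarrow> ('m, 'b, 'v) conn \<Rightarrow>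
   ('m \<times> 'v \<Rightarrow> ('b \<times> 'v) \<times> ('b \<times> 'v) \<Rightarrow> ('b \<times> 'v) \<times> ('b \<times> 'v)) \<Rightarrow>
   ('m \<Rightarrow> ('v \<times> 'b) \<times> ('v \<times> 'b) \<Rightarrow> ('v \<times> 'b) \<times> ('v \<times> 'b)) \<Rightarrow> bool" where
  "lifted_from A E N J K \<longleftrightarrow>
     gen_almost_complex A (sum_bundle E (tangent_bundle A)) K \<and>
     (\<forall>x\<in>carrier_of (total_space A E). J x = lift A E N K x)"

definition adapted ::
  "('m, 'b::euclidean_space) atlas \<Rightarrow>
   ('m \<Rightarrow> ('v::euclidean_space \<times> 'b) \<times> ('v \<times> 'b) \<Rightarrow> ('v \<times> 'b) \<times> ('v \<times> 'b)) \<Rightarrow> bool" where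
  "adapted A K \<longleftrightarrow>
     (\<forall>p\<in>carrier_of A. K p ` range (\<lambda>(v, f). ((v, 0), (f, 0))) = range (\<lambda>(t, k). ((0, t), (0, k))))"

definition swap_fibre :: "('v \<times> 'b) \<times> ('v \<times> 'b) \<Rightarrow> ('v \<times> 'b) \<times> ('v \<times> 'b)" where
  "swap_fibre = (\<lambda>((v, t), (f, k)). ((f, t), (v, k)))"

definition mirror_base ::
  "('m \<Rightarrow> ('v \<times> 'b) \<times> ('v \<times> 'b) \<Rightarrow> ('v \<times> 'b) \<times> ('v \<times> 'b)) \<Rightarrow>
   'm \<Rightarrow> ('v \<times> 'b) \<times> ('v \<times> 'b) \<Rightarrow> ('v \<times> 'b) \<times> ('v \<times> 'b)" where
  "mirror_base K p = swap_fibre \<circ> K p \<circ> inv swap_fibre"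

definition mirror ::
  "('m, 'b::euclidean_space) atlas \<Rightarrow> ('m, 'v::euclidean_space) vbundle \<Rightarrow> ('m, 'b, 'v) conn \<Rightarrow>
   ('m \<Rightarrow> ('v \<times> 'b) \<times> ('v \<times> 'b) \<Rightarrow> ('v \<times> 'b) \<times> ('v \<times> 'b)) \<Rightarrow>
   'm \<times> 'v \<Rightarrow> ('b \<times> 'v) \<times> ('b \<times> 'v) \<Rightarrow> ('b \<times> 'v) \<times> ('b \<times> 'v)" where
  "mirror A E N K = lift A (dual_bundle E) (dual_connection A E N) (mirror_base K)"

section \<open>Fibre coordinates of a frame\<close>

definition dual_frame :: "('i \<Rightarrow> 'm \<Rightarrow> 'v::euclidean_space) \<Rightarrow> 'i \<Rightarrow> 'm \<Rightarrow> 'v" where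
  "dual_frame e a p = (THE f. \<forall>c. f \<bullet> e c p = (if a = c then 1 else 0))"

definition fibre_coord :: "('i::finite \<Rightarrow> 'm \<Rightarrow> 'v::euclidean_space) \<Rightarrow> 'm \<times> 'v \<Rightarrow> real ^ 'i" where
  "fibre_coord e x = (THE y. snd x = (\<Sum>a\<in>UNIV. (y $ a) *\<^sub>R e a (fst x)))"

text \<open>The value of the bilinear form \<open>P\<^sub>i\<^sub>j(x) dx\<^sup>i dx\<^sup>j + Q\<^sub>\<alpha>\<^sub>\<beta>(x) dy\<^sup>\<alpha> dy\<^sup>\<beta>\<close> on the
  total space, as a map from the tangent space at \<open>z\<close> to its dual, evaluated at \<open>w\<close> and then at \<open>w'\<close>.
  Here \<open>x\<close> is \<open>\<xi> \<circ> fst\<close> and \<open>y\<close> are the fibre coordinates of the frame \<open>e\<close>.\<close>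

definition coord_form ::
  "('m, 'b::euclidean_space) atlas \<Rightarrow> ('m, 'v::euclidean_space) vbundle \<Rightarrow> ('m \<Rightarrow> real ^ 'n) \<Rightarrow>
   ('r::finite \<Rightarrow> 'm \<Rightarrow> 'v) \<Rightarrow> (real ^ 'n \<Rightarrow> real ^ 'n ^ 'n) \<Rightarrow> (real ^ 'n \<Rightarrow> real ^ 'r ^ 'r) \<Rightarrow>
   'm \<times> 'v \<Rightarrow> 'b \<times> 'v \<Rightarrow> 'b \<times> 'v \<Rightarrow> real" where
  "coord_form A E \<xi> e P Q z w w' =
     (let x = \<xi> (fst z);
          dx = mdiff (total_space A E) (\<xi> \<circ> fst) z;
          dy = mdiff (total_space A E) (fibre_coord e) z
      in (\<Sum>i\<in>UNIV. \<Sum>j\<in>UNIV. P x $ i $ j * (dx w' $ i) * (dx w $ j))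
       + (\<Sum>a\<in>UNIV. \<Sum>c\<in>UNIV. Q x $ a $ c * (dy w' $ a) * (dy w $ c)))"

end

(* Put P = (D, d\<pi>) : T_X \<rightarrow> \<pi>^*(V \<oplus> T_M). The map F is P together with its inverse transpose, hence an
   isometry for the canonical pairings, and it is smooth with smooth inverse, because in a bundle chart
   P is (w, u) \<mapsto> (u + \<Gamma> w, w). So all claims about lifted structures reduce to linear algebra over a
   point of M. There G = -JJ' squares to 1, is self-adjoint for the pairing, and preserves V \<oplus> V^\<or> and
   T \<oplus> T^\<or> because J and J' exchange them, so G consists of two blocks [a b; c a^\<or>]. The +1 eigenspace of
   such a block is the graph of b\<^sup>-\<^sup>1 + a^\<or> b\<^sup>-\<^sup>1, and the mirror replaces the V-block (a, b, c) by
   (a^\<or>, c, b). In a flat frame D is the differential of the fibre coordinates, which gives the coordinate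
   expressions. *)
theory Submission
  imports Defs
begin

section \<open>Calculus of smooth functions\<close>

text \<open>Fibres and tangent spaces are identified with a model space by choices that need not
  vary continuously with the point, so a bundle map can be tested for smoothness only after
  conjugation with trivialisations. Composition, transposition, pairing and pullback of bundle maps
  therefore each need a smoothness proof. A second obstacle: \<open>dual_connection\<close>,
  \<open>hlift\<close>, \<open>metric_of\<close>, \<open>form_of\<close>, \<open>dual_frame\<close>
  and \<open>fibre_coord\<close> are definite descriptions, so existence and uniqueness must be
  settled before anything can be computed. The dual connection in particular must be shown to be a
  connection; then the mirror side is an instance of the statements about (V, \<nabla>) and needs no
  second proof. The inverses of the off-diagonal blocks in the formulas exist by positivity: V and
  its dual are isotropic, so for x in one of them the form (Gx, x) sees a single off-diagonal block,
  which is hence definite.\<close>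

text \<open>The predicate from which \<open>frechet_derivative\<close> chooses is the same for both
  functions, so the chosen maps agree even where neither function is differentiable.\<close>

lemma frechet_derivative_cong_open:
  assumes "open S" "x \<in> S" "\<And>y. y \<in> S \<Longrightarrow> f y = g y"
  shows "frechet_derivative f (at x) = frechet_derivative g (at x)"
proof -
  have "(f has_derivative D) (at x) \<longleftrightarrow> (g has_derivative D) (at x)" for D
    using has_derivative_transform_within_open[OF _ assms(1,2)] assms(3) by metis
  then show ?thesis unfolding frechet_derivative_def by simp
qed

lemma Ck_on_subset: "Ck_on k S f \<Longrightarrow> T \<subseteq> S \<Longrightarrow> Ck_on k T f"
  by (induction k arbitrary: f) (auto intro: continuous_on_subset)

lemma Ck_on_cong:
  assumes "open S" "\<And>y. y \<in> S \<Longrightarrow> f y = g y" "Ck_on k S f"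
  shows "Ck_on k S g"
  using assms(2,3)
proof (induction k arbitrary: f g)
  case 0 then show ?case by (simp cong: continuous_on_cong)
next
  case (Suc k)
  have eq: "frechet_derivative f (at x) = frechet_derivative g (at x)" if "x \<in> S" for x
    using frechet_derivative_cong_open[OF assms(1) that] Suc.prems(1) by blast
  have "g differentiable (at x)" if "x \<in> S" for x
  proof -
    have "f differentiable (at x)" using Suc.prems(2) that by simp
    then show ?thesis
      unfolding differentiable_def
      using has_derivative_transform_within_open[OF _ assms(1) that] Suc.prems(1) by blast
  qed
  moreover have "Ck_on k S (\<lambda>x. frechet_derivative g (at x) v)" for v
    using Suc.IH[of "\<lambda>x. frechet_derivative f (at x) v"] Suc.prems(2) eq by simp
  ultimately show ?case by simp
qed

text \<open>Lets an induction work with an explicit formula for the derivative instead of the chosen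
  \<open>frechet_derivative\<close>; the two agree by uniqueness of derivatives.\<close>

lemma Ck_on_SucI:
  assumes "open S" "\<And>x. x \<in> S \<Longrightarrow> (f has_derivative f' x) (at x)"
    "\<And>v. Ck_on k S (\<lambda>x. f' x v)"
  shows "Ck_on (Suc k) S f"
proof -
  have "frechet_derivative f (at x) = f' x" if "x \<in> S" for x
    using frechet_derivative_at[OF assms(2)[OF that]] by simp
  then have "Ck_on k S (\<lambda>x. frechet_derivative f (at x) v)" for v
    using Ck_on_cong[OF assms(1) _ assms(3)] by simp
  then show ?thesis using assms(2) by (auto simp: differentiable_def)
qed

lemma Ck_on_SucD:
  assumes "Ck_on (Suc k) S f" "x \<in> S"
  shows "(f has_derivative frechet_derivative f (at x)) (at x)"
  using assms frechet_derivative_works by auto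

text \<open>Not immediate, since the successor clause of \<open>Ck_on\<close> does not mention the
  lower class: the induction passes to directional derivatives and ends with differentiability
  implying continuity.\<close>

lemma Ck_on_lower: "Ck_on (Suc k) S f \<Longrightarrow> Ck_on k S f"
proof (induction k arbitrary: f)
  case 0
  then show ?case
    by (auto intro!: continuous_at_imp_continuous_on differentiable_imp_continuous_within)
next
  case (Suc k)
  have "Ck_on k S (\<lambda>x. frechet_derivative f (at x) v)" for v
    using Suc.IH Suc.prems by simp
  then show ?case using Suc.prems by simp
qed

lemma Ck_on_const: "open S \<Longrightarrow> Ck_on k S (\<lambda>x. c)"
proof (induction k arbitrary: c)
  case (Suc k)
  then show ?case by (intro Ck_on_SucI[where f' = "\<lambda>x v. 0"]) auto
qed simp

lemma Ck_on_bounded_linear: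
  assumes "bounded_linear h" "open S" "Ck_on k S f"
  shows "Ck_on k S (\<lambda>x. h (f x))"
  using assms(3)
proof (induction k arbitrary: f)
  case 0 then show ?case using bounded_linear.continuous_on[OF assms(1)] by auto
next
  case (Suc k)
  show ?case
  proof (rule Ck_on_SucI[OF assms(2)])
    show "((\<lambda>x. h (f x)) has_derivative (\<lambda>v. h (frechet_derivative f (at x) v))) (at x)"
      if "x \<in> S" for x
      using bounded_linear.has_derivative[OF assms(1) Ck_on_SucD[OF Suc.prems that]] .
    show "Ck_on k S (\<lambda>x. h (frechet_derivative f (at x) v))" for v
      using Suc.IH Suc.prems by simp
  qed
qed

lemma Ck_on_linear_map:
  assumes "bounded_linear h" "open S"
  shows "Ck_on k S h"
proof (cases k)
  case 0 then show ?thesis using linear_continuous_on[OF assms(1)] by simp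
next
  case (Suc k)
  then show ?thesis
    using Ck_on_SucI[OF assms(2), of h "\<lambda>x. h"] bounded_linear.has_derivative[OF assms(1), of "\<lambda>x. x" "\<lambda>x. x"]
      Ck_on_const[OF assms(2)] by auto
qed

lemma Ck_on_add:
  assumes "open S" "Ck_on k S f" "Ck_on k S g"
  shows "Ck_on k S (\<lambda>x. f x + g x)"
  using assms(2,3)
proof (induction k arbitrary: f g)
  case 0 then show ?case by (auto intro: continuous_on_add)
next
  case (Suc k)
  show ?case
  proof (rule Ck_on_SucI[OF assms(1)])
    show "((\<lambda>x. f x + g x) has_derivative
        (\<lambda>v. frechet_derivative f (at x) v + frechet_derivative g (at x) v)) (at x)"
      if "x \<in> S" for x
      using has_derivative_add[OF Ck_on_SucD[OF Suc.prems(1) that] Ck_on_SucD[OF Suc.prems(2) that]] .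
    show "Ck_on k S (\<lambda>x. frechet_derivative f (at x) v + frechet_derivative g (at x) v)" for v
      using Suc.IH Suc.prems by simp
  qed
qed

text \<open>Each term of the product rule keeps one factor undifferentiated. That factor is one
  class better than required, and \<open>Ck_on_lower\<close> brings it down to the class of the
  induction hypothesis.\<close>

lemma Ck_on_bilinear:
  assumes "bounded_bilinear bil" "open S" "Ck_on k S f" "Ck_on k S g"
  shows "Ck_on k S (\<lambda>x. bil (f x) (g x))"
  using assms(3,4)
proof (induction k arbitrary: f g)
  case 0 then show ?case using bounded_bilinear.continuous_on[OF assms(1)] by auto
next
  case (Suc k)
  show ?case
  proof (rule Ck_on_SucI[OF assms(2)])
    show "((\<lambda>x. bil (f x) (g x)) has_derivative
        (\<lambda>v. bil (f x) (frechet_derivative g (at x) v) + bil (frechet_derivative f (at x) v) (g x))) (at x)"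
      if "x \<in> S" for x
      using bounded_bilinear.FDERIV[OF assms(1) Ck_on_SucD[OF Suc.prems(1) that]
          Ck_on_SucD[OF Suc.prems(2) that]] .
    show "Ck_on k S (\<lambda>x. bil (f x) (frechet_derivative g (at x) v)
        + bil (frechet_derivative f (at x) v) (g x))" for v
      using Suc.prems Ck_on_lower[OF Suc.prems(1)] Ck_on_lower[OF Suc.prems(2)]
      by (intro Ck_on_add[OF assms(2)] Suc.IH) auto
  qed
qed

lemma Ck_on_sum:
  assumes "open S" "\<And>i. i \<in> I \<Longrightarrow> Ck_on k S (f i)"
  shows "Ck_on k S (\<lambda>x. \<Sum>i\<in>I. f i x)"
  using assms(2)
proof (induction I rule: infinite_finite_induct)
  case (insert i I)
  then show ?case by (auto intro!: Ck_on_add[OF assms(1)])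
qed (auto simp: Ck_on_const[OF assms(1)])

text \<open>The hypothesis on \<open>g\<close> controls its derivative only in a fixed direction,
  whereas the chain rule evaluates it in the moving direction \<open>?f' x v\<close>. Expanding that
  direction in \<open>Basis\<close> leaves a finite sum of products of a scalar function with a
  composite to which the induction hypothesis applies; this is why the target of \<open>f\<close> is
  Euclidean.\<close>

lemma Ck_on_compose:
  fixes f :: "'a::real_normed_vector \<Rightarrow> 'b::euclidean_space"
  assumes "open S" "open T" "f ` S \<subseteq> T" "Ck_on k T g" "Ck_on k S f"
  shows "Ck_on k S (\<lambda>x. g (f x))"
  using assms(4,5)
proof (induction k arbitrary: g)
  case 0 then show ?case
    using continuous_on_compose2[of T g S f] assms(3) by auto
next
  case (Suc k)
  let ?g' = "\<lambda>y. frechet_derivative g (at y)"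
  let ?f' = "\<lambda>x. frechet_derivative f (at x)"
  show ?case
  proof (rule Ck_on_SucI[OF assms(1)])
    show "((\<lambda>x. g (f x)) has_derivative (\<lambda>v. \<Sum>b\<in>Basis. (?f' x v \<bullet> b) *\<^sub>R ?g' (f x) b)) (at x)"
      if "x \<in> S" for x
    proof -
      have f: "(f has_derivative ?f' x) (at x)" using Ck_on_SucD[OF Suc.prems(2) that] .
      have g: "(g has_derivative ?g' (f x)) (at (f x))"
        using Ck_on_SucD[OF Suc.prems(1)] that assms(3) by blast
      have lin: "linear (?g' (f x))" using has_derivative_linear[OF g] .
      have "?g' (f x) (?f' x v) = (\<Sum>b\<in>Basis. (?f' x v \<bullet> b) *\<^sub>R ?g' (f x) b)" for v
        by (subst euclidean_representation[of "?f' x v", symmetric])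
          (simp only: linear_sum[OF lin] linear_scale[OF lin])
      then show ?thesis using diff_chain_at[OF f g] by (simp add: o_def)
    qed
    show "Ck_on k S (\<lambda>x. \<Sum>b\<in>Basis. (?f' x v \<bullet> b) *\<^sub>R ?g' (f x) b)" for v
    proof (intro Ck_on_sum[OF assms(1)] Ck_on_bilinear[OF bounded_bilinear_scaleR assms(1)])
      fix b :: 'b
      show "Ck_on k S (\<lambda>x. ?f' x v \<bullet> b)"
        using Suc.prems(2) by (intro Ck_on_bounded_linear[OF bounded_linear_inner_left assms(1)]) simp
      show "Ck_on k S (\<lambda>x. ?g' (f x) b)"
        using Suc.prems Ck_on_lower[OF Suc.prems(2)] by (intro Suc.IH) auto
    qed
  qed
qed

lemma Ck_on_local:
  assumes "\<And>x. x \<in> S \<Longrightarrow> \<exists>T. open T \<and> x \<in> T \<and> Ck_on k T f"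
  shows "Ck_on k S f"
  using assms
proof (induction k arbitrary: f)
  case 0
  then have "isCont f x" if "x \<in> S" for x
    using 0[OF that] by (auto simp: continuous_on_eq_continuous_at)
  then show ?case by (simp add: continuous_at_imp_continuous_on)
next
  case (Suc k)
  have "f differentiable (at x)" if "x \<in> S" for x using Suc.prems[OF that] by auto
  moreover have "Ck_on k S (\<lambda>x. frechet_derivative f (at x) v)" for v
    using Suc.prems by (intro Suc.IH) (metis Ck_on.simps(2))
  ultimately show ?case by simp
qed

lemma smooth_on_subset: "smooth_on S f \<Longrightarrow> T \<subseteq> S \<Longrightarrow> smooth_on T f"
  by (auto simp: smooth_on_def intro: Ck_on_subset)

lemma smooth_on_cong:
  "open S \<Longrightarrow> (\<And>y. y \<in> S \<Longrightarrow> f y = g y) \<Longrightarrow> smooth_on S f \<Longrightarrow> smooth_on S g"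
  by (auto simp: smooth_on_def intro: Ck_on_cong)

lemma smooth_on_const: "open S \<Longrightarrow> smooth_on S (\<lambda>x. c)"
  by (simp add: smooth_on_def Ck_on_const)

lemma smooth_on_add:
  "open S \<Longrightarrow> smooth_on S f \<Longrightarrow> smooth_on S g \<Longrightarrow> smooth_on S (\<lambda>x. f x + g x)"
  by (simp add: smooth_on_def Ck_on_add)

lemma smooth_on_linear_map: "bounded_linear h \<Longrightarrow> open S \<Longrightarrow> smooth_on S h"
  by (simp add: smooth_on_def Ck_on_linear_map)

lemma smooth_on_bounded_linear:
  "bounded_linear h \<Longrightarrow> open S \<Longrightarrow> smooth_on S f \<Longrightarrow> smooth_on S (\<lambda>x. h (f x))"
  by (simp add: smooth_on_def Ck_on_bounded_linear)

lemma smooth_on_bilinear: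
  "bounded_bilinear bil \<Longrightarrow> open S \<Longrightarrow> smooth_on S f \<Longrightarrow> smooth_on S g \<Longrightarrow>
    smooth_on S (\<lambda>x. bil (f x) (g x))"
  by (simp add: smooth_on_def Ck_on_bilinear)

lemma smooth_on_compose:
  fixes f :: "'a::real_normed_vector \<Rightarrow> 'b::euclidean_space"
  shows "open S \<Longrightarrow> open T \<Longrightarrow> f ` S \<subseteq> T \<Longrightarrow> smooth_on T g \<Longrightarrow> smooth_on S f \<Longrightarrow>
    smooth_on S (\<lambda>x. g (f x))"
  unfolding smooth_on_def using Ck_on_compose by blast

lemma smooth_on_local:
  "(\<And>x. x \<in> S \<Longrightarrow> \<exists>T. open T \<and> x \<in> T \<and> smooth_on T f) \<Longrightarrow> smooth_on S f"
  unfolding smooth_on_def by (metis Ck_on_local)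

lemma smooth_on_frechet_derivative:
  "smooth_on S f \<Longrightarrow> smooth_on S (\<lambda>x. frechet_derivative f (at x) v)"
  unfolding smooth_on_def by (metis Ck_on.simps(2))

lemma smooth_on_has_derivative:
  "smooth_on S f \<Longrightarrow> x \<in> S \<Longrightarrow> (f has_derivative frechet_derivative f (at x)) (at x)"
  unfolding smooth_on_def using Ck_on_SucD by blast

section \<open>Smooth functions on manifolds\<close>

lemma smooth_atlas_transition:
  assumes "smooth_atlas A" "(U, \<phi>) \<in> A" "(U', \<psi>) \<in> A"
  shows "open (\<phi> ` (U \<inter> U'))" "smooth_on (\<phi> ` (U \<inter> U')) (\<psi> \<circ> inv_into U \<phi>)"
proof -
  have "\<forall>(U, \<phi>)\<in>A. \<forall>(U', \<psi>)\<in>A. open (\<phi> ` (U \<inter> U')) \<and> smooth_on (\<phi> ` (U \<inter> U')) (\<psi> \<circ> inv_into U \<phi>)"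
    using assms(1) unfolding smooth_atlas_def by blast
  from bspec[OF this assms(2)]
  have "\<forall>(U', \<psi>)\<in>A. open (\<phi> ` (U \<inter> U')) \<and> smooth_on (\<phi> ` (U \<inter> U')) (\<psi> \<circ> inv_into U \<phi>)"
    by simp
  from bspec[OF this assms(3)]
  show "open (\<phi> ` (U \<inter> U'))" "smooth_on (\<phi> ` (U \<inter> U')) (\<psi> \<circ> inv_into U \<phi>)" by simp_all
qed

lemma smooth_atlas_chart:
  assumes "smooth_atlas A" "(U, \<phi>) \<in> A"
  shows "inj_on \<phi> U" "open (\<phi> ` U)" "openin (mtop A) U"
proof -
  have "\<forall>(U, \<phi>)\<in>A. inj_on \<phi> U \<and> open (\<phi> ` U)"
    using assms(1) unfolding smooth_atlas_def by blast
  from bspec[OF this assms(2)] show "inj_on \<phi> U" "open (\<phi> ` U)" by simp_all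
  have "open (\<psi> ` (U \<inter> U'))" if "(U', \<psi>) \<in> A" for U' \<psi>
    using smooth_atlas_transition(1)[OF assms(1) that assms(2)] by (simp add: Int_commute)
  moreover have "U \<subseteq> carrier_of A" using assms(2) by (force simp: carrier_of_def)
  ultimately show "openin (mtop A) U" unfolding openin_mtop[OF assms(1)] by blast
qed

lemma openin_mtop_image:
  assumes "smooth_atlas A" "(U', \<phi>) \<in> A" "openin (mtop A) U"
  shows "open (\<phi> ` (U \<inter> U'))"
  using assms openin_mtop[OF assms(1), of U] by auto

lemma openin_mtop_carrier:
  assumes "smooth_atlas A" shows "openin (mtop A) (carrier_of A)"
proof -
  have "openin (mtop A) (\<Union>(fst ` A))"
    by (intro openin_Union) (use smooth_atlas_chart(3)[OF assms] in auto)
  then show ?thesis by (simp add: carrier_of_def)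
qed

lemma openin_mtop_subset:
  "smooth_atlas A \<Longrightarrow> openin (mtop A) U \<Longrightarrow> U \<subseteq> carrier_of A"
  by (simp add: openin_mtop)

lemma smooth_funD:
  "smooth_fun A U f \<Longrightarrow> (U', \<phi>) \<in> A \<Longrightarrow> smooth_on (\<phi> ` (U \<inter> U')) (f \<circ> inv_into U' \<phi>)"
  unfolding smooth_fun_def by blast

lemma smooth_fun_subset: "smooth_fun A U f \<Longrightarrow> W \<subseteq> U \<Longrightarrow> smooth_fun A W f"
  unfolding smooth_fun_def by (blast intro: smooth_on_subset)

lemma smooth_fun_cong:
  assumes A: "smooth_atlas A" and U: "openin (mtop A) U"
    and eq: "\<And>p. p \<in> U \<Longrightarrow> f p = g p" and f: "smooth_fun A U f"
  shows "smooth_fun A U g"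
  unfolding smooth_fun_def
proof (clarify)
  fix U' \<phi> assume c: "(U', \<phi>) \<in> A"
  show "smooth_on (\<phi> ` (U \<inter> U')) (g \<circ> inv_into U' \<phi>)"
  proof (rule smooth_on_cong[OF openin_mtop_image[OF A c U]])
    show "smooth_on (\<phi> ` (U \<inter> U')) (f \<circ> inv_into U' \<phi>)"
      using smooth_funD[OF f c] .
  qed (use eq smooth_atlas_chart(1)[OF A c] in auto)
qed

text \<open>Any other chart expression of \<open>f\<close> is the given one composed with a
  transition map of the atlas.\<close>

lemma smooth_fun_chartI:
  assumes A: "smooth_atlas A" and c: "(U', \<phi>) \<in> A" and U: "openin (mtop A) U" "U \<subseteq> U'"
    and f: "smooth_on (\<phi> ` U) (f \<circ> inv_into U' \<phi>)"
  shows "smooth_fun A U f"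
  unfolding smooth_fun_def
proof (clarify)
  fix U2 \<psi> assume c2: "(U2, \<psi>) \<in> A"
  note inj = smooth_atlas_chart(1)[OF A c] smooth_atlas_chart(1)[OF A c2]
  have op: "open (\<psi> ` (U \<inter> U2))" using openin_mtop_image[OF A c2 U(1)] .
  have op': "open (\<phi> ` U)" using openin_mtop_image[OF A c U(1)] U(2) by (simp add: Int_absorb2)
  have tr: "smooth_on (\<psi> ` (U \<inter> U2)) (\<phi> \<circ> inv_into U2 \<psi>)"
    by (rule smooth_on_subset[OF smooth_atlas_transition(2)[OF A c2 c]]) (use U(2) in auto)
  have "smooth_on (\<psi> ` (U \<inter> U2)) (\<lambda>y. (f \<circ> inv_into U' \<phi>) ((\<phi> \<circ> inv_into U2 \<psi>) y))"
    by (rule smooth_on_compose[OF op op' _ f tr]) (use inj in auto)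
  then show "smooth_on (\<psi> ` (U \<inter> U2)) (f \<circ> inv_into U2 \<psi>)"
    by (rule smooth_on_cong[OF op, rotated]) (use inj U(2) in auto)
qed

lemma smooth_fun_local:
  assumes A: "smooth_atlas A"
    and f: "\<And>p. p \<in> U \<Longrightarrow> \<exists>W. openin (mtop A) W \<and> p \<in> W \<and> smooth_fun A W f"
  shows "smooth_fun A U f"
  unfolding smooth_fun_def
proof (clarify)
  fix U' \<phi> assume c: "(U', \<phi>) \<in> A"
  show "smooth_on (\<phi> ` (U \<inter> U')) (f \<circ> inv_into U' \<phi>)"
  proof (rule smooth_on_local)
    fix x assume "x \<in> \<phi> ` (U \<inter> U')"
    then obtain p where p: "p \<in> U" "p \<in> U'" "x = \<phi> p" by auto
    obtain W where "openin (mtop A) W" "p \<in> W" "smooth_fun A W f" using f[OF p(1)] by blast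
    then show "\<exists>T. open T \<and> x \<in> T \<and> smooth_on T (f \<circ> inv_into U' \<phi>)"
      using p c openin_mtop_image[OF A c]
      by (intro exI[of _ "\<phi> ` (W \<inter> U')"]) (auto simp: smooth_fun_def)
  qed
qed

lemma smooth_fun_const: "smooth_atlas A \<Longrightarrow> openin (mtop A) U \<Longrightarrow> smooth_fun A U (\<lambda>p. c)"
  unfolding smooth_fun_def by (auto simp: o_def intro!: smooth_on_const openin_mtop_image)

lemma smooth_fun_add:
  "smooth_atlas A \<Longrightarrow> openin (mtop A) U \<Longrightarrow> smooth_fun A U f \<Longrightarrow> smooth_fun A U g \<Longrightarrow>
    smooth_fun A U (\<lambda>p. f p + g p)"
  unfolding smooth_fun_def by (auto simp: o_def split: prod.splits intro!: smooth_on_add openin_mtop_image)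

lemma smooth_fun_bounded_linear:
  "smooth_atlas A \<Longrightarrow> openin (mtop A) U \<Longrightarrow> bounded_linear h \<Longrightarrow> smooth_fun A U f \<Longrightarrow>
    smooth_fun A U (\<lambda>p. h (f p))"
  unfolding smooth_fun_def
  by (auto simp: o_def split: prod.splits intro!: smooth_on_bounded_linear[of h] openin_mtop_image)

lemma smooth_fun_bilinear:
  "smooth_atlas A \<Longrightarrow> openin (mtop A) U \<Longrightarrow> bounded_bilinear bil \<Longrightarrow> smooth_fun A U f \<Longrightarrow>
    smooth_fun A U g \<Longrightarrow> smooth_fun A U (\<lambda>p. bil (f p) (g p))"
  unfolding smooth_fun_def
  by (auto simp: o_def split: prod.splits intro!: smooth_on_bilinear[of bil] openin_mtop_image)

lemma smooth_fun_sum: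
  assumes "smooth_atlas A" "openin (mtop A) U" "\<And>i. i \<in> I \<Longrightarrow> smooth_fun A U (f i)"
  shows "smooth_fun A U (\<lambda>p. \<Sum>i\<in>I. f i p)"
  using assms(3)
proof (induction I rule: infinite_finite_induct)
  case (insert i I)
  then show ?case by (auto intro!: smooth_fun_add[OF assms(1,2)])
qed (auto simp: smooth_fun_const[OF assms(1,2)])

lemma smooth_fun_Pair:
  fixes f :: "'m \<Rightarrow> 'c::real_normed_vector" and g :: "'m \<Rightarrow> 'd::real_normed_vector"
  assumes "smooth_atlas A" "openin (mtop A) U" "smooth_fun A U f" "smooth_fun A U g"
  shows "smooth_fun A U (\<lambda>p. (f p, g p))"
proof -
  have "bounded_linear (\<lambda>a::'c. (a, 0::'d))" "bounded_linear (\<lambda>b::'d. (0::'c, b))"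
    by (auto intro!: bounded_linear_Pair bounded_linear_ident bounded_linear_zero)
  then have "smooth_fun A U (\<lambda>p. (f p, 0) + (0, g p))"
    using assms
    by (intro smooth_fun_add smooth_fun_bounded_linear[of A U "\<lambda>a. (a, 0)"]
        smooth_fun_bounded_linear[of A U "\<lambda>a. (0, a)"])
  then show ?thesis by simp
qed

lemma linear_Basis_sum:
  fixes L :: "'v::euclidean_space \<Rightarrow> 'w::real_vector"
  assumes "linear L" shows "L v = (\<Sum>b\<in>Basis. (v \<bullet> b) *\<^sub>R L b)"
  by (subst euclidean_representation[of v, symmetric])
    (simp only: linear_sum[OF assms] linear_scale[OF assms])

text \<open>Expanding the moving vector in the basis reduces the claim to constant vectors, on which
  the smoothness of the family is known. This is the device by which bundle maps are
  composed.\<close>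

lemma smooth_fun_apply:
  fixes s :: "'m \<Rightarrow> 'v::euclidean_space"
  assumes A: "smooth_atlas A" and U: "openin (mtop A) U"
    and lin: "\<And>p. p \<in> U \<Longrightarrow> linear (L p)"
    and L: "\<And>v. smooth_fun A U (\<lambda>p. L p v)" and s: "smooth_fun A U s"
  shows "smooth_fun A U (\<lambda>p. L p (s p))"
proof (rule smooth_fun_cong[OF A U])
  show "smooth_fun A U (\<lambda>p. \<Sum>b\<in>Basis. (s p \<bullet> b) *\<^sub>R L p b)"
    by (rule smooth_fun_sum[OF A U], rule smooth_fun_bilinear[OF A U bounded_bilinear_scaleR _ L],
        rule smooth_fun_bounded_linear[OF A U bounded_linear_inner_left s])
  show "(\<Sum>b\<in>Basis. (s p \<bullet> b) *\<^sub>R L p b) = L p (s p)" if "p \<in> U" for p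
    by (rule linear_Basis_sum[OF lin[OF that], symmetric])
qed

section \<open>Differentials\<close>

text \<open>\<open>mdiff\<close> is total and says nothing where no derivative exists. The
  relational form carries differentiability along, in the manner of \<open>has_derivative\<close>,
  so that sum, product and chain rules can be combined and \<open>mdiff\<close> is read off at the
  end.\<close>

definition has_mdiff ::
  "('m, 'b::euclidean_space) atlas \<Rightarrow> ('m \<Rightarrow> 'c::real_normed_vector) \<Rightarrow> 'm \<Rightarrow> ('b \<Rightarrow> 'c) \<Rightarrow> bool" where
  "has_mdiff A f p D \<longleftrightarrow>
     (case chart_at A p of (U, \<phi>) \<Rightarrow> ((f \<circ> inv_into U \<phi>) has_derivative D) (at (\<phi> p)))"

lemma chart_at:
  assumes "p \<in> carrier_of A" "chart_at A p = (U, \<phi>)"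
  shows "(U, \<phi>) \<in> A" "p \<in> U"
proof -
  have "\<exists>c. c \<in> A \<and> p \<in> fst c" using assms(1) by (auto simp: carrier_of_def)
  from someI_ex[OF this] show "(U, \<phi>) \<in> A" "p \<in> U"
    using assms(2) by (auto simp: chart_at_def)
qed

lemma mdiff_eqI: "has_mdiff A f p D \<Longrightarrow> mdiff A f p = D"
  unfolding has_mdiff_def mdiff_def
  by (cases "chart_at A p") (simp, rule frechet_derivative_at[symmetric])

lemma has_mdiff_linear: "has_mdiff A f p D \<Longrightarrow> linear D"
  unfolding has_mdiff_def by (cases "chart_at A p") (simp add: has_derivative_linear)

lemma smooth_fun_has_mdiff:
  assumes A: "smooth_atlas A" and U: "openin (mtop A) U" "p \<in> U" and f: "smooth_fun A U f"
  shows "has_mdiff A f p (mdiff A f p)"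
proof -
  obtain U' \<phi> where c: "chart_at A p = (U', \<phi>)" using surj_pair[of "chart_at A p"] by blast
  have p: "p \<in> carrier_of A" using openin_mtop_subset[OF A U(1)] U(2) by blast
  note c' = chart_at[OF p c]
  show ?thesis
    unfolding has_mdiff_def mdiff_def c prod.case
    by (rule smooth_on_has_derivative[of "\<phi> ` (U \<inter> U')"])
      (rule smooth_funD[OF f c'(1)], use c'(2) U(2) in blast)
qed

lemma has_mdiff_cong:
  assumes A: "smooth_atlas A" and U: "openin (mtop A) U" "p \<in> U"
    and eq: "\<And>q. q \<in> U \<Longrightarrow> f q = g q" and f: "has_mdiff A f p D"
  shows "has_mdiff A g p D"
proof -
  obtain U' \<phi> where c: "chart_at A p = (U', \<phi>)" using surj_pair[of "chart_at A p"] by blast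
  have p: "p \<in> carrier_of A" using openin_mtop_subset[OF A U(1)] U(2) by blast
  note c' = chart_at[OF p c]
  have "((f \<circ> inv_into U' \<phi>) has_derivative D) (at (\<phi> p))" using f c by (simp add: has_mdiff_def)
  then have "((g \<circ> inv_into U' \<phi>) has_derivative D) (at (\<phi> p))"
    by (rule has_derivative_transform_within_open[OF _ openin_mtop_image[OF A c'(1) U(1)]])
      (use c' U(2) eq smooth_atlas_chart(1)[OF A c'(1)] in auto)
  then show ?thesis using c by (simp add: has_mdiff_def)
qed

lemma mdiff_cong:
  assumes A: "smooth_atlas A" and U: "openin (mtop A) U" "p \<in> U"
    and eq: "\<And>q. q \<in> U \<Longrightarrow> f q = g q"
  shows "mdiff A f p = mdiff A g p"
proof -
  have "has_mdiff A f p = has_mdiff A g p"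
  proof (intro ext iffI)
    show "has_mdiff A g p D" if "has_mdiff A f p D" for D using has_mdiff_cong[OF A U eq that] .
    show "has_mdiff A f p D" if "has_mdiff A g p D" for D
      using has_mdiff_cong[OF A U eq[symmetric] that] .
  qed
  then show ?thesis
    unfolding has_mdiff_def[abs_def] mdiff_def frechet_derivative_def
    by (cases "chart_at A p") simp
qed

lemma has_mdiff_sum:
  "(\<And>i. i \<in> I \<Longrightarrow> has_mdiff A (f i) p (D i)) \<Longrightarrow>
    has_mdiff A (\<lambda>q. \<Sum>i\<in>I. f i q) p (\<lambda>w. \<Sum>i\<in>I. D i w)"
  by (auto simp: has_mdiff_def o_def split: prod.splits intro!: has_derivative_sum)

lemma has_mdiff_bounded_linear:
  "bounded_linear h \<Longrightarrow> has_mdiff A f p D \<Longrightarrow> has_mdiff A (\<lambda>q. h (f q)) p (\<lambda>w. h (D w))"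
  unfolding has_mdiff_def
  by (cases "chart_at A p") (simp add: o_def bounded_linear.has_derivative[of h])

lemma has_mdiff_compose:
  assumes A: "smooth_atlas A" and p: "p \<in> carrier_of A"
    and f: "has_mdiff A f p D" and h: "(h has_derivative h') (at (f p))"
  shows "has_mdiff A (\<lambda>q. h (f q)) p (\<lambda>w. h' (D w))"
proof -
  obtain U' \<phi> where c: "chart_at A p = (U', \<phi>)" using surj_pair[of "chart_at A p"] by blast
  note c' = chart_at[OF p c]
  have "inv_into U' \<phi> (\<phi> p) = p" using c' smooth_atlas_chart(1)[OF A c'(1)] by simp
  then show ?thesis
    using diff_chain_at[of "f \<circ> inv_into U' \<phi>" D "\<phi> p" h h'] f h
    unfolding has_mdiff_def c o_def by simp
qed

lemma has_mdiff_bilinear: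
  assumes A: "smooth_atlas A" and p: "p \<in> carrier_of A" and bb: "bounded_bilinear bil"
    and f: "has_mdiff A f p D" and g: "has_mdiff A g p D'"
  shows "has_mdiff A (\<lambda>q. bil (f q) (g q)) p (\<lambda>w. bil (f p) (D' w) + bil (D w) (g p))"
proof -
  obtain U' \<phi> where c: "chart_at A p = (U', \<phi>)" using surj_pair[of "chart_at A p"] by blast
  note c' = chart_at[OF p c]
  have "inv_into U' \<phi> (\<phi> p) = p" using c' smooth_atlas_chart(1)[OF A c'(1)] by simp
  then show ?thesis
    using bounded_bilinear.FDERIV[OF bb, of "f \<circ> inv_into U' \<phi>" D "\<phi> p" UNIV "g \<circ> inv_into U' \<phi>" D'] f g
    unfolding has_mdiff_def c o_def by simp
qed

lemma smooth_chart_in_atlas: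
  "smooth_atlas A \<Longrightarrow> c \<in> A \<Longrightarrow> smooth_chart A c"
  by (auto simp: smooth_chart_def carrier_of_def insert_absorb)

lemma smooth_chart_properties:
  assumes A: "smooth_atlas A" and c: "smooth_chart A (U, \<phi>)"
  shows "openin (mtop A) U" "inj_on \<phi> U" "smooth_fun A U \<phi>"
    and "open (\<phi> ` U)"
    and "(U', \<psi>) \<in> A \<Longrightarrow> open (\<phi> ` (U \<inter> U'))"
    and "(U', \<psi>) \<in> A \<Longrightarrow> smooth_on (\<phi> ` (U \<inter> U')) (\<psi> \<circ> inv_into U \<phi>)"
proof -
  let ?B = "insert (U, \<phi>) A"
  have B: "smooth_atlas ?B" and UA: "U \<subseteq> carrier_of A" using c by (auto simp: smooth_chart_def)
  show "openin (mtop A) U"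
    unfolding openin_mtop[OF A]
    using UA smooth_atlas_transition(1)[OF B, of _ _ U \<phi>] by (auto simp: Int_commute)
  show "inj_on \<phi> U" "open (\<phi> ` U)" using smooth_atlas_chart[OF B, of U \<phi>] by auto
  show "smooth_fun A U \<phi>"
    unfolding smooth_fun_def
    using smooth_atlas_transition(2)[OF B, of _ _ U \<phi>] by (auto simp: Int_commute)
  show "(U', \<psi>) \<in> A \<Longrightarrow> open (\<phi> ` (U \<inter> U'))"
    "(U', \<psi>) \<in> A \<Longrightarrow> smooth_on (\<phi> ` (U \<inter> U')) (\<psi> \<circ> inv_into U \<phi>)"
    using smooth_atlas_transition[OF B, of U \<phi> U' \<psi>] by auto
qed

text \<open>Tangent vectors at \<open>p\<close> are written in the components of this very chart, so
  its differential changes nothing.\<close>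

lemma mdiff_chart_at:
  assumes A: "smooth_atlas A" and p: "p \<in> carrier_of A" and c: "chart_at A p = (U, \<phi>)"
  shows "mdiff A \<phi> p = (\<lambda>w. w)"
proof -
  note c' = chart_at[OF p c]
  have "((\<lambda>y. y) has_derivative (\<lambda>w. w)) (at (\<phi> p))" by simp
  then have "((\<phi> \<circ> inv_into U \<phi>) has_derivative (\<lambda>w. w)) (at (\<phi> p))"
    by (rule has_derivative_transform_within_open[OF _ smooth_atlas_chart(2)[OF A c'(1)]])
      (use c' in \<open>auto simp: f_inv_into_f\<close>)
  then show ?thesis using c by (intro mdiff_eqI) (simp add: has_mdiff_def)
qed

text \<open>Near \<open>p\<close> the function \<open>f\<close> is its chart expression after the
  chart, and the chain rule applies. The chart may be any one of the maximal atlas, not only the one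
  chosen at \<open>p\<close>.\<close>

lemma has_mdiff_via_chart:
  assumes A: "smooth_atlas A" and c: "smooth_chart A (U, \<phi>)" and p: "p \<in> U"
    and F: "((f \<circ> inv_into U \<phi>) has_derivative F) (at (\<phi> p))"
  shows "has_mdiff A f p (\<lambda>w. F (mdiff A \<phi> p w))"
proof (rule has_mdiff_cong[OF A _ p])
  show U: "openin (mtop A) U" using smooth_chart_properties(1)[OF A c] .
  have pc: "p \<in> carrier_of A" using openin_mtop_subset[OF A U] p by blast
  have "has_mdiff A \<phi> p (mdiff A \<phi> p)"
    by (rule smooth_fun_has_mdiff[OF A U p smooth_chart_properties(3)[OF A c]])
  from has_mdiff_compose[OF A pc this F]
  show "has_mdiff A (\<lambda>q. (f \<circ> inv_into U \<phi>) (\<phi> q)) p (\<lambda>w. F (mdiff A \<phi> p w))" .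
qed (use smooth_chart_properties(2)[OF A c] in auto)

text \<open>The derivative of the transition map to the chart chosen at \<open>p\<close> is a left
  inverse; equality of dimensions does the rest.\<close>

lemma mdiff_chart_bij:
  assumes A: "smooth_atlas A" and c: "smooth_chart A (U, \<phi>)" and p: "p \<in> U"
  shows "linear (mdiff A \<phi> p)" "bij (mdiff A \<phi> p)"
proof -
  have U: "openin (mtop A) U" using smooth_chart_properties(1)[OF A c] .
  have pc: "p \<in> carrier_of A" using openin_mtop_subset[OF A U] p by blast
  have hm: "has_mdiff A \<phi> p (mdiff A \<phi> p)"
    by (rule smooth_fun_has_mdiff[OF A U p smooth_chart_properties(3)[OF A c]])
  then show lin: "linear (mdiff A \<phi> p)" by (rule has_mdiff_linear)
  obtain U0 \<phi>0 where c0: "chart_at A p = (U0, \<phi>0)" using surj_pair[of "chart_at A p"] by blast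
  note c0' = chart_at[OF pc c0]
  define G where "G = frechet_derivative (\<phi>0 \<circ> inv_into U \<phi>) (at (\<phi> p))"
  have "((\<phi>0 \<circ> inv_into U \<phi>) has_derivative G) (at (\<phi> p))"
    unfolding G_def using p c0'
    by (intro smooth_on_has_derivative[OF smooth_chart_properties(6)[OF A c c0'(1)]]) auto
  from mdiff_eqI[OF has_mdiff_via_chart[OF A c p this]]
  have "G (mdiff A \<phi> p w) = w" for w using mdiff_chart_at[OF A pc c0] by (metis)
  then have "inj (mdiff A \<phi> p)" by (metis injI)
  then show "bij (mdiff A \<phi> p)" using lin linear_injective_imp_surjective by (auto simp: bij_def)
qed

lemma mdiff_inv_chart:
  assumes A: "smooth_atlas A" and c: "(U', \<phi>) \<in> A" and U: "openin (mtop A) U" "p \<in> U" "p \<in> U'"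
    and f: "smooth_fun A U f"
  shows "mdiff A f p (inv (mdiff A \<phi> p) v) = frechet_derivative (f \<circ> inv_into U' \<phi>) (at (\<phi> p)) v"
proof -
  have c': "smooth_chart A (U', \<phi>)" using smooth_chart_in_atlas[OF A c] .
  have "((f \<circ> inv_into U' \<phi>) has_derivative frechet_derivative (f \<circ> inv_into U' \<phi>) (at (\<phi> p))) (at (\<phi> p))"
    using U by (intro smooth_on_has_derivative[OF smooth_funD[OF f c]]) blast
  from mdiff_eqI[OF has_mdiff_via_chart[OF A c' U(3) this]]
  show ?thesis using mdiff_chart_bij(2)[OF A c' U(3)] by (simp add: bij_is_surj surj_f_inv_f)
qed

text \<open>\<open>inv (mdiff A \<phi> p) v\<close> is the vector field with constant components
  \<open>v\<close> in the chart. On it the differential of \<open>f\<close> is a directional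
  derivative of the chart expression of \<open>f\<close>.\<close>

lemma mdiff_smooth:
  assumes A: "smooth_atlas A" and U: "openin (mtop A) U" and f: "smooth_fun A U f"
    and c: "(U', \<phi>) \<in> A"
  shows "smooth_fun A (U \<inter> U') (\<lambda>p. mdiff A f p (inv (mdiff A \<phi> p) v))"
proof -
  have U': "openin (mtop A) U'" using smooth_atlas_chart(3)[OF A c] .
  have o: "openin (mtop A) (U \<inter> U')" using U U' by blast
  have "smooth_on (\<phi> ` (U \<inter> U')) (\<lambda>y. frechet_derivative (f \<circ> inv_into U' \<phi>) (at y) v)"
    by (rule smooth_on_frechet_derivative[OF smooth_funD[OF f c]])
  then have "smooth_on (\<phi> ` (U \<inter> U'))
      ((\<lambda>p. mdiff A f p (inv (mdiff A \<phi> p) v)) \<circ> inv_into U' \<phi>)"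
    by (rule smooth_on_cong[OF openin_mtop_image[OF A c U], rotated])
      (use smooth_atlas_chart(1)[OF A c] in \<open>auto simp: mdiff_inv_chart[OF A c U _ _ f]\<close>)
  then show ?thesis by (intro smooth_fun_chartI[OF A c o]) auto
qed

section \<open>Vector bundles and smooth homomorphisms\<close>

lemma adjoint_inner:
  fixes f :: "'a::euclidean_space \<Rightarrow> 'b::euclidean_space"
  assumes "linear f" shows "adjoint f y \<bullet> x = y \<bullet> f x"
  using adjoint_works[OF assms, of x y] by (simp add: inner_commute)

lemma adjoint_compose:
  fixes f :: "'a::euclidean_space \<Rightarrow> 'b::euclidean_space" and g :: "'b \<Rightarrow> 'c::euclidean_space"
  assumes "linear f" "linear g"
  shows "adjoint (\<lambda>x. g (f x)) y = adjoint f (adjoint g y)"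
proof -
  have "linear (\<lambda>x. g (f x))" using linear_compose[OF assms] by (simp add: o_def)
  then show ?thesis
    unfolding vector_eq_rdot[symmetric, of "adjoint (\<lambda>x. g (f x)) y"]
    by (simp add: adjoint_inner assms)
qed

lemma adjoint_ident: "adjoint (\<lambda>x::'a::euclidean_space. x) = (\<lambda>x. x)"
  by (rule adjoint_unique) simp

lemma linear_inv_bij:
  fixes f :: "'a::euclidean_space \<Rightarrow> 'b::euclidean_space"
  assumes "linear f" "bij f" shows "linear (inv f)"
proof (rule linearI)
  have i: "inv f (f x) = x" for x using assms(2) by (simp add: bij_is_inj)
  have s: "f (inv f y) = y" for y using assms(2) by (simp add: bij_is_surj surj_f_inv_f)
  show "inv f (y + z) = inv f y + inv f z" for y z
    using i[of "inv f y + inv f z"] by (simp add: linear_add[OF assms(1)] s)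
  show "inv f (r *\<^sub>R y) = r *\<^sub>R inv f y" for r y
    using i[of "r *\<^sub>R inv f y"] by (simp add: linear_scale[OF assms(1)] s)
qed

lemma adjoint_bij:
  fixes f :: "'a::euclidean_space \<Rightarrow> 'b::euclidean_space"
  assumes f: "linear f" "bij f"
  shows "bij (adjoint f)" "inv (adjoint f) = adjoint (inv f)"
proof -
  have i: "linear (inv f)" using linear_inv_bij[OF f] .
  have 1: "adjoint f (adjoint (inv f) y) = y" for y
    using adjoint_compose[OF f(1) i, of y] f(2) by (simp add: bij_is_inj adjoint_ident)
  have 2: "adjoint (inv f) (adjoint f y) = y" for y
    using adjoint_compose[OF i f(1), of y] f(2)
    by (simp add: bij_is_surj surj_f_inv_f adjoint_ident)
  show "bij (adjoint f)" using 1 2 by (intro o_bij[of "adjoint (inv f)"]) auto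
  show "inv (adjoint f) = adjoint (inv f)" using 1 2 by (intro inv_equality)
qed

lemma inv_map_prod:
  assumes "bij f" "bij g" shows "inv (map_prod f g) = map_prod (inv f) (inv g)"
  using assms by (intro inv_equality) (auto simp: bij_is_inj bij_is_surj surj_f_inv_f)

lemma bij_map_prod: "bij f \<Longrightarrow> bij g \<Longrightarrow> bij (map_prod f g)"
  by (simp add: bij_def prod.inj_map map_prod_surj)

lemma linear_map_prod: "linear f \<Longrightarrow> linear g \<Longrightarrow> linear (map_prod f g)"
  by (auto simp: linear_iff)

lemma vector_bundle_triv:
  assumes "vector_bundle A E" "(U, \<Phi>) \<in> E"
  shows "openin (mtop A) U" "p \<in> U \<Longrightarrow> linear (\<Phi> p)" "p \<in> U \<Longrightarrow> bij (\<Phi> p)"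
    "(U', \<Psi>) \<in> E \<Longrightarrow> smooth_fun A (U \<inter> U') (\<lambda>p. \<Psi> p (inv (\<Phi> p) v))"
proof -
  have "\<forall>(U, \<Phi>)\<in>E. openin (mtop A) U \<and> (\<forall>p\<in>U. linear (\<Phi> p) \<and> bij (\<Phi> p))"
    using assms(1) unfolding vector_bundle_def by (elim conjE)
  from bspec[OF this assms(2)] show "openin (mtop A) U" "p \<in> U \<Longrightarrow> linear (\<Phi> p)" "p \<in> U \<Longrightarrow> bij (\<Phi> p)"
    by auto
  have "\<forall>(U, \<Phi>)\<in>E. \<forall>(U', \<Psi>)\<in>E. \<forall>v. smooth_fun A (U \<inter> U') (\<lambda>p. \<Psi> p (inv (\<Phi> p) v))"
    using assms(1) unfolding vector_bundle_def by (elim conjE)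
  from bspec[OF this assms(2)]
  have *: "\<forall>(U', \<Psi>)\<in>E. \<forall>v. smooth_fun A (U \<inter> U') (\<lambda>p. \<Psi> p (inv (\<Phi> p) v))" by simp
  show "smooth_fun A (U \<inter> U') (\<lambda>p. \<Psi> p (inv (\<Phi> p) v))" if "(U', \<Psi>) \<in> E"
    using bspec[OF * that] by simp
qed

lemma vector_bundle_inv:
  assumes "vector_bundle A E" "(U, \<Phi>) \<in> E" "p \<in> U"
  shows "inv (\<Phi> p) (\<Phi> p v) = v" "\<Phi> p (inv (\<Phi> p) v) = v" "linear (inv (\<Phi> p))"
  using vector_bundle_triv(2,3)[OF assms]
  by (auto simp: bij_is_inj bij_is_surj surj_f_inv_f linear_inv_bij)

lemma vector_bundle_cover:
  assumes "vector_bundle A E" "p \<in> carrier_of A"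
  obtains U \<Phi> where "(U, \<Phi>) \<in> E" "p \<in> U"
proof -
  have "p \<in> \<Union>(fst ` E)" using assms unfolding vector_bundle_def by simp
  then show ?thesis using that by auto
qed

lemma smooth_homI:
  assumes "\<And>p. p \<in> U \<Longrightarrow> linear (L p)"
    "\<And>U1 \<Phi> U2 \<Psi> v. (U1, \<Phi>) \<in> E \<Longrightarrow> (U2, \<Psi>) \<in> E' \<Longrightarrow>
      smooth_fun A (U \<inter> U1 \<inter> U2) (\<lambda>p. \<Psi> p (L p (inv (\<Phi> p) v)))"
  shows "smooth_hom A U E E' L"
  unfolding smooth_hom_def using assms by (intro conjI ballI allI) auto

lemma smooth_homD:
  assumes "smooth_hom A U E E' L"
  shows "p \<in> U \<Longrightarrow> linear (L p)"
    "(U1, \<Phi>) \<in> E \<Longrightarrow> (U2, \<Psi>) \<in> E' \<Longrightarrow>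
      smooth_fun A (U \<inter> U1 \<inter> U2) (\<lambda>p. \<Psi> p (L p (inv (\<Phi> p) v)))"
proof -
  have *: "\<forall>(U1, \<Phi>)\<in>E. \<forall>(U2, \<Psi>)\<in>E'. \<forall>v.
      smooth_fun A (U \<inter> U1 \<inter> U2) (\<lambda>p. \<Psi> p (L p (inv (\<Phi> p) v)))"
    using assms unfolding smooth_hom_def by (elim conjE)
  show "linear (L p)" if "p \<in> U" using assms that unfolding smooth_hom_def by (elim conjE bspec)
  show "smooth_fun A (U \<inter> U1 \<inter> U2) (\<lambda>p. \<Psi> p (L p (inv (\<Phi> p) v)))"
    if c: "(U1, \<Phi>) \<in> E" "(U2, \<Psi>) \<in> E'"
  proof -
    from bspec[OF * c(1)]
    have "\<forall>(U2, \<Psi>)\<in>E'. \<forall>v. smooth_fun A (U \<inter> U1 \<inter> U2) (\<lambda>p. \<Psi> p (L p (inv (\<Phi> p) v)))" by simp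
    from bspec[OF this c(2)] show ?thesis by simp
  qed
qed

lemma smooth_hom_id: "vector_bundle A E \<Longrightarrow> smooth_hom A U E E (\<lambda>p v. v)"
proof (rule smooth_homI)
  fix U1 U2 \<Phi> \<Psi> v
  assume *: "vector_bundle A E" "(U1, \<Phi>) \<in> E" "(U2, \<Psi>) \<in> E"
  show "smooth_fun A (U \<inter> U1 \<inter> U2) (\<lambda>p. \<Psi> p (inv (\<Phi> p) v))"
    by (rule smooth_fun_subset[OF vector_bundle_triv(4)[OF *]]) blast
qed (simp add: linear_iff)

section \<open>Operations on smooth bundle homomorphisms over a fixed open set\<close>

context
  fixes A :: "('m, 'b::euclidean_space) atlas" and U :: "'m set"
  assumes A: "smooth_atlas A" and U: "openin (mtop A) U"
begin

lemma openin_triv2: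
  "vector_bundle A E \<Longrightarrow> vector_bundle A F \<Longrightarrow> (U1, \<Phi>) \<in> E \<Longrightarrow> (U2, \<Psi>) \<in> F \<Longrightarrow>
    openin (mtop A) (U \<inter> U1 \<inter> U2)"
  using U by (intro openin_Int) (auto dest: vector_bundle_triv(1))

lemma smooth_hom_cong:
  assumes E: "vector_bundle A E" and F: "vector_bundle A F"
    and L: "smooth_hom A U E F L" and eq: "\<And>p v. p \<in> U \<Longrightarrow> L p v = L' p v"
  shows "smooth_hom A U E F L'"
proof (rule smooth_homI)
  fix p assume "p \<in> U"
  then show "linear (L' p)" using smooth_homD(1)[OF L, of p] eq[of p] by (metis ext)
next
  fix U1 \<Phi> U2 \<Psi> v assume c: "(U1, \<Phi>) \<in> E" "(U2, \<Psi>) \<in> F"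
  show "smooth_fun A (U \<inter> U1 \<inter> U2) (\<lambda>p. \<Psi> p (L' p (inv (\<Phi> p) v)))"
    by (rule smooth_fun_cong[OF A openin_triv2[OF E F c] _ smooth_homD(2)[OF L c]])
      (simp add: eq)
qed

text \<open>A trivialisation of the middle bundle is inserted between the two maps. It exists only
  locally, hence the passage through \<open>smooth_fun_local\<close>.\<close>

lemma smooth_hom_compose:
  fixes E :: "('m, 'v::euclidean_space) vbundle" and F :: "('m, 'w::euclidean_space) vbundle"
    and G :: "('m, 'u::euclidean_space) vbundle"
  assumes E: "vector_bundle A E" and F: "vector_bundle A F" and G: "vector_bundle A G"
    and L: "smooth_hom A U E F L" and L': "smooth_hom A U F G L'"
  shows "smooth_hom A U E G (\<lambda>p v. L' p (L p v))"
proof (rule smooth_homI)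
  fix p assume "p \<in> U"
  then show "linear (\<lambda>v. L' p (L p v))"
    using linear_compose[OF smooth_homD(1)[OF L] smooth_homD(1)[OF L']] by (simp add: o_def)
next
  fix U1 \<Phi> U2 \<Psi> v assume c: "(U1, \<Phi>) \<in> E" "(U2, \<Psi>) \<in> G"
  show "smooth_fun A (U \<inter> U1 \<inter> U2) (\<lambda>p. \<Psi> p (L' p (L p (inv (\<Phi> p) v))))"
  proof (rule smooth_fun_local[OF A])
    fix p assume p: "p \<in> U \<inter> U1 \<inter> U2"
    then have "p \<in> carrier_of A" using openin_mtop_subset[OF A U] by blast
    then obtain U3 \<Theta> where d: "(U3, \<Theta>) \<in> F" "p \<in> U3" using vector_bundle_cover[OF F] by blast
    let ?W = "U \<inter> U1 \<inter> U2 \<inter> U3"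
    have W: "openin (mtop A) ?W"
      using openin_Int[OF openin_triv2[OF E G c] vector_bundle_triv(1)[OF F d(1)]] .
    have "smooth_fun A ?W (\<lambda>p. \<Psi> p (L' p (inv (\<Theta> p) (\<Theta> p (L p (inv (\<Phi> p) v))))))"
    proof (rule smooth_fun_apply[OF A W, where L = "\<lambda>p u. \<Psi> p (L' p (inv (\<Theta> p) u))"])
      show "linear (\<lambda>u. \<Psi> p (L' p (inv (\<Theta> p) u)))" if "p \<in> ?W" for p
        using that linear_compose[OF linear_compose[OF vector_bundle_inv(3)[OF F d(1), of p]
            smooth_homD(1)[OF L', of p]] vector_bundle_triv(2)[OF G c(2), of p]]
        by (simp add: o_def)
      show "smooth_fun A ?W (\<lambda>p. \<Psi> p (L' p (inv (\<Theta> p) u)))" for u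
        by (rule smooth_fun_subset[OF smooth_homD(2)[OF L' d(1) c(2)]]) blast
      show "smooth_fun A ?W (\<lambda>p. \<Theta> p (L p (inv (\<Phi> p) v)))"
        by (rule smooth_fun_subset[OF smooth_homD(2)[OF L c(1) d(1)]]) blast
    qed
    then have "smooth_fun A ?W (\<lambda>p. \<Psi> p (L' p (L p (inv (\<Phi> p) v))))"
      by (rule smooth_fun_cong[OF A W, rotated]) (simp add: vector_bundle_inv(1)[OF F d(1)])
    then show "\<exists>W. openin (mtop A) W \<and> p \<in> W \<and>
        smooth_fun A W (\<lambda>p. \<Psi> p (L' p (L p (inv (\<Phi> p) v))))"
      using W p d(2) by blast
  qed
qed

lemma smooth_hom_add:
  assumes E: "vector_bundle A E" and F: "vector_bundle A F"
    and L: "smooth_hom A U E F L" and L': "smooth_hom A U E F L'"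
  shows "smooth_hom A U E F (\<lambda>p v. L p v + L' p v)"
proof (rule smooth_homI)
  fix p assume "p \<in> U"
  then show "linear (\<lambda>v. L p v + L' p v)"
    using linear_compose_add[OF smooth_homD(1)[OF L] smooth_homD(1)[OF L']] by simp
next
  fix U1 \<Phi> U2 \<Psi> v assume c: "(U1, \<Phi>) \<in> E" "(U2, \<Psi>) \<in> F"
  note o = openin_triv2[OF E F c]
  show "smooth_fun A (U \<inter> U1 \<inter> U2) (\<lambda>p. \<Psi> p (L p (inv (\<Phi> p) v) + L' p (inv (\<Phi> p) v)))"
    by (rule smooth_fun_cong[OF A o _ smooth_fun_add[OF A o smooth_homD(2)[OF L c] smooth_homD(2)[OF L' c]]])
      (simp add: linear_add[OF vector_bundle_triv(2)[OF F c(2)]])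
qed

lemma smooth_hom_scale:
  fixes F :: "('m, 'w::euclidean_space) vbundle"
  assumes E: "vector_bundle A E" and F: "vector_bundle A F" and L: "smooth_hom A U E F L"
  shows "smooth_hom A U E F (\<lambda>p v. c *\<^sub>R L p v)"
proof (rule smooth_homI)
  fix p assume "p \<in> U"
  then show "linear (\<lambda>v. c *\<^sub>R L p v)"
    using linear_compose_scale_right[OF smooth_homD(1)[OF L]] by simp
next
  fix U1 \<Phi> U2 \<Psi> v assume d: "(U1, \<Phi>) \<in> E" "(U2, \<Psi>) \<in> F"
  note o = openin_triv2[OF E F d]
  show "smooth_fun A (U \<inter> U1 \<inter> U2) (\<lambda>p. \<Psi> p (c *\<^sub>R L p (inv (\<Phi> p) v)))"
    by (rule smooth_fun_cong[OF A o _ smooth_fun_bounded_linear[OF A o bounded_linear_scaleR_right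
            smooth_homD(2)[OF L d]]])
      (simp add: linear_scale[OF vector_bundle_triv(2)[OF F d(2)]])
qed

lemma vector_bundle_sum:
  fixes E :: "('m, 'v::euclidean_space) vbundle" and F :: "('m, 'w::euclidean_space) vbundle"
  assumes E: "vector_bundle A E" and F: "vector_bundle A F"
  shows "vector_bundle A (sum_bundle E F)"
  unfolding vector_bundle_def
proof (intro conjI)
  have "\<exists>c\<in>sum_bundle E F. p \<in> fst c" if "p \<in> carrier_of A" for p
  proof -
    obtain U1 \<Phi> where "(U1, \<Phi>) \<in> E" "p \<in> U1" using vector_bundle_cover[OF E \<open>p \<in> carrier_of A\<close>] .
    moreover obtain U2 \<Psi> where "(U2, \<Psi>) \<in> F" "p \<in> U2" using vector_bundle_cover[OF F \<open>p \<in> carrier_of A\<close>] .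
    ultimately show ?thesis
      by (intro bexI[of _ "(U1 \<inter> U2, \<lambda>p. map_prod (\<Phi> p) (\<Psi> p))"]) (auto simp: sum_bundle_def)
  qed
  moreover have "fst c \<subseteq> carrier_of A" if "c \<in> sum_bundle E F" for c
    using that E unfolding sum_bundle_def vector_bundle_def by fastforce
  ultimately show "\<Union>(fst ` sum_bundle E F) = carrier_of A" by blast
  show "\<forall>(U, \<Phi>)\<in>sum_bundle E F. openin (mtop A) U \<and> (\<forall>p\<in>U. linear (\<Phi> p) \<and> bij (\<Phi> p))"
  proof (clarify, intro conjI ballI)
    fix U' \<Theta> assume "(U', \<Theta>) \<in> sum_bundle E F"
    then obtain U1 \<Phi> U2 \<Psi> where d: "(U1, \<Phi>) \<in> E" "(U2, \<Psi>) \<in> F" "U' = U1 \<inter> U2"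
      "\<Theta> = (\<lambda>p. map_prod (\<Phi> p) (\<Psi> p))" by (auto simp: sum_bundle_def)
    show "openin (mtop A) U'"
      unfolding d(3) using vector_bundle_triv(1)[OF E d(1)] vector_bundle_triv(1)[OF F d(2)] by blast
    fix p assume "p \<in> U'"
    then have p: "p \<in> U1" "p \<in> U2" using d(3) by auto
    show "linear (\<Theta> p)" "bij (\<Theta> p)"
      unfolding d(4) using vector_bundle_triv(2,3)[OF E d(1) p(1)] vector_bundle_triv(2,3)[OF F d(2) p(2)]
      by (auto intro: linear_map_prod bij_map_prod)
  qed
  show "\<forall>(U, \<Phi>)\<in>sum_bundle E F. \<forall>(U', \<Psi>)\<in>sum_bundle E F. \<forall>v.
      smooth_fun A (U \<inter> U') (\<lambda>p. \<Psi> p (inv (\<Phi> p) v))"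
    unfolding sum_bundle_def
  proof (clarify)
    fix U1 \<Phi>1 U2 \<Phi>2 U3 \<Phi>3 U4 \<Phi>4 and v :: 'v and w :: 'w
    assume c: "(U1, \<Phi>1) \<in> E" "(U2, \<Phi>2) \<in> F" "(U3, \<Phi>3) \<in> E" "(U4, \<Phi>4) \<in> F"
    let ?W = "U1 \<inter> U2 \<inter> (U3 \<inter> U4)"
    have o: "openin (mtop A) ?W"
      using c by (intro openin_Int) (auto dest: vector_bundle_triv(1)[OF E] vector_bundle_triv(1)[OF F])
    have "smooth_fun A ?W (\<lambda>p. (\<Phi>3 p (inv (\<Phi>1 p) v), \<Phi>4 p (inv (\<Phi>2 p) w)))"
      by (rule smooth_fun_Pair[OF A o smooth_fun_subset[OF vector_bundle_triv(4)[OF E c(1,3)]]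
            smooth_fun_subset[OF vector_bundle_triv(4)[OF F c(2,4)]]]) blast+
    then show "smooth_fun A ?W (\<lambda>p. map_prod (\<Phi>3 p) (\<Phi>4 p) (inv (map_prod (\<Phi>1 p) (\<Phi>2 p)) (v, w)))"
      by (rule smooth_fun_cong[OF A o, rotated])
        (simp add: inv_map_prod vector_bundle_triv(3)[OF E c(1)] vector_bundle_triv(3)[OF F c(2)])
  qed
qed

text \<open>In the inverse transposed trivialisations the matrix of the transpose of
  \<open>L\<close> is the transposed matrix of \<open>L\<close>, so its entries are smooth. Stated
  for single trivialisations because it serves twice: for transposes of bundle maps and, with
  \<open>L\<close> the identity, for the transition maps of the dual bundle.\<close>

lemma adjoint_smooth:
  fixes E :: "('m, 'v::euclidean_space) vbundle" and F :: "('m, 'w::euclidean_space) vbundle"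
  assumes E: "vector_bundle A E" and F: "vector_bundle A F"
    and L: "smooth_hom A U E F L" and c: "(U1, \<Phi>) \<in> E" "(U2, \<Psi>) \<in> F"
  shows "smooth_fun A (U \<inter> U1 \<inter> U2)
      (\<lambda>p. inv (adjoint (\<Phi> p)) (adjoint (L p) (inv (inv (adjoint (\<Psi> p))) v)))"
proof (rule smooth_fun_cong[OF A openin_triv2[OF E F c]])
  note o = openin_triv2[OF E F c]
  show "smooth_fun A (U \<inter> U1 \<inter> U2) (\<lambda>p. \<Sum>b\<in>Basis. (v \<bullet> \<Psi> p (L p (inv (\<Phi> p) b))) *\<^sub>R b)"
    by (rule smooth_fun_sum[OF A o], rule smooth_fun_bounded_linear[OF A o bounded_linear_scaleR_left],
        rule smooth_fun_bounded_linear[OF A o bounded_linear_inner_right smooth_homD(2)[OF L c]])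
  fix p assume p: "p \<in> U \<inter> U1 \<inter> U2"
  have \<Phi>: "linear (\<Phi> p)" "bij (\<Phi> p)" "linear (inv (\<Phi> p))"
    using p vector_bundle_triv(2,3)[OF E c(1)] vector_bundle_inv(3)[OF E c(1)] by auto
  have \<Psi>: "linear (\<Psi> p)" "bij (\<Psi> p)" using p vector_bundle_triv(2,3)[OF F c(2)] by auto
  have Lp: "linear (L p)" using p smooth_homD(1)[OF L] by auto
  have "inv (adjoint (\<Phi> p)) (adjoint (L p) (inv (inv (adjoint (\<Psi> p))) v))
      = adjoint (inv (\<Phi> p)) (adjoint (L p) (adjoint (\<Psi> p) v))"
    unfolding inv_inv_eq[OF adjoint_bij(1)[OF \<Psi>]] adjoint_bij(2)[OF \<Phi>(1,2)] ..
  also have "\<dots> = (\<Sum>b\<in>Basis. (v \<bullet> \<Psi> p (L p (inv (\<Phi> p) b))) *\<^sub>R b)"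
    by (subst euclidean_representation[symmetric]) (simp only: adjoint_inner \<Phi> \<Psi> Lp)
  finally show "(\<Sum>b\<in>Basis. (v \<bullet> \<Psi> p (L p (inv (\<Phi> p) b))) *\<^sub>R b)
      = inv (adjoint (\<Phi> p)) (adjoint (L p) (inv (inv (adjoint (\<Psi> p))) v))" ..
qed

lemma smooth_hom_adjoint:
  fixes E :: "('m, 'v::euclidean_space) vbundle" and F :: "('m, 'w::euclidean_space) vbundle"
  assumes E: "vector_bundle A E" and F: "vector_bundle A F" and L: "smooth_hom A U E F L"
  shows "smooth_hom A U (dual_bundle F) (dual_bundle E) (\<lambda>p. adjoint (L p))"
proof (rule smooth_homI)
  show "linear (adjoint (L p))" if "p \<in> U" for p
    using adjoint_linear[OF smooth_homD(1)[OF L that]] .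
next
  fix U1 \<Phi>' U2 \<Psi>' v assume c: "(U1, \<Phi>') \<in> dual_bundle F" "(U2, \<Psi>') \<in> dual_bundle E"
  obtain \<Phi> where 1: "(U1, \<Phi>) \<in> F" "\<Phi>' = (\<lambda>p. inv (adjoint (\<Phi> p)))"
    using c(1) by (auto simp: dual_bundle_def)
  obtain \<Psi> where 2: "(U2, \<Psi>) \<in> E" "\<Psi>' = (\<lambda>p. inv (adjoint (\<Psi> p)))"
    using c(2) by (auto simp: dual_bundle_def)
  show "smooth_fun A (U \<inter> U1 \<inter> U2) (\<lambda>p. \<Psi>' p (adjoint (L p) (inv (\<Phi>' p) v)))"
    using adjoint_smooth[OF E F L 2(1) 1(1), of v] unfolding 1(2) 2(2)
    by (simp add: Int_assoc Int_commute[of U2])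
qed

lemma smooth_hom_Pair:
  fixes E :: "('m, 'v::euclidean_space) vbundle" and F :: "('m, 'w::euclidean_space) vbundle"
    and G :: "('m, 'u::euclidean_space) vbundle"
  assumes E: "vector_bundle A E" and F: "vector_bundle A F" and G: "vector_bundle A G"
    and L: "smooth_hom A U E F L" and L': "smooth_hom A U E G L'"
  shows "smooth_hom A U E (sum_bundle F G) (\<lambda>p v. (L p v, L' p v))"
proof (rule smooth_homI)
  show "linear (\<lambda>v. (L p v, L' p v))" if "p \<in> U" for p
    using smooth_homD(1)[OF L that] smooth_homD(1)[OF L' that] by (simp add: linear_iff)
next
  fix U1 \<Phi> U2 \<Psi> v assume c: "(U1, \<Phi>) \<in> E" "(U2, \<Psi>) \<in> sum_bundle F G"
  then obtain U3 \<Theta> U4 \<Theta>' where d: "(U3, \<Theta>) \<in> F" "(U4, \<Theta>') \<in> G" "U2 = U3 \<inter> U4"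
    "\<Psi> = (\<lambda>p. map_prod (\<Theta> p) (\<Theta>' p))" by (auto simp: sum_bundle_def)
  have o: "openin (mtop A) (U \<inter> U1 \<inter> (U3 \<inter> U4))"
    using openin_triv2[OF E vector_bundle_sum[OF F G] c] d(3) by simp
  show "smooth_fun A (U \<inter> U1 \<inter> U2) (\<lambda>p. \<Psi> p (L p (inv (\<Phi> p) v), L' p (inv (\<Phi> p) v)))"
    unfolding d(3,4) map_prod_simp
    by (rule smooth_fun_Pair[OF A o smooth_fun_subset[OF smooth_homD(2)[OF L c(1) d(1)]]
          smooth_fun_subset[OF smooth_homD(2)[OF L' c(1) d(2)]]]) blast+
qed

lemma smooth_hom_fst_snd:
  fixes E :: "('m, 'v::euclidean_space) vbundle" and F :: "('m, 'w::euclidean_space) vbundle"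
  assumes E: "vector_bundle A E" and F: "vector_bundle A F"
  shows "smooth_hom A U (sum_bundle E F) E (\<lambda>p. fst)" "smooth_hom A U (sum_bundle E F) F (\<lambda>p. snd)"
proof -
  have *: "smooth_fun A (U \<inter> U1 \<inter> U2) (\<lambda>p. \<Psi> p (fst (inv (\<Phi> p) v)))"
    if c: "(U1, \<Phi>) \<in> sum_bundle E F" "(U2, \<Psi>) \<in> E" for U1 \<Phi> U2 \<Psi> and v :: "'v \<times> 'w"
  proof -
    obtain U3 \<Theta> U4 \<Theta>' where d: "(U3, \<Theta>) \<in> E" "(U4, \<Theta>') \<in> F" "U1 = U3 \<inter> U4"
      "\<Phi> = (\<lambda>p. map_prod (\<Theta> p) (\<Theta>' p))" using c(1) by (auto simp: sum_bundle_def)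
    show ?thesis
    proof (rule smooth_fun_cong[OF A openin_triv2[OF vector_bundle_sum[OF E F] E c]])
      show "smooth_fun A (U \<inter> U1 \<inter> U2) (\<lambda>p. \<Psi> p (inv (\<Theta> p) (fst v)))"
        by (rule smooth_fun_subset[OF vector_bundle_triv(4)[OF E d(1) c(2)]]) (auto simp: d(3))
      show "\<Psi> p (inv (\<Theta> p) (fst v)) = \<Psi> p (fst (inv (\<Phi> p) v))" if "p \<in> U \<inter> U1 \<inter> U2" for p
      proof -
        have p: "p \<in> U3" "p \<in> U4" using that d(3) by auto
        show ?thesis
          unfolding d(4) inv_map_prod[OF vector_bundle_triv(3)[OF E d(1) p(1)] vector_bundle_triv(3)[OF F d(2) p(2)]]
          by (simp add: map_prod_def split_beta)
      qed
    qed
  qed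
  show "smooth_hom A U (sum_bundle E F) E (\<lambda>p. fst)"
    by (rule smooth_homI) (rule linear_fst, rule *)
  have *: "smooth_fun A (U \<inter> U1 \<inter> U2) (\<lambda>p. \<Psi> p (snd (inv (\<Phi> p) v)))"
    if c: "(U1, \<Phi>) \<in> sum_bundle E F" "(U2, \<Psi>) \<in> F" for U1 \<Phi> U2 \<Psi> and v :: "'v \<times> 'w"
  proof -
    obtain U3 \<Theta> U4 \<Theta>' where d: "(U3, \<Theta>) \<in> E" "(U4, \<Theta>') \<in> F" "U1 = U3 \<inter> U4"
      "\<Phi> = (\<lambda>p. map_prod (\<Theta> p) (\<Theta>' p))" using c(1) by (auto simp: sum_bundle_def)
    show ?thesis
    proof (rule smooth_fun_cong[OF A openin_triv2[OF vector_bundle_sum[OF E F] F c]])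
      show "smooth_fun A (U \<inter> U1 \<inter> U2) (\<lambda>p. \<Psi> p (inv (\<Theta>' p) (snd v)))"
        by (rule smooth_fun_subset[OF vector_bundle_triv(4)[OF F d(2) c(2)]]) (auto simp: d(3))
      show "\<Psi> p (inv (\<Theta>' p) (snd v)) = \<Psi> p (snd (inv (\<Phi> p) v))" if "p \<in> U \<inter> U1 \<inter> U2" for p
      proof -
        have p: "p \<in> U3" "p \<in> U4" using that d(3) by auto
        show ?thesis
          unfolding d(4) inv_map_prod[OF vector_bundle_triv(3)[OF E d(1) p(1)] vector_bundle_triv(3)[OF F d(2) p(2)]]
          by (simp add: map_prod_def split_beta)
      qed
    qed
  qed
  show "smooth_hom A U (sum_bundle E F) F (\<lambda>p. snd)"
    by (rule smooth_homI) (rule linear_snd, rule *)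
qed

end

lemma vector_bundle_dual:
  fixes E :: "('m, 'v::euclidean_space) vbundle"
  assumes A: "smooth_atlas A" and E: "vector_bundle A E"
  shows "vector_bundle A (dual_bundle E)"
  unfolding vector_bundle_def
proof (intro conjI)
  have "\<Union>(fst ` dual_bundle E) = \<Union>(fst ` E)" by (force simp: dual_bundle_def)
  then show "\<Union>(fst ` dual_bundle E) = carrier_of A" using E by (simp add: vector_bundle_def)
  show "\<forall>(U, \<Phi>)\<in>dual_bundle E. openin (mtop A) U \<and> (\<forall>p\<in>U. linear (\<Phi> p) \<and> bij (\<Phi> p))"
    unfolding dual_bundle_def
    using vector_bundle_triv(1-3)[OF E]
    by (auto intro!: linear_inv_bij adjoint_linear bij_imp_bij_inv adjoint_bij(1))
  show "\<forall>(U, \<Phi>)\<in>dual_bundle E. \<forall>(U', \<Psi>)\<in>dual_bundle E. \<forall>v.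
      smooth_fun A (U \<inter> U') (\<lambda>p. \<Psi> p (inv (\<Phi> p) v))"
    unfolding dual_bundle_def
  proof (clarify)
    fix U1 \<Phi> U2 \<Psi> and v :: 'v assume c: "(U1, \<Phi>) \<in> E" "(U2, \<Psi>) \<in> E"
    have "U2 \<subseteq> carrier_of A" using vector_bundle_triv(1)[OF E c(2)] openin_mtop_subset[OF A] by blast
    then have "carrier_of A \<inter> U2 \<inter> U1 = U1 \<inter> U2" by blast
    then show "smooth_fun A (U1 \<inter> U2) (\<lambda>p. inv (adjoint (\<Psi> p)) (inv (inv (adjoint (\<Phi> p))) v))"
      using adjoint_smooth[OF A openin_mtop_carrier[OF A] E E smooth_hom_id[OF E] c(2,1), of v]
      by (simp add: adjoint_ident)
  qed
qed

lemma vector_bundle_tangent: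
  fixes A :: "('m, 'b::euclidean_space) atlas"
  assumes A: "smooth_atlas A"
  shows "vector_bundle A (tangent_bundle A)"
  unfolding vector_bundle_def
proof (intro conjI)
  show "\<Union>(fst ` tangent_bundle A) = carrier_of A" by (force simp: tangent_bundle_def carrier_of_def)
  show "\<forall>(U, \<Phi>)\<in>tangent_bundle A. openin (mtop A) U \<and> (\<forall>p\<in>U. linear (\<Phi> p) \<and> bij (\<Phi> p))"
    using smooth_atlas_chart(3)[OF A] mdiff_chart_bij[OF A smooth_chart_in_atlas[OF A]]
    by (auto simp: tangent_bundle_def)
  show "\<forall>(U, \<Phi>)\<in>tangent_bundle A. \<forall>(U', \<Psi>)\<in>tangent_bundle A. \<forall>v.
      smooth_fun A (U \<inter> U') (\<lambda>p. \<Psi> p (inv (\<Phi> p) v))"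
    unfolding tangent_bundle_def
  proof (clarify)
    fix U1 \<phi> U2 \<psi> and v :: 'b assume c: "(U1, \<phi>) \<in> A" "(U2, \<psi>) \<in> A"
    have "smooth_fun A U2 \<psi>"
      using smooth_chart_properties(3)[OF A smooth_chart_in_atlas[OF A c(2)]] .
    from mdiff_smooth[OF A smooth_atlas_chart(3)[OF A c(2)] this c(1)]
    show "smooth_fun A (U1 \<inter> U2) (\<lambda>p. mdiff A \<psi> p (inv (mdiff A \<phi> p) v))"
      by (simp add: Int_commute)
  qed
qed

text \<open>Dualising twice returns a trivialisation only over its own domain, since elsewhere its
  values need not be linear bijections. The two bundles need not be equal as sets of
  trivialisations, so the identity has to be shown smooth in both directions.\<close>

lemma smooth_hom_double_dual:
  assumes A: "smooth_atlas A" and U: "openin (mtop A) U" and E: "vector_bundle A E"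
  shows "smooth_hom A U E (dual_bundle (dual_bundle E)) (\<lambda>p v. v)"
    "smooth_hom A U (dual_bundle (dual_bundle E)) E (\<lambda>p v. v)"
proof -
  note EE = vector_bundle_dual[OF A vector_bundle_dual[OF A E]]
  have dd: "inv (adjoint (inv (adjoint (\<Phi> p)))) = \<Phi> p" if "(U1, \<Phi>) \<in> E" "p \<in> U1" for U1 \<Phi> p
  proof -
    note \<Phi> = vector_bundle_triv(2,3)[OF E that]
    show ?thesis
      using adjoint_bij[OF \<Phi>] adjoint_bij[OF linear_inv_bij[OF \<Phi>]] adjoint_bij(2)[OF adjoint_linear[OF \<Phi>(1)]]
      by (simp add: adjoint_adjoint \<Phi> bij_imp_bij_inv inv_inv_eq linear_inv_bij)
  qed
  note id = smooth_homD(2)[OF smooth_hom_id[OF E, of U]]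
  show "smooth_hom A U E (dual_bundle (dual_bundle E)) (\<lambda>p v. v)"
  proof (rule smooth_homI)
    fix U1 \<Phi> U2 \<Psi>' v assume c: "(U1, \<Phi>) \<in> E" "(U2, \<Psi>') \<in> dual_bundle (dual_bundle E)"
    then obtain \<Psi> where d: "(U2, \<Psi>) \<in> E" "\<Psi>' = (\<lambda>p. inv (adjoint (inv (adjoint (\<Psi> p)))))"
      by (auto simp: dual_bundle_def)
    show "smooth_fun A (U \<inter> U1 \<inter> U2) (\<lambda>p. \<Psi>' p (inv (\<Phi> p) v))"
      by (rule smooth_fun_cong[OF A openin_triv2[OF A U E EE c] _ id[OF c(1) d(1)]])
        (simp add: d(2) dd[OF d(1)])
  qed (simp add: linear_iff)
  show "smooth_hom A U (dual_bundle (dual_bundle E)) E (\<lambda>p v. v)"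
  proof (rule smooth_homI)
    fix U1 \<Phi>' U2 \<Psi> v assume c: "(U1, \<Phi>') \<in> dual_bundle (dual_bundle E)" "(U2, \<Psi>) \<in> E"
    then obtain \<Phi> where d: "(U1, \<Phi>) \<in> E" "\<Phi>' = (\<lambda>p. inv (adjoint (inv (adjoint (\<Phi> p)))))"
      by (auto simp: dual_bundle_def)
    show "smooth_fun A (U \<inter> U1 \<inter> U2) (\<lambda>p. \<Psi> p (inv (\<Phi>' p) v))"
      by (rule smooth_fun_cong[OF A openin_triv2[OF A U EE E c] _ id[OF d(1) c(2)]])
        (simp add: d(2) dd[OF d(1)])
  qed (simp add: linear_iff)
qed

section \<open>Connections\<close>

lemma smooth_sectionD:
  assumes "smooth_section A U E s" "(U', \<Phi>) \<in> E"
  shows "smooth_fun A (U \<inter> U') (\<lambda>p. \<Phi> p (s p))"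
  using assms unfolding smooth_section_def by fast

lemma smooth_sectionI:
  assumes "\<And>U' \<Phi>. (U', \<Phi>) \<in> E \<Longrightarrow> smooth_fun A (U \<inter> U') (\<lambda>p. \<Phi> p (s p))"
  shows "smooth_section A U E s"
  unfolding smooth_section_def using assms by auto

lemma smooth_section_subset:
  assumes "smooth_section A U E s" "W \<subseteq> U" shows "smooth_section A W E s"
  by (rule smooth_sectionI, rule smooth_fun_subset[OF smooth_sectionD[OF assms(1)]]) (use assms(2) in auto)

lemma triv_section:
  assumes "vector_bundle A E" "(U, \<Phi>) \<in> E"
  shows "smooth_section A U E (\<lambda>p. inv (\<Phi> p) b)"
  by (rule smooth_sectionI, rule vector_bundle_triv(4)[OF assms])

lemma mdiff_inner_right:
  assumes A: "smooth_atlas A" and U: "openin (mtop A) U" "p \<in> U" and f: "smooth_fun A U f"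
  shows "mdiff A (\<lambda>q. f q \<bullet> b) p w = mdiff A f p w \<bullet> b"
  using mdiff_eqI[OF has_mdiff_bounded_linear[OF bounded_linear_inner_left smooth_fun_has_mdiff[OF A U f]]]
  by metis

context
  fixes A :: "('m, 'b::euclidean_space) atlas" and E :: "('m, 'v::euclidean_space) vbundle"
  assumes A: "smooth_atlas A" and E: "vector_bundle A E"
begin

lemma smooth_section_add:
  assumes "openin (mtop A) U" "smooth_section A U E s" "smooth_section A U E t"
  shows "smooth_section A U E (\<lambda>p. s p + t p)"
proof (rule smooth_sectionI)
  fix U' \<Phi> assume c: "(U', \<Phi>) \<in> E"
  have o: "openin (mtop A) (U \<inter> U')" using assms(1) vector_bundle_triv(1)[OF E c] by blast
  show "smooth_fun A (U \<inter> U') (\<lambda>p. \<Phi> p (s p + t p))"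
    by (rule smooth_fun_cong[OF A o _ smooth_fun_add[OF A o smooth_sectionD[OF assms(2) c] smooth_sectionD[OF assms(3) c]]])
      (simp add: linear_add[OF vector_bundle_triv(2)[OF E c]])
qed

lemma smooth_section_scale:
  assumes "openin (mtop A) U" "smooth_fun A U f" "smooth_section A U E s"
  shows "smooth_section A U E (\<lambda>p. f p *\<^sub>R s p)"
proof (rule smooth_sectionI)
  fix U' \<Phi> assume c: "(U', \<Phi>) \<in> E"
  have o: "openin (mtop A) (U \<inter> U')" using assms(1) vector_bundle_triv(1)[OF E c] by blast
  have f: "smooth_fun A (U \<inter> U') f" using smooth_fun_subset[OF assms(2)] by blast
  show "smooth_fun A (U \<inter> U') (\<lambda>p. \<Phi> p (f p *\<^sub>R s p))"
    by (rule smooth_fun_cong[OF A o _ smooth_fun_bilinear[OF A o bounded_bilinear_scaleR f smooth_sectionD[OF assms(3) c]]])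
      (simp add: linear_scale[OF vector_bundle_triv(2)[OF E c]])
qed

lemma smooth_section_zero:
  assumes "openin (mtop A) U" shows "smooth_section A U E (\<lambda>p. 0)"
proof (rule smooth_sectionI)
  fix U' \<Phi> assume c: "(U', \<Phi>) \<in> E"
  have o: "openin (mtop A) (U \<inter> U')" using assms vector_bundle_triv(1)[OF E c] by blast
  show "smooth_fun A (U \<inter> U') (\<lambda>p. \<Phi> p 0)"
    by (rule smooth_fun_cong[OF A o _ smooth_fun_const[OF A o, of 0]])
      (simp add: linear_0[OF vector_bundle_triv(2)[OF E c]])
qed

lemma smooth_section_sum:
  assumes U: "openin (mtop A) U" and "\<And>i. i \<in> I \<Longrightarrow> smooth_section A U E (s i)"
  shows "smooth_section A U E (\<lambda>p. \<Sum>i\<in>I. s i p)"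
  using assms(2)
proof (induction I rule: infinite_finite_induct)
  case (insert i I)
  then show ?case using smooth_section_add[OF U, of "s i"] by simp
qed (simp_all add: smooth_section_zero[OF U])

text \<open>A trivialisation and its inverse transpose preserve the pairing, so pairings of sections
  may be computed in trivialised form, where they are visibly smooth.\<close>

lemma triv_inner:
  assumes "(U, \<Phi>) \<in> E" "p \<in> U"
  shows "inv (adjoint (\<Phi> p)) f \<bullet> \<Phi> p v = f \<bullet> v"
    "inv (adjoint (\<Phi> p)) f \<bullet> c = f \<bullet> inv (\<Phi> p) c"
  using adjoint_bij(2)[OF vector_bundle_triv(2,3)[OF E assms]] vector_bundle_inv[OF E assms]
  by (simp_all add: adjoint_inner)

lemma triv_basis_expansion:
  assumes "(U, \<Phi>) \<in> E" "p \<in> U"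
  shows "(\<Sum>b\<in>Basis. (u \<bullet> b) *\<^sub>R inv (\<Phi> p) b) = inv (\<Phi> p) u"
  by (rule linear_Basis_sum[OF vector_bundle_inv(3)[OF E assms], symmetric])

lemma section_inner_smooth:
  assumes U: "openin (mtop A) U" and s: "smooth_section A U E s"
    and f: "smooth_section A U (dual_bundle E) f"
  shows "smooth_fun A U (\<lambda>p. f p \<bullet> s p)"
proof (rule smooth_fun_local[OF A])
  fix p assume p: "p \<in> U"
  then have "p \<in> carrier_of A" using openin_mtop_subset[OF A U] by blast
  then obtain U' \<Phi> where c: "(U', \<Phi>) \<in> E" "p \<in> U'" using vector_bundle_cover[OF E] by blast
  have o: "openin (mtop A) (U \<inter> U')" using U vector_bundle_triv(1)[OF E c(1)] by blast
  have "(U', \<lambda>p. inv (adjoint (\<Phi> p))) \<in> dual_bundle E"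
    using c(1) by (force simp: dual_bundle_def)
  then have "smooth_fun A (U \<inter> U') (\<lambda>p. inv (adjoint (\<Phi> p)) (f p) \<bullet> \<Phi> p (s p))"
    by (rule smooth_fun_bilinear[OF A o bounded_bilinear_inner smooth_sectionD[OF f]
          smooth_sectionD[OF s c(1)]])
  then have "smooth_fun A (U \<inter> U') (\<lambda>p. f p \<bullet> s p)"
    by (rule smooth_fun_cong[OF A o, rotated]) (simp add: triv_inner(1)[OF c(1)])
  then show "\<exists>W. openin (mtop A) W \<and> p \<in> W \<and> smooth_fun A W (\<lambda>p. f p \<bullet> s p)"
    using o p c(2) by blast
qed

section \<open>The local formula for a connection, and the dual connection\<close>

context
  fixes N :: "('m, 'b, 'v) conn"
  assumes N: "connection A E N"
begin

lemma connection_axioms: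
  assumes "openin (mtop A) U"
  shows "smooth_section A U E s \<Longrightarrow> smooth_hom A U (tangent_bundle A) E (N s)"
    "smooth_section A U E s \<Longrightarrow> smooth_section A U E t \<Longrightarrow> p \<in> U \<Longrightarrow>
      N (\<lambda>q. s q + t q) p w = N s p w + N t p w"
    "smooth_section A U E s \<Longrightarrow> smooth_section A U E t \<Longrightarrow> (\<And>q. q \<in> U \<Longrightarrow> s q = t q) \<Longrightarrow>
      p \<in> U \<Longrightarrow> N s p w = N t p w"
    "smooth_fun A U f \<Longrightarrow> smooth_section A U E s \<Longrightarrow> p \<in> U \<Longrightarrow>
      N (\<lambda>q. f q *\<^sub>R s q) p w = mdiff A f p w *\<^sub>R s p + f p *\<^sub>R N s p w"
  using N[unfolded connection_def, rule_format, OF assms] by simp_all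

lemma connection_sum:
  fixes f :: "'i \<Rightarrow> 'm \<Rightarrow> real"
  assumes U: "openin (mtop A) U" and p: "p \<in> U"
    and "\<And>i. i \<in> I \<Longrightarrow> smooth_fun A U (f i)" "\<And>i. i \<in> I \<Longrightarrow> smooth_section A U E (s i)"
  shows "N (\<lambda>q. \<Sum>i\<in>I. f i q *\<^sub>R s i q) p w
    = (\<Sum>i\<in>I. mdiff A (f i) p w *\<^sub>R s i p + f i p *\<^sub>R N (s i) p w)"
proof -
  \<comment> \<open>The zero section is its own multiple by the zero function, so the Leibniz rule
    gives this.\<close>
  have z: "N (\<lambda>q. 0) p w = 0"
    using connection_axioms(4)[OF U smooth_fun_const[OF A U, of 0] smooth_section_zero[OF U] p, of w]
    by simp
  show ?thesis
    using assms(3,4)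
  proof (induction I rule: infinite_finite_induct)
    case (insert i I)
    have "smooth_section A U E (\<lambda>q. f i q *\<^sub>R s i q)"
      using insert.prems by (intro smooth_section_scale[OF U]) auto
    moreover have "smooth_section A U E (\<lambda>q. \<Sum>i\<in>I. f i q *\<^sub>R s i q)"
      using insert.prems by (intro smooth_section_sum[OF U] smooth_section_scale[OF U]) auto
    ultimately have "N (\<lambda>q. f i q *\<^sub>R s i q + (\<Sum>i\<in>I. f i q *\<^sub>R s i q)) p w
        = N (\<lambda>q. f i q *\<^sub>R s i q) p w + N (\<lambda>q. \<Sum>i\<in>I. f i q *\<^sub>R s i q) p w"
      by (rule connection_axioms(2)[OF U _ _ p])
    also have "N (\<lambda>q. f i q *\<^sub>R s i q) p w = mdiff A (f i) p w *\<^sub>R s i p + f i p *\<^sub>R N (s i) p w"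
      using insert.prems by (intro connection_axioms(4)[OF U _ _ p]) auto
    finally show ?case using insert by simp
  qed (simp_all add: z)
qed

text \<open>A connection is d plus a connection form in a trivialisation: expand \<open>s\<close> in
  the frame \<open>inv (\<Phi> q) b\<close> and apply the Leibniz rule. The expansion holds only
  over the trivialising set, and the third clause of \<open>connection\<close> permits the
  replacement.\<close>

lemma connection_triv_sum:
  assumes U: "openin (mtop A) U" "p \<in> U" and s: "smooth_section A U E s"
    and c: "(U', \<Phi>) \<in> E" "p \<in> U'"
  shows "N s p w = (\<Sum>b\<in>Basis. (mdiff A (\<lambda>q. \<Phi> q (s q)) p w \<bullet> b) *\<^sub>R inv (\<Phi> p) b
    + (\<Phi> p (s p) \<bullet> b) *\<^sub>R N (\<lambda>q. inv (\<Phi> q) b) p w)"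
proof -
  let ?W = "U \<inter> U'"
  have o: "openin (mtop A) ?W" and pW: "p \<in> ?W"
    using U c vector_bundle_triv(1)[OF E c(1)] by blast+
  have sW: "smooth_section A ?W E s" using smooth_section_subset[OF s] by blast
  have eW: "smooth_section A ?W E (\<lambda>q. inv (\<Phi> q) b)" for b
    using smooth_section_subset[OF triv_section[OF E c(1)]] by blast
  have fW: "smooth_fun A ?W (\<lambda>q. \<Phi> q (s q) \<bullet> b)" for b
    by (rule smooth_fun_bounded_linear[OF A o bounded_linear_inner_left smooth_sectionD[OF s c(1)]])
  have "N s p w = N (\<lambda>q. \<Sum>b\<in>Basis. (\<Phi> q (s q) \<bullet> b) *\<^sub>R inv (\<Phi> q) b) p w"
  proof (rule connection_axioms(3)[OF o sW _ _ pW])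
    show "smooth_section A ?W E (\<lambda>q. \<Sum>b\<in>Basis. (\<Phi> q (s q) \<bullet> b) *\<^sub>R inv (\<Phi> q) b)"
      by (intro smooth_section_sum[OF o] smooth_section_scale[OF o] fW eW)
    show "s q = (\<Sum>b\<in>Basis. (\<Phi> q (s q) \<bullet> b) *\<^sub>R inv (\<Phi> q) b)" if "q \<in> ?W" for q
      using that triv_basis_expansion[OF c(1), of q] vector_bundle_inv(1)[OF E c(1), of q] by simp
  qed
  also have "\<dots> = (\<Sum>b\<in>Basis. mdiff A (\<lambda>q. \<Phi> q (s q) \<bullet> b) p w *\<^sub>R inv (\<Phi> p) b
    + (\<Phi> p (s p) \<bullet> b) *\<^sub>R N (\<lambda>q. inv (\<Phi> q) b) p w)"
    by (rule connection_sum[OF o pW fW eW])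
  finally show ?thesis unfolding mdiff_inner_right[OF A o pW smooth_sectionD[OF s c(1)]] .
qed

lemma connection_triv:
  assumes "openin (mtop A) U" "p \<in> U" "smooth_section A U E s" "(U', \<Phi>) \<in> E" "p \<in> U'"
  shows "N s p w = inv (\<Phi> p) (mdiff A (\<lambda>q. \<Phi> q (s q)) p w)
    + (\<Sum>b\<in>Basis. (\<Phi> p (s p) \<bullet> b) *\<^sub>R N (\<lambda>q. inv (\<Phi> q) b) p w)"
  unfolding connection_triv_sum[OF assms] sum.distrib triv_basis_expansion[OF assms(4,5)] ..

text \<open>The sections that are constant in a trivialisation take every value at \<open>p\<close>,
  so pairings with local sections separate covectors. This gives uniqueness in
  \<open>dual_connection\<close> and reduces later identities for it to identities between
  scalars.\<close>

lemma dual_eqI: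
  assumes p: "p \<in> carrier_of A"
    and eq: "\<And>U s. openin (mtop A) U \<Longrightarrow> p \<in> U \<Longrightarrow> smooth_section A U E s \<Longrightarrow> u \<bullet> s p = u' \<bullet> s p"
  shows "u = u'"
proof -
  obtain U \<Phi> where c: "(U, \<Phi>) \<in> E" "p \<in> U" using vector_bundle_cover[OF E p] .
  have "u \<bullet> inv (\<Phi> p) x = u' \<bullet> inv (\<Phi> p) x" for x
    by (rule eq[OF vector_bundle_triv(1)[OF E c(1)] c(2) triv_section[OF E c(1)]])
  from this[of "\<Phi> p _"] have "u \<bullet> x = u' \<bullet> x" for x
    by (simp add: vector_bundle_inv(1)[OF E c])
  then show ?thesis using vector_eq_rdot by blast
qed

text \<open>Resolves the definite description. The right hand side depends on \<open>s\<close> only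
  through \<open>s p\<close>, because the derivatives of the coefficients of \<open>s\<close>
  cancel; so a covector fixed by its values on one frame satisfies the identity for every local
  section.\<close>

lemma dual_connection_inner:
  assumes U: "openin (mtop A) U" "p \<in> U" and f: "smooth_section A U (dual_bundle E) f"
    and U2: "openin (mtop A) U2" "p \<in> U2" and s: "smooth_section A U2 E s"
  shows "dual_connection A E N f p w \<bullet> s p = mdiff A (\<lambda>q. f q \<bullet> s q) p w - f p \<bullet> N s p w"
proof -
  have p: "p \<in> carrier_of A" using openin_mtop_subset[OF A U(1)] U(2) by blast
  obtain U' \<Phi> where c: "(U', \<Phi>) \<in> E" "p \<in> U'" using vector_bundle_cover[OF E p] .
  let ?e = "\<lambda>b q. inv (\<Phi> q) b"
  \<comment> \<open>The values on the frame \<open>?e b\<close> are forced, and the vectors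
    \<open>adjoint (\<Phi> p) b\<close> form the dual frame.\<close>
  define u where "u = (\<Sum>b\<in>Basis. (mdiff A (\<lambda>q. f q \<bullet> ?e b q) p w - f p \<bullet> N (?e b) p w) *\<^sub>R adjoint (\<Phi> p) b)"
  let ?P = "\<lambda>u. \<forall>U s. openin (mtop A) U \<and> p \<in> U \<and> smooth_section A U E s \<longrightarrow>
        u \<bullet> s p = mdiff A (\<lambda>q. f q \<bullet> s q) p w - f p \<bullet> N s p w"
  have "?P u"
  proof (intro allI impI, elim conjE)
    fix U2 s assume U2: "openin (mtop A) U2" "p \<in> U2" and s: "smooth_section A U2 E s"
    let ?W = "U \<inter> U' \<inter> U2"
    have W: "openin (mtop A) ?W" and pW: "p \<in> ?W"
      using U U2 c vector_bundle_triv(1)[OF E c(1)] by blast+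
    have fe: "smooth_fun A ?W (\<lambda>q. f q \<bullet> ?e b q)" for b
      by (rule section_inner_smooth[OF W smooth_section_subset[OF triv_section[OF E c(1)]]
            smooth_section_subset[OF f]]) blast+
    have sf: "smooth_fun A ?W (\<lambda>q. \<Phi> q (s q))"
      by (rule smooth_fun_subset[OF smooth_sectionD[OF s c(1)]]) blast
    let ?d = "\<lambda>b. mdiff A (\<lambda>q. f q \<bullet> ?e b q) p"
    let ?ds = "mdiff A (\<lambda>q. \<Phi> q (s q)) p"
    have "has_mdiff A (\<lambda>q. \<Sum>b\<in>Basis. (\<Phi> q (s q) \<bullet> b) * (f q \<bullet> ?e b q)) p
        (\<lambda>w. \<Sum>b\<in>Basis. (\<Phi> p (s p) \<bullet> b) * ?d b w + (?ds w \<bullet> b) * (f p \<bullet> ?e b p))"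
      by (rule has_mdiff_sum, rule has_mdiff_bilinear[OF A p bounded_bilinear_mult
            has_mdiff_bounded_linear[OF bounded_linear_inner_left smooth_fun_has_mdiff[OF A W pW sf]]
            smooth_fun_has_mdiff[OF A W pW fe]])
    moreover have "(\<Sum>b\<in>Basis. (\<Phi> q (s q) \<bullet> b) * (f q \<bullet> ?e b q)) = f q \<bullet> s q" if "q \<in> ?W" for q
    proof -
      have "f q \<bullet> (\<Sum>b\<in>Basis. (\<Phi> q (s q) \<bullet> b) *\<^sub>R ?e b q) = f q \<bullet> s q"
        using that triv_basis_expansion[OF c(1), of q] vector_bundle_inv(1)[OF E c(1), of q] by simp
      then show ?thesis by (simp add: inner_sum_right)
    qed
    ultimately have "has_mdiff A (\<lambda>q. f q \<bullet> s q) p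
        (\<lambda>w. \<Sum>b\<in>Basis. (\<Phi> p (s p) \<bullet> b) * ?d b w + (?ds w \<bullet> b) * (f p \<bullet> ?e b p))"
      by (rule has_mdiff_cong[OF A W pW, rotated])
    from mdiff_eqI[OF this]
    have d: "mdiff A (\<lambda>q. f q \<bullet> s q) p w
        = (\<Sum>b\<in>Basis. (\<Phi> p (s p) \<bullet> b) * ?d b w + (?ds w \<bullet> b) * (f p \<bullet> ?e b p))" by metis
    have "f p \<bullet> N s p w = (\<Sum>b\<in>Basis. (?ds w \<bullet> b) * (f p \<bullet> ?e b p) + (\<Phi> p (s p) \<bullet> b) * (f p \<bullet> N (?e b) p w))"
      unfolding connection_triv_sum[OF U2 s c] by (simp add: inner_sum_right inner_add_right)
    with d have "mdiff A (\<lambda>q. f q \<bullet> s q) p w - f p \<bullet> N s p w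
        = (\<Sum>b\<in>Basis. (?d b w - f p \<bullet> N (?e b) p w) * (\<Phi> p (s p) \<bullet> b))"
      by (simp add: sum_subtractf[symmetric] algebra_simps)
    also have "\<dots> = u \<bullet> s p"
      unfolding u_def inner_sum_left
      by (simp add: adjoint_inner[OF vector_bundle_triv(2)[OF E c]] inner_commute[of "\<Phi> p (s p)"])
    finally show "u \<bullet> s p = mdiff A (\<lambda>q. f q \<bullet> s q) p w - f p \<bullet> N s p w" ..
  qed
  moreover have "u' = u" if "?P u'" for u'
    by (rule dual_eqI[OF p]) (use that \<open>?P u\<close> in auto)
  ultimately have "?P (THE u. ?P u)" by (rule theI)
  then show ?thesis unfolding dual_connection_def using U2 s by blast
qed

text \<open>Makes everything proved for the total space of a bundle with connection available for
  the dual. The algebraic clauses are tested by pairing with arbitrary local sections, which leaves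
  rules for differentials of scalar functions; smoothness is read off from the pairings with a
  frame.\<close>

lemma connection_dual: "connection A (dual_bundle E) (dual_connection A E N)"
  unfolding connection_def
proof (intro allI impI)
  fix U assume U: "openin (mtop A) U"
  let ?N = "dual_connection A E N"
  note E' = vector_bundle_dual[OF A E]
  have carr: "p \<in> carrier_of A" if "p \<in> U" for p using that openin_mtop_subset[OF A U] by blast
  have hm: "has_mdiff A (\<lambda>q. f q \<bullet> s q) p (mdiff A (\<lambda>q. f q \<bullet> s q) p)"
    if "smooth_section A U (dual_bundle E) f" "openin (mtop A) U2" "p \<in> U" "p \<in> U2"
      "smooth_section A U2 E s" for f s U2 p
  proof (rule smooth_fun_has_mdiff[OF A])
    show "openin (mtop A) (U \<inter> U2)" using U that by blast
    then show "smooth_fun A (U \<inter> U2) (\<lambda>q. f q \<bullet> s q)"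
      using that by (intro section_inner_smooth) (auto elim: smooth_section_subset)
  qed (use that in simp)
  show "(\<forall>s. smooth_section A U (dual_bundle E) s \<longrightarrow>
         smooth_hom A U (tangent_bundle A) (dual_bundle E) (?N s)) \<and>
     (\<forall>s t. smooth_section A U (dual_bundle E) s \<and> smooth_section A U (dual_bundle E) t \<longrightarrow>
        (\<forall>p\<in>U. \<forall>w. ?N (\<lambda>q. s q + t q) p w = ?N s p w + ?N t p w)) \<and>
     (\<forall>s t. smooth_section A U (dual_bundle E) s \<and> smooth_section A U (dual_bundle E) t \<and> (\<forall>q\<in>U. s q = t q) \<longrightarrow>
        (\<forall>p\<in>U. \<forall>w. ?N s p w = ?N t p w)) \<and>
     (\<forall>f s. smooth_fun A U f \<and> smooth_section A U (dual_bundle E) s \<longrightarrow>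
        (\<forall>p\<in>U. \<forall>w. ?N (\<lambda>q. f q *\<^sub>R s q) p w = mdiff A f p w *\<^sub>R s p + f p *\<^sub>R ?N s p w))"
  proof (intro conjI allI impI ballI; (elim conjE)?)
    fix f assume f: "smooth_section A U (dual_bundle E) f"
    show "smooth_hom A U (tangent_bundle A) (dual_bundle E) (?N f)"
    proof (rule smooth_homI)
      fix p assume p: "p \<in> U"
      note inner = dual_connection_inner[OF U p f]
      have l: "linear (mdiff A (\<lambda>q. f q \<bullet> s q) p)" "linear (N s p)"
        if "openin (mtop A) U2" "p \<in> U2" "smooth_section A U2 E s" for s U2
        using has_mdiff_linear[OF hm[OF f that(1) p that(2,3)]]
          smooth_homD(1)[OF connection_axioms(1)[OF that(1,3)] that(2)] by auto
      show "linear (?N f p)"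
      proof (rule linearI)
        show "?N f p (w + w') = ?N f p w + ?N f p w'" for w w'
          by (rule dual_eqI[OF carr[OF p]])
            (simp add: inner inner_add_left inner_add_right linear_add[OF l(1)] linear_add[OF l(2)])
        show "?N f p (r *\<^sub>R w) = r *\<^sub>R ?N f p w" for r w
          by (rule dual_eqI[OF carr[OF p]])
            (simp add: inner linear_scale[OF l(1)] linear_scale[OF l(2)] right_diff_distrib)
      qed
    next
      fix U1 \<Theta> U2 \<Psi>' v
      assume c: "(U1, \<Theta>) \<in> tangent_bundle A" "(U2, \<Psi>') \<in> dual_bundle E"
      obtain \<phi> where 1: "(U1, \<phi>) \<in> A" "\<Theta> = mdiff A \<phi>" using c(1) by (auto simp: tangent_bundle_def)
      obtain \<Psi> where 2: "(U2, \<Psi>) \<in> E" "\<Psi>' = (\<lambda>p. inv (adjoint (\<Psi> p)))"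
        using c(2) by (auto simp: dual_bundle_def)
      let ?W = "U \<inter> U1 \<inter> U2"
      have U2: "openin (mtop A) U2" using vector_bundle_triv(1)[OF E 2(1)] .
      have UU2: "openin (mtop A) (U \<inter> U2)" using U U2 by blast
      have W: "openin (mtop A) ?W"
        using U smooth_atlas_chart(3)[OF A 1(1)] U2 by blast
      let ?e = "\<lambda>b q. inv (\<Psi> q) b"
      let ?w = "\<lambda>p. inv (mdiff A \<phi> p) v"
      have e: "smooth_section A U2 E (?e b)" for b using triv_section[OF E 2(1)] .
      have s1: "smooth_fun A ?W (\<lambda>p. mdiff A (\<lambda>q. f q \<bullet> ?e b q) p (?w p))" for b
      proof -
        have "smooth_fun A (U \<inter> U2) (\<lambda>q. f q \<bullet> ?e b q)"
          by (rule section_inner_smooth[OF UU2 smooth_section_subset[OF e] smooth_section_subset[OF f]]) blast+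
        from mdiff_smooth[OF A UU2 this 1(1)] show ?thesis by (rule smooth_fun_subset) blast
      qed
      have s2: "smooth_fun A ?W (\<lambda>p. f p \<bullet> N (?e b) p (?w p))" for b
      proof -
        have 3: "smooth_fun A ?W (\<lambda>p. \<Psi> p (N (?e b) p (?w p)))"
          by (rule smooth_fun_subset[OF smooth_homD(2)[OF connection_axioms(1)[OF U2 e] c(1)[unfolded 1(2)] 2(1)]]) blast
        have 4: "smooth_fun A ?W (\<lambda>p. inv (adjoint (\<Psi> p)) (f p))"
          by (rule smooth_fun_subset[OF smooth_sectionD[OF f c(2)[unfolded 2(2)]]]) blast
        show ?thesis
          by (rule smooth_fun_cong[OF A W _ smooth_fun_bilinear[OF A W bounded_bilinear_inner 4 3]])
            (simp add: triv_inner(1)[OF 2(1)])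
      qed
      have s3: "smooth_fun A ?W (\<lambda>p. mdiff A (\<lambda>q. f q \<bullet> ?e b q) p (?w p) - f p \<bullet> N (?e b) p (?w p))" for b
        using smooth_fun_add[OF A W s1 smooth_fun_bounded_linear[OF A W bounded_linear_minus[OF bounded_linear_ident] s2]]
        by simp
      have "smooth_fun A ?W (\<lambda>p. \<Sum>b\<in>Basis.
          (mdiff A (\<lambda>q. f q \<bullet> ?e b q) p (?w p) - f p \<bullet> N (?e b) p (?w p)) *\<^sub>R b)"
        by (rule smooth_fun_sum[OF A W], rule smooth_fun_bounded_linear[OF A W bounded_linear_scaleR_left s3])
      moreover have "(\<Sum>b\<in>Basis. (mdiff A (\<lambda>q. f q \<bullet> ?e b q) p (?w p) - f p \<bullet> N (?e b) p (?w p)) *\<^sub>R b)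
          = inv (adjoint (\<Psi> p)) (?N f p (?w p))" if p: "p \<in> ?W" for p
      proof -
        have p': "p \<in> U" "p \<in> U2" using p by auto
        have "inv (adjoint (\<Psi> p)) (?N f p (?w p)) \<bullet> b
            = mdiff A (\<lambda>q. f q \<bullet> ?e b q) p (?w p) - f p \<bullet> N (?e b) p (?w p)" for b
          unfolding triv_inner(2)[OF 2(1) p'(2)]
          by (rule dual_connection_inner[OF U p'(1) f U2 p'(2) e])
        then show ?thesis by (metis (no_types, lifting) euclidean_representation sum.cong)
      qed
      ultimately show "smooth_fun A ?W (\<lambda>p. \<Psi>' p (?N f p (inv (\<Theta> p) v)))"
        unfolding 1(2) 2(2) by (rule smooth_fun_cong[OF A W, rotated])
    qed
  next
    fix s t p w assume s: "smooth_section A U (dual_bundle E) s" and t: "smooth_section A U (dual_bundle E) t"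
      and p: "p \<in> U"
    have st: "smooth_section A U (dual_bundle E) (\<lambda>q. s q + t q)"
      by (rule Submission.smooth_section_add[OF A E' U s t])
    show "?N (\<lambda>q. s q + t q) p w = ?N s p w + ?N t p w"
    proof (rule dual_eqI[OF carr[OF p]])
      fix U2 r assume r: "openin (mtop A) U2" "p \<in> U2" "smooth_section A U2 E r"
      \<comment> \<open>The sum of two terms is written as a sum over the two truth values, so that
        the rule for finite sums applies.\<close>
      have "has_mdiff A (\<lambda>q. (\<Sum>i\<in>{True, False}. (if i then s q else t q) \<bullet> r q)) p
          (\<lambda>w. \<Sum>i\<in>{True, False}. mdiff A (\<lambda>q. (if i then s q else t q) \<bullet> r q) p w)"
      proof (rule has_mdiff_sum)
        show "has_mdiff A (\<lambda>q. (if i then s q else t q) \<bullet> r q) p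
            (mdiff A (\<lambda>q. (if i then s q else t q) \<bullet> r q) p)" for i
          by (cases i) (simp_all add: hm[OF s r(1) p r(2,3)] hm[OF t r(1) p r(2,3)])
      qed
      from mdiff_eqI[OF this]
      have "mdiff A (\<lambda>q. (s q + t q) \<bullet> r q) p w = mdiff A (\<lambda>q. s q \<bullet> r q) p w + mdiff A (\<lambda>q. t q \<bullet> r q) p w"
        by (simp add: inner_add_left)
      then show "?N (\<lambda>q. s q + t q) p w \<bullet> r p = (?N s p w + ?N t p w) \<bullet> r p"
        by (simp add: inner_add_left dual_connection_inner[OF U p st r] dual_connection_inner[OF U p s r]
            dual_connection_inner[OF U p t r])
    qed
  next
    fix s t p w assume s: "smooth_section A U (dual_bundle E) s" and t: "smooth_section A U (dual_bundle E) t"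
      and p: "p \<in> U" and eq: "\<forall>q\<in>U. s q = t q"
    show "?N s p w = ?N t p w"
    proof (rule dual_eqI[OF carr[OF p]])
      fix U2 r assume r: "openin (mtop A) U2" "p \<in> U2" "smooth_section A U2 E r"
      have "mdiff A (\<lambda>q. s q \<bullet> r q) p = mdiff A (\<lambda>q. t q \<bullet> r q) p"
        by (rule mdiff_cong[OF A U p]) (simp add: eq)
      then show "?N s p w \<bullet> r p = ?N t p w \<bullet> r p"
        using eq p by (simp add: dual_connection_inner[OF U p s r] dual_connection_inner[OF U p t r])
    qed
  next
    fix f :: "'m \<Rightarrow> real" and s p w assume f: "smooth_fun A U f" and s: "smooth_section A U (dual_bundle E) s" and p: "p \<in> U"
    have fs: "smooth_section A U (dual_bundle E) (\<lambda>q. f q *\<^sub>R s q)"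
      by (rule Submission.smooth_section_scale[OF A E' U f s])
    show "?N (\<lambda>q. f q *\<^sub>R s q) p w = mdiff A f p w *\<^sub>R s p + f p *\<^sub>R ?N s p w"
    proof (rule dual_eqI[OF carr[OF p]])
      fix U2 r assume r: "openin (mtop A) U2" "p \<in> U2" "smooth_section A U2 E r"
      from mdiff_eqI[OF has_mdiff_bilinear[OF A carr[OF p] bounded_bilinear_mult smooth_fun_has_mdiff[OF A U p f] hm[OF s r(1) p r(2,3)]]]
      have "mdiff A (\<lambda>q. f q *\<^sub>R s q \<bullet> r q) p w
          = f p * mdiff A (\<lambda>q. s q \<bullet> r q) p w + mdiff A f p w * (s p \<bullet> r p)"
        by simp
      then show "?N (\<lambda>q. f q *\<^sub>R s q) p w \<bullet> r p = (mdiff A f p w *\<^sub>R s p + f p *\<^sub>R ?N s p w) \<bullet> r p"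
        by (simp add: dual_connection_inner[OF U p fs r] dual_connection_inner[OF U p s r]
            inner_add_left algebra_simps)
    qed
  qed
qed

end

end

section \<open>The total space\<close>

lemma smooth_on_sum:
  "open S \<Longrightarrow> (\<And>i. i \<in> I \<Longrightarrow> smooth_on S (f i)) \<Longrightarrow> smooth_on S (\<lambda>x. \<Sum>i\<in>I. f i x)"
  by (simp add: smooth_on_def Ck_on_sum)

lemma smooth_on_Pair:
  assumes "open S" "smooth_on S f" "smooth_on S g"
  shows "smooth_on S (\<lambda>x. (f x, g x))"
proof -
  have "smooth_on S (\<lambda>x. (f x, 0))" "smooth_on S (\<lambda>x. (0, g x))"
    by (rule smooth_on_bounded_linear[of "\<lambda>a. (a, 0)", OF _ assms(1,2)],
        rule bounded_linear_Pair[OF bounded_linear_ident bounded_linear_zero])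
      (rule smooth_on_bounded_linear[of "\<lambda>a. (0, a)", OF _ assms(1,3)],
        rule bounded_linear_Pair[OF bounded_linear_zero bounded_linear_ident])
  from smooth_on_add[OF assms(1) this] show ?thesis by simp
qed

lemma smooth_on_fst:
  fixes f :: "'a::euclidean_space \<Rightarrow> 'c::real_normed_vector"
  assumes "open S" "smooth_on S f"
  shows "smooth_on (S \<times> (UNIV :: 'd::euclidean_space set)) (\<lambda>z. f (fst z))"
proof (rule smooth_on_compose[OF _ assms(1) _ assms(2)])
  show "open (S \<times> (UNIV :: 'd set))" using assms(1) by (simp add: open_Times)
  then show "smooth_on (S \<times> (UNIV :: 'd set)) fst"
    by (intro smooth_on_linear_map bounded_linear_fst)
qed auto

lemma mdiff_Pair:
  assumes A: "smooth_atlas A" and U: "openin (mtop A) U" "p \<in> U"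
    and f: "smooth_fun A U f" and g: "smooth_fun A U g"
  shows "mdiff A (\<lambda>q. (f q, g q)) p w = (mdiff A f p w, mdiff A g p w)"
proof -
  have h: "has_mdiff A (\<lambda>q. (f q, g q)) p (mdiff A (\<lambda>q. (f q, g q)) p)"
    by (rule smooth_fun_has_mdiff[OF A U smooth_fun_Pair[OF A U(1) f g]])
  have "mdiff A f p w = fst (mdiff A (\<lambda>q. (f q, g q)) p w)"
    "mdiff A g p w = snd (mdiff A (\<lambda>q. (f q, g q)) p w)"
    using mdiff_eqI[OF has_mdiff_bounded_linear[OF bounded_linear_fst h]]
      mdiff_eqI[OF has_mdiff_bounded_linear[OF bounded_linear_snd h]] by simp_all
  then show ?thesis by simp
qed

lemma ball_ball_caseI:
  "(\<And>c c'. c \<in> S \<Longrightarrow> c' \<in> S \<Longrightarrow> case c of (a, b) \<Rightarrow> (case c' of (a', b') \<Rightarrow> P a b a' b')) \<Longrightarrow>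
    \<forall>(a, b)\<in>S. \<forall>(a', b')\<in>S. P a b a' b'"
  by fastforce

section \<open>Pullback of a bundle from the base to the total space\<close>

definition pullback_bundle :: "('m, 'w) vbundle \<Rightarrow> ('m \<times> 'v, 'w) vbundle" where
  "pullback_bundle F = (\<lambda>(U, \<Phi>). (U \<times> UNIV, \<lambda>z. \<Phi> (fst z))) ` F"

lemma in_pullback_bundleE:
  assumes "c \<in> pullback_bundle F"
  obtains U \<Phi> where "(U, \<Phi>) \<in> F" "c = (U \<times> UNIV, \<lambda>z. \<Phi> (fst z))"
  using assms unfolding pullback_bundle_def by (elim imageE) (auto intro: that)

text \<open>Equality holds on the level of trivialisations, here and for sums below. So a smooth
  endomorphism of W \<oplus> W^\<or> on the base pulls back to one of the sum of the pulled back W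
  and its dual, with no further identification.\<close>

lemma dual_pullback_bundle: "dual_bundle (pullback_bundle F) = pullback_bundle (dual_bundle F)"
  unfolding dual_bundle_def pullback_bundle_def image_image by (intro image_cong) auto

lemma sum_pullback_bundle:
  "sum_bundle (pullback_bundle F) (pullback_bundle G) = pullback_bundle (sum_bundle F G)"
proof (intro equalityI subsetI)
  fix c assume "c \<in> sum_bundle (pullback_bundle F) (pullback_bundle G)"
  then obtain U \<Phi> U' \<Psi> where 1: "(U, \<Phi>) \<in> F" "(U', \<Psi>) \<in> G"
    "c = (U \<times> UNIV \<inter> U' \<times> UNIV, \<lambda>z. map_prod (\<Phi> (fst z)) (\<Psi> (fst z)))"
    by (auto simp: sum_bundle_def pullback_bundle_def)
  have "(U \<inter> U', \<lambda>p. map_prod (\<Phi> p) (\<Psi> p)) \<in> sum_bundle F G" using 1 by (auto simp: sum_bundle_def)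
  then show "c \<in> pullback_bundle (sum_bundle F G)"
    unfolding pullback_bundle_def 1(3) Times_Int_Times by (intro image_eqI[rotated]) auto
next
  fix c assume "c \<in> pullback_bundle (sum_bundle F G)"
  then obtain U \<Phi> U' \<Psi> where 1: "(U, \<Phi>) \<in> F" "(U', \<Psi>) \<in> G"
    "c = ((U \<inter> U') \<times> UNIV, \<lambda>z. map_prod (\<Phi> (fst z)) (\<Psi> (fst z)))"
    by (auto simp: sum_bundle_def pullback_bundle_def)
  have "(U \<times> UNIV, \<lambda>z. \<Phi> (fst z)) \<in> pullback_bundle F" "(U' \<times> UNIV, \<lambda>z. \<Psi> (fst z)) \<in> pullback_bundle G"
    unfolding pullback_bundle_def by (rule image_eqI[OF _ 1(1)], simp) (rule image_eqI[OF _ 1(2)], simp)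
  moreover have "c = (U \<times> UNIV \<inter> U' \<times> UNIV, \<lambda>z. map_prod (\<Phi> (fst z)) (\<Psi> (fst z)))"
    by (simp add: 1(3) Times_Int_Times)
  ultimately show "c \<in> sum_bundle (pullback_bundle F) (pullback_bundle G)"
    unfolding sum_bundle_def by (intro CollectI exI conjI) (assumption | rule refl)+
qed

section \<open>Charts of the total space\<close>

definition bundle_chart :: "('m \<Rightarrow> 'b) \<Rightarrow> ('m \<Rightarrow> 'v \<Rightarrow> 'v) \<Rightarrow> 'm \<times> 'v \<Rightarrow> 'b \<times> 'v" where
  "bundle_chart \<phi> \<Phi> = (\<lambda>(p, v). (\<phi> p, \<Phi> p v))"

context
  fixes A :: "('m, 'b::euclidean_space) atlas" and E :: "('m, 'v::euclidean_space) vbundle"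
  assumes A: "smooth_atlas A" and E: "vector_bundle A E"
begin

private abbreviation X where "X \<equiv> total_space A E"

lemma bundle_chart_in:
  "(U, \<phi>) \<in> A \<Longrightarrow> (U', \<Phi>) \<in> E \<Longrightarrow> ((U \<inter> U') \<times> UNIV, bundle_chart \<phi> \<Phi>) \<in> X"
  unfolding total_space_def bundle_chart_def
  by (rule CollectI, intro exI conjI, rule refl, assumption, assumption)

lemma in_total_spaceE:
  assumes "c \<in> X"
  obtains U \<phi> U' \<Phi> where "(U, \<phi>) \<in> A" "(U', \<Phi>) \<in> E" "c = ((U \<inter> U') \<times> UNIV, bundle_chart \<phi> \<Phi>)"
  using assms unfolding total_space_def bundle_chart_def mem_Collect_eq
  by (elim exE conjE) (rule that, assumption, assumption, simp add: bundle_chart_def)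

lemma carrier_total_space: "carrier_of X = carrier_of A \<times> UNIV"
proof (intro equalityI subsetI)
  fix x assume "x \<in> carrier_of X"
  then obtain c where c: "c \<in> X" "x \<in> fst c" unfolding carrier_of_def by blast
  obtain U \<phi> U' \<Phi> where d: "(U, \<phi>) \<in> A" "(U', \<Phi>) \<in> E" "c = ((U \<inter> U') \<times> UNIV, bundle_chart \<phi> \<Phi>)"
    using c(1) by (rule in_total_spaceE)
  have "fst x \<in> U" using c(2) d(3) by (simp add: mem_Times_iff)
  then have "fst x \<in> carrier_of A" using openin_mtop_subset[OF A smooth_atlas_chart(3)[OF A d(1)]] by blast
  then show "x \<in> carrier_of A \<times> UNIV" by (simp add: mem_Times_iff)
next
  fix x :: "'m \<times> 'v" assume "x \<in> carrier_of A \<times> UNIV"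
  then have p: "fst x \<in> carrier_of A" by (simp add: mem_Times_iff)
  obtain U' \<Phi> where c: "(U', \<Phi>) \<in> E" "fst x \<in> U'" using vector_bundle_cover[OF E p] .
  obtain U \<phi> where d: "(U, \<phi>) \<in> A" "fst x \<in> U" using p by (auto simp: carrier_of_def)
  have "x \<in> (U \<inter> U') \<times> UNIV" using c(2) d(2) by (simp add: mem_Times_iff)
  then show "x \<in> carrier_of X"
    unfolding carrier_of_def by (intro UnionI[OF imageI[OF bundle_chart_in[OF d(1) c(1)]]]) simp
qed

lemma bundle_chart_inj:
  assumes "(U, \<phi>) \<in> A" "(U', \<Phi>) \<in> E"
  shows "inj_on (bundle_chart \<phi> \<Phi>) ((U \<inter> U') \<times> UNIV)"
proof (rule inj_onI)
  fix x y assume x: "x \<in> (U \<inter> U') \<times> (UNIV :: 'v set)" and y: "y \<in> (U \<inter> U') \<times> (UNIV :: 'v set)"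
    and eq: "bundle_chart \<phi> \<Phi> x = bundle_chart \<phi> \<Phi> y"
  have "\<phi> (fst x) = \<phi> (fst y)" "\<Phi> (fst x) (snd x) = \<Phi> (fst y) (snd y)"
    using eq by (simp_all add: bundle_chart_def split_beta)
  moreover have "fst x \<in> U" "fst y \<in> U" "fst x \<in> U'" using x y by (simp_all add: mem_Times_iff)
  ultimately have 1: "fst x = fst y"
    using inj_onD[OF smooth_atlas_chart(1)[OF A assms(1)]] by simp
  with \<open>\<Phi> (fst x) (snd x) = \<Phi> (fst y) (snd y)\<close>
  have "inv (\<Phi> (fst x)) (\<Phi> (fst x) (snd x)) = inv (\<Phi> (fst x)) (\<Phi> (fst x) (snd y))" by simp
  then show "x = y"
    using vector_bundle_inv(1)[OF E assms(2) \<open>fst x \<in> U'\<close>] 1 by (simp add: prod_eq_iff)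
qed

lemma bundle_chart_inv:
  assumes "(U, \<phi>) \<in> A" "(U', \<Phi>) \<in> E" "p \<in> U" "p \<in> U'"
  shows "inv_into ((U \<inter> U') \<times> UNIV) (bundle_chart \<phi> \<Phi>) (\<phi> p, u) = (p, inv (\<Phi> p) u)"
  by (rule inv_into_f_eq[OF bundle_chart_inj[OF assms(1,2)]])
    (use assms in \<open>auto simp: bundle_chart_def vector_bundle_inv(2)[OF E assms(2)]\<close>)

lemma bundle_chart_image:
  assumes "(U', \<Phi>) \<in> E" "W \<subseteq> U'"
  shows "bundle_chart \<phi> \<Phi> ` (W \<times> UNIV) = \<phi> ` W \<times> UNIV"
proof (intro equalityI subsetI)
  fix z assume "z \<in> \<phi> ` W \<times> (UNIV :: 'v set)"
  then obtain p u where z: "p \<in> W" "z = (\<phi> p, u)" by auto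
  show "z \<in> bundle_chart \<phi> \<Phi> ` (W \<times> UNIV)"
    by (rule image_eqI[of _ _ "(p, inv (\<Phi> p) u)"])
      (use z assms(2) in \<open>auto simp: bundle_chart_def vector_bundle_inv(2)[OF E assms(1)]\<close>)
qed (auto simp: bundle_chart_def)

text \<open>A transition map is that of the base in the first component; the second is the bundle
  transition, linear in the fibre coordinate with coefficients that depend smoothly on the base
  coordinate.\<close>

lemma smooth_atlas_total_space: "smooth_atlas X"
  unfolding smooth_atlas_def
proof (intro conjI, rule ballI, rule_tac[2] ball_ball_caseI)
  fix c assume "c \<in> X"
  then obtain U \<phi> U' \<Phi> where 1: "(U, \<phi>) \<in> A" "(U', \<Phi>) \<in> E" "c = ((U \<inter> U') \<times> UNIV, bundle_chart \<phi> \<Phi>)"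
    by (rule in_total_spaceE)
  have o: "open (\<phi> ` (U \<inter> U'))"
    using openin_mtop_image[OF A 1(1) vector_bundle_triv(1)[OF E 1(2)]] by (simp add: Int_commute)
  have "open (bundle_chart \<phi> \<Phi> ` ((U \<inter> U') \<times> UNIV))"
    by (subst bundle_chart_image[OF 1(2)]) (auto intro: open_Times[OF o])
  then show "case c of (U, \<phi>) \<Rightarrow> inj_on \<phi> U \<and> open (\<phi> ` U)"
    unfolding 1(3) using bundle_chart_inj[OF 1(1,2)] by simp
next
  fix c c' assume "c \<in> X" "c' \<in> X"
  obtain U \<phi> U' \<Phi> where 1: "(U, \<phi>) \<in> A" "(U', \<Phi>) \<in> E" "c = ((U \<inter> U') \<times> UNIV, bundle_chart \<phi> \<Phi>)"
    using \<open>c \<in> X\<close> by (rule in_total_spaceE)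
  obtain U2 \<phi>2 U2' \<Phi>2 where 2: "(U2, \<phi>2) \<in> A" "(U2', \<Phi>2) \<in> E"
    "c' = ((U2 \<inter> U2') \<times> UNIV, bundle_chart \<phi>2 \<Phi>2)"
    using \<open>c' \<in> X\<close> by (rule in_total_spaceE)
  define D f D' f' where D1: "D = (U \<inter> U') \<times> (UNIV :: 'v set)" and f: "f = bundle_chart \<phi> \<Phi>"
    and D2: "D' = (U2 \<inter> U2') \<times> (UNIV :: 'v set)" and f': "f' = bundle_chart \<phi>2 \<Phi>2"
  let ?W = "U \<inter> U' \<inter> (U2 \<inter> U2')"
  have D: "D \<inter> D' = ?W \<times> UNIV" unfolding D1 D2 by blast
  have W: "openin (mtop A) ?W"
    using smooth_atlas_chart(3)[OF A 1(1)] smooth_atlas_chart(3)[OF A 2(1)]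
      vector_bundle_triv(1)[OF E 1(2)] vector_bundle_triv(1)[OF E 2(2)] by blast
  have im: "f ` (D \<inter> D') = \<phi> ` ?W \<times> UNIV" unfolding D f by (rule bundle_chart_image[OF 1(2)]) blast
  have "?W \<inter> U = ?W" by blast
  with openin_mtop_image[OF A 1(1) W] have oW: "open (\<phi> ` ?W)" by metis
  then have o: "open (\<phi> ` ?W \<times> (UNIV :: 'v set))" by (simp add: open_Times)
  have "smooth_on (\<phi> ` ?W) (\<phi>2 \<circ> inv_into U \<phi>)"
    by (rule smooth_on_subset[OF smooth_atlas_transition(2)[OF A 1(1) 2(1)]]) blast
  then have s1: "smooth_on (\<phi> ` ?W \<times> (UNIV :: 'v set)) (\<lambda>z. (\<phi>2 \<circ> inv_into U \<phi>) (fst z))"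
    by (rule smooth_on_fst[OF oW])
  have "smooth_on (\<phi> ` ?W) ((\<lambda>p. \<Phi>2 p (inv (\<Phi> p) b)) \<circ> inv_into U \<phi>)" for b
    by (rule smooth_on_subset[OF smooth_funD[OF vector_bundle_triv(4)[OF E 1(2) 2(2), of b] 1(1)]]) blast
  then have s2: "smooth_on (\<phi> ` ?W \<times> (UNIV :: 'v set))
      (\<lambda>z. ((\<lambda>p. \<Phi>2 p (inv (\<Phi> p) b)) \<circ> inv_into U \<phi>) (fst z))" for b
    by (rule smooth_on_fst[OF oW])
  have s3: "smooth_on (\<phi> ` ?W \<times> (UNIV :: 'v set)) (\<lambda>z. snd z \<bullet> b)" for b
    by (rule smooth_on_linear_map[OF bounded_linear_compose[OF bounded_linear_inner_left bounded_linear_snd] o])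
  have s4: "smooth_on (\<phi> ` ?W \<times> (UNIV :: 'v set)) (\<lambda>z. \<Sum>b\<in>Basis. (snd z \<bullet> b) *\<^sub>R
      (((\<lambda>p. \<Phi>2 p (inv (\<Phi> p) b)) \<circ> inv_into U \<phi>) (fst z)))"
    by (rule smooth_on_sum[OF o], rule smooth_on_bilinear[OF bounded_bilinear_scaleR o s3 s2])
  have "smooth_on (\<phi> ` ?W \<times> UNIV) (f' \<circ> inv_into D f)"
  proof (rule smooth_on_cong[OF o _ smooth_on_Pair[OF o s1 s4]])
    fix z assume "z \<in> \<phi> ` ?W \<times> (UNIV :: 'v set)"
    then obtain p u where p: "p \<in> ?W" and z: "z = (\<phi> p, u)" by auto
    have i: "inv_into U \<phi> (\<phi> p) = p" using p smooth_atlas_chart(1)[OF A 1(1)] by simp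
    have "linear (\<lambda>u. \<Phi>2 p (inv (\<Phi> p) u))"
      using linear_compose[OF vector_bundle_inv(3)[OF E 1(2)] vector_bundle_triv(2)[OF E 2(2)], of p] p
      by (simp add: o_def)
    from linear_Basis_sum[OF this, of u]
    show "((\<phi>2 \<circ> inv_into U \<phi>) (fst z), \<Sum>b\<in>Basis. (snd z \<bullet> b) *\<^sub>R
      (((\<lambda>p. \<Phi>2 p (inv (\<Phi> p) b)) \<circ> inv_into U \<phi>) (fst z))) = (f' \<circ> inv_into D f) z"
      unfolding z D1 f f' o_def bundle_chart_inv[OF 1(1,2) IntD1[OF IntD1[OF p]] IntD2[OF IntD1[OF p]]]
      by (simp add: i bundle_chart_def)
  qed
  then have "open (f ` (D \<inter> D')) \<and> smooth_on (f ` (D \<inter> D')) (f' \<circ> inv_into D f)"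
    using o unfolding im by blast
  then show "case c of (U, \<phi>) \<Rightarrow> (case c' of (U', \<psi>) \<Rightarrow>
      open (\<phi> ` (U \<inter> U')) \<and> smooth_on (\<phi> ` (U \<inter> U')) (\<psi> \<circ> inv_into U \<phi>))"
    unfolding 1(3) 2(3) D1 D2 f f' by simp
qed

lemma openin_total_space:
  assumes U: "openin (mtop A) U" shows "openin (mtop X) (U \<times> UNIV)"
  unfolding openin_mtop[OF smooth_atlas_total_space]
proof (intro conjI ballI)
  show "U \<times> UNIV \<subseteq> carrier_of X"
    unfolding carrier_total_space using openin_mtop_subset[OF A U] by blast
  fix c assume "c \<in> X"
  then obtain U1 \<phi> U' \<Phi> where 1: "(U1, \<phi>) \<in> A" "(U', \<Phi>) \<in> E" "c = ((U1 \<inter> U') \<times> UNIV, bundle_chart \<phi> \<Phi>)"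
    by (rule in_total_spaceE)
  have "openin (mtop A) (U \<inter> U')" using U vector_bundle_triv(1)[OF E 1(2)] by blast
  from openin_mtop_image[OF A 1(1) this]
  have "open (\<phi> ` (U \<inter> (U1 \<inter> U')))" by (simp add: Int_ac)
  moreover have "bundle_chart \<phi> \<Phi> ` (U \<times> UNIV \<inter> (U1 \<inter> U') \<times> UNIV) = \<phi> ` (U \<inter> (U1 \<inter> U')) \<times> UNIV"
    unfolding Times_Int_Times Int_UNIV_right by (rule bundle_chart_image[OF 1(2)]) blast
  ultimately show "case c of (D, f) \<Rightarrow> open (f ` (U \<times> UNIV \<inter> D))"
    unfolding 1(3) by (simp add: open_Times)
qed

lemma smooth_fun_pullback:
  assumes U: "openin (mtop A) U" and f: "smooth_fun A U f"
  shows "smooth_fun X (U \<times> UNIV) (\<lambda>z. f (fst z))"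
  unfolding smooth_fun_def
proof (intro ballI)
  fix c assume "c \<in> X"
  then obtain U1 \<phi> U' \<Phi> where 1: "(U1, \<phi>) \<in> A" "(U', \<Phi>) \<in> E" "c = ((U1 \<inter> U') \<times> UNIV, bundle_chart \<phi> \<Phi>)"
    by (rule in_total_spaceE)
  let ?W = "U \<inter> (U1 \<inter> U')"
  have "openin (mtop A) (U \<inter> U')" using U vector_bundle_triv(1)[OF E 1(2)] by blast
  from openin_mtop_image[OF A 1(1) this] have oW: "open (\<phi> ` ?W)" by (simp add: Int_ac)
  have "smooth_on (\<phi> ` ?W) (f \<circ> inv_into U1 \<phi>)"
    by (rule smooth_on_subset[OF smooth_funD[OF f 1(1)]]) blast
  from smooth_on_fst[OF oW this]
  have "smooth_on (\<phi> ` ?W \<times> UNIV) ((\<lambda>z. f (fst z)) \<circ> inv_into ((U1 \<inter> U') \<times> UNIV) (bundle_chart \<phi> \<Phi>))"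
    by (rule smooth_on_cong[OF open_Times[OF oW open_UNIV], rotated])
      (auto simp: bundle_chart_inv[OF 1(1,2)] smooth_atlas_chart(1)[OF A 1(1)])
  moreover have "bundle_chart \<phi> \<Phi> ` (U \<times> UNIV \<inter> (U1 \<inter> U') \<times> UNIV) = \<phi> ` ?W \<times> UNIV"
    unfolding Times_Int_Times Int_UNIV_right by (rule bundle_chart_image[OF 1(2)]) blast
  ultimately show "case c of (D, g) \<Rightarrow>
      smooth_on (g ` (U \<times> UNIV \<inter> D)) ((\<lambda>z. f (fst z)) \<circ> inv_into D g)"
    unfolding 1(3) by simp
qed

text \<open>Locally this is the second component of a bundle chart; \<open>U'\<close> itself need
  not lie in the domain of a single base chart.\<close>

lemma smooth_fun_triv_snd:
  assumes c: "(U', \<Phi>) \<in> E"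
  shows "smooth_fun X (U' \<times> UNIV) (\<lambda>z. \<Phi> (fst z) (snd z))"
proof (rule smooth_fun_local[OF smooth_atlas_total_space])
  fix x assume x: "x \<in> U' \<times> (UNIV :: 'v set)"
  have "fst x \<in> carrier_of A" using x openin_mtop_subset[OF A vector_bundle_triv(1)[OF E c]] by auto
  then obtain U \<phi> where d: "(U, \<phi>) \<in> A" "fst x \<in> U" by (auto simp: carrier_of_def)
  let ?W = "(U \<inter> U') \<times> (UNIV :: 'v set)"
  note ch = bundle_chart_in[OF d(1) c]
  have o: "openin (mtop X) ?W" using smooth_atlas_chart(3)[OF smooth_atlas_total_space ch] .
  have "smooth_fun X ?W (\<lambda>z. snd (bundle_chart \<phi> \<Phi> z))"
    by (rule smooth_fun_bounded_linear[OF smooth_atlas_total_space o bounded_linear_snd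
          smooth_chart_properties(3)[OF smooth_atlas_total_space smooth_chart_in_atlas[OF smooth_atlas_total_space ch]]])
  then have "smooth_fun X ?W (\<lambda>z. \<Phi> (fst z) (snd z))" by (simp add: bundle_chart_def split_beta)
  then show "\<exists>W. openin (mtop X) W \<and> x \<in> W \<and> smooth_fun X W (\<lambda>z. \<Phi> (fst z) (snd z))"
    using o x d(2) by (intro exI[of _ ?W]) auto
qed

lemma vector_bundle_pullback:
  fixes F :: "('m, 'w::euclidean_space) vbundle"
  assumes F: "vector_bundle A F" shows "vector_bundle X (pullback_bundle F)"
  unfolding vector_bundle_def
proof (intro conjI)
  have "\<Union>(fst ` pullback_bundle F) = \<Union>(fst ` F) \<times> (UNIV :: 'v set)"
    by (force simp: pullback_bundle_def)
  then show "\<Union>(fst ` pullback_bundle F) = carrier_of X"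
    unfolding carrier_total_space using F unfolding vector_bundle_def by metis
  show "\<forall>(U, \<Phi>)\<in>pullback_bundle F. openin (mtop X) U \<and> (\<forall>p\<in>U. linear (\<Phi> p) \<and> bij (\<Phi> p))"
  proof (intro ballI)
    fix c :: "('m \<times> 'v) set \<times> _" assume "c \<in> pullback_bundle F"
    then obtain U \<Phi> where 1: "(U, \<Phi>) \<in> F" "c = (U \<times> UNIV, \<lambda>z. \<Phi> (fst z))"
      by (rule in_pullback_bundleE)
    show "case c of (U, \<Phi>) \<Rightarrow> openin (mtop X) U \<and> (\<forall>p\<in>U. linear (\<Phi> p) \<and> bij (\<Phi> p))"
      unfolding 1(2) using vector_bundle_triv(1-3)[OF F 1(1)] openin_total_space by auto
  qed
  show "\<forall>(U, \<Phi>)\<in>pullback_bundle F. \<forall>(U', \<Psi>)\<in>pullback_bundle F. \<forall>v.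
      smooth_fun X (U \<inter> U') (\<lambda>p. \<Psi> p (inv (\<Phi> p) v))"
  proof (rule ball_ball_caseI)
    fix c c' :: "('m \<times> 'v) set \<times> ('m \<times> 'v \<Rightarrow> 'w \<Rightarrow> 'w)" assume cc: "c \<in> pullback_bundle F" "c' \<in> pullback_bundle F"
    obtain U \<Phi> where 1: "(U, \<Phi>) \<in> F" "c = (U \<times> UNIV, \<lambda>z. \<Phi> (fst z))"
      using cc(1) by (rule in_pullback_bundleE)
    obtain U' \<Psi> where 2: "(U', \<Psi>) \<in> F" "c' = (U' \<times> UNIV, \<lambda>z. \<Psi> (fst z))"
      using cc(2) by (rule in_pullback_bundleE)
    have o: "openin (mtop A) (U \<inter> U')"
      using vector_bundle_triv(1)[OF F 1(1)] vector_bundle_triv(1)[OF F 2(1)] by blast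
    show "case c of (U, \<Phi>) \<Rightarrow> (case c' of (U', \<Psi>) \<Rightarrow> \<forall>v.
        smooth_fun X (U \<inter> U') (\<lambda>p. \<Psi> p (inv (\<Phi> p) v)))"
      unfolding 1(2) 2(2) using smooth_fun_pullback[OF o vector_bundle_triv(4)[OF F 1(1) 2(1)]]
      by (simp add: Times_Int_Times)
  qed
qed

lemma smooth_hom_pullback:
  fixes F :: "('m, 'w::euclidean_space) vbundle" and G :: "('m, 'u::euclidean_space) vbundle"
  assumes F: "vector_bundle A F" and G: "vector_bundle A G"
    and L: "smooth_hom A (carrier_of A) F G L"
  shows "smooth_hom X (carrier_of X) (pullback_bundle F) (pullback_bundle G) (\<lambda>z. L (fst z))"
proof (rule smooth_homI)
  show "linear (L (fst z))" if "z \<in> carrier_of X" for z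
    using that smooth_homD(1)[OF L] by (auto simp: carrier_total_space)
next
  fix U1 U2 :: "('m \<times> 'v) set" and \<Phi>' \<Psi>' v
  assume cc: "(U1, \<Phi>') \<in> pullback_bundle F" "(U2, \<Psi>') \<in> pullback_bundle G"
  obtain U \<Phi> where 1: "(U, \<Phi>) \<in> F" "(U1, \<Phi>') = (U \<times> UNIV, \<lambda>z. \<Phi> (fst z))"
    using cc(1) by (rule in_pullback_bundleE)
  obtain U' \<Psi> where 2: "(U', \<Psi>) \<in> G" "(U2, \<Psi>') = (U' \<times> UNIV, \<lambda>z. \<Psi> (fst z))"
    using cc(2) by (rule in_pullback_bundleE)
  have c: "(U, \<Phi>) \<in> F" "(U', \<Psi>) \<in> G" "U1 = U \<times> UNIV" "U2 = U' \<times> UNIV"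
    "\<Phi>' = (\<lambda>z. \<Phi> (fst z))" "\<Psi>' = (\<lambda>z. \<Psi> (fst z))"
    using 1 2 by simp_all
  note o = openin_triv2[OF A openin_mtop_carrier[OF A] F G c(1,2)]
  from smooth_fun_pullback[OF o smooth_homD(2)[OF L c(1,2)]]
  show "smooth_fun X (carrier_of X \<inter> U1 \<inter> U2) (\<lambda>p. \<Psi>' p (L (fst p) (inv (\<Phi>' p) v)))"
    unfolding c(3-6) carrier_total_space by (simp add: Times_Int_Times)
qed

text \<open>\<open>dproj\<close> is by definition the differential of the projection followed by the
  chart chosen at \<open>fst x\<close>. Near that point \<open>f\<close> is a function of this
  chart, so the chain rule through \<pi> applies.\<close>

lemma has_mdiff_dproj:
  assumes p: "fst x \<in> carrier_of A" and f: "has_mdiff A f (fst x) D"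
  shows "has_mdiff X (\<lambda>z. f (fst z)) x (\<lambda>w. D (dproj A E x w))"
proof -
  obtain U0 \<phi>0 where c: "chart_at A (fst x) = (U0, \<phi>0)" using surj_pair[of "chart_at A (fst x)"] by blast
  note c' = chart_at[OF p c]
  note U0 = smooth_atlas_chart(3)[OF A c'(1)]
  note o = openin_total_space[OF U0]
  have x: "x \<in> U0 \<times> UNIV" using c'(2) by (simp add: mem_Times_iff)
  have xc: "x \<in> carrier_of X" using p by (simp add: carrier_total_space mem_Times_iff)
  have "has_mdiff X (\<lambda>z. \<phi>0 (fst z)) x (mdiff X (\<lambda>z. \<phi>0 (fst z)) x)"
    by (rule smooth_fun_has_mdiff[OF smooth_atlas_total_space o x smooth_fun_pullback[OF U0
          smooth_chart_properties(3)[OF A smooth_chart_in_atlas[OF A c'(1)]]]])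
  moreover have "mdiff X (\<lambda>z. \<phi>0 (fst z)) x = dproj A E x"
    by (simp add: dproj_def tangent_map_def c o_def)
  ultimately have 1: "has_mdiff X (\<lambda>z. \<phi>0 (fst z)) x (dproj A E x)" by simp
  have 2: "((f \<circ> inv_into U0 \<phi>0) has_derivative D) (at (\<phi>0 (fst x)))"
    using f c by (simp add: has_mdiff_def)
  show ?thesis
    by (rule has_mdiff_cong[OF smooth_atlas_total_space o x _
          has_mdiff_compose[OF smooth_atlas_total_space xc 1 2]])
      (use smooth_atlas_chart(1)[OF A c'(1)] in auto)
qed

lemma mdiff_dproj:
  assumes U: "openin (mtop A) U" "fst x \<in> U" and f: "smooth_fun A U f"
  shows "mdiff X (\<lambda>z. f (fst z)) x w = mdiff A f (fst x) (dproj A E x w)"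
proof -
  have "fst x \<in> carrier_of A" using openin_mtop_subset[OF A U(1)] U(2) by blast
  from mdiff_eqI[OF has_mdiff_dproj[OF this smooth_fun_has_mdiff[OF A U f]]]
  show ?thesis by metis
qed

lemma linear_dproj:
  assumes p: "fst x \<in> carrier_of A" shows "linear (dproj A E x)"
proof -
  obtain U0 \<phi>0 where c: "chart_at A (fst x) = (U0, \<phi>0)" using surj_pair[of "chart_at A (fst x)"] by blast
  note c' = chart_at[OF p c]
  have "has_mdiff A \<phi>0 (fst x) (\<lambda>w. w)"
    using smooth_fun_has_mdiff[OF A smooth_atlas_chart(3)[OF A c'(1)] c'(2)
        smooth_chart_properties(3)[OF A smooth_chart_in_atlas[OF A c'(1)]]]
    by (simp add: mdiff_chart_at[OF A p c])
  from has_mdiff_linear[OF has_mdiff_dproj[OF p this]] show ?thesis .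
qed

end

section \<open>The splitting of the tangent bundle of the total space\<close>

lemma triv_at:
  assumes E: "vector_bundle A E" and p: "p \<in> carrier_of A" and c: "triv_at E p = (U, \<Phi>)"
  shows "(U, \<Phi>) \<in> E" "p \<in> U"
proof -
  obtain U' \<Psi> where "(U', \<Psi>) \<in> E" "p \<in> U'" using vector_bundle_cover[OF E p] .
  then have "\<exists>c. c \<in> E \<and> p \<in> fst c" by (intro exI[of _ "(U', \<Psi>)"]) simp
  from someI_ex[OF this] show "(U, \<Phi>) \<in> E" "p \<in> U" using c by (simp_all add: triv_at_def)
qed

text \<open>The vertical component stands first, as in V \<oplus> T_M, while tangent vectors of the
  total space, like its charts, have the base component first.\<close>

definition tangent_split ::
  "('m, 'b::euclidean_space) atlas \<Rightarrow> ('m, 'v::euclidean_space) vbundle \<Rightarrow> ('m, 'b, 'v) conn \<Rightarrow>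
   'm \<times> 'v \<Rightarrow> 'b \<times> 'v \<Rightarrow> 'v \<times> 'b" where
  "tangent_split A E N x w = (vproj A E N x w, dproj A E x w)"

text \<open>The connection form of the trivialisation applied to the tautological section: \<Phi> of
  the sum of y_b \<nabla>_t e_b, with y_b the fibre coordinates of \<open>x\<close>. It is the
  \<Gamma> by which \<open>tangent_split\<close> differs from the chart components.\<close>

definition connection_term ::
  "('m, 'b, 'v) conn \<Rightarrow> ('m \<Rightarrow> 'v::euclidean_space \<Rightarrow> 'v) \<Rightarrow> 'm \<times> 'v \<Rightarrow> 'b \<Rightarrow> 'v" where
  "connection_term N \<Phi> x t =
    (\<Sum>b\<in>Basis. (\<Phi> (fst x) (snd x) \<bullet> b) *\<^sub>R \<Phi> (fst x) (N (\<lambda>q. inv (\<Phi> q) b) (fst x) t))"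

context
  fixes A :: "('m, 'b::euclidean_space) atlas" and E :: "('m, 'v::euclidean_space) vbundle"
    and N :: "('m, 'b, 'v) conn"
  assumes A: "smooth_atlas A" and E: "vector_bundle A E" and N: "connection A E N"
begin

private lemmas XA = smooth_atlas_total_space[OF A E]

text \<open>The product rule for \<open>\<pi>\<^sup>*\<nabla>\<close> applied to the tautological section; in particular \<open>vproj\<close>
  does not depend on the trivialisation chosen in its definition.\<close>

lemma vproj_expand:
  fixes s :: "'i \<Rightarrow> 'm \<Rightarrow> 'v"
  assumes U: "openin (mtop A) U" and s: "\<And>i. i \<in> I \<Longrightarrow> smooth_section A U E (s i)"
    and W: "openin (mtop (total_space A E)) W" "x \<in> W" "W \<subseteq> U \<times> UNIV"
    and y: "\<And>i. i \<in> I \<Longrightarrow> has_mdiff (total_space A E) (y i) x (dy i)"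
    and eq: "\<And>z. z \<in> W \<Longrightarrow> snd z = (\<Sum>i\<in>I. y i z *\<^sub>R s i (fst z))"
  shows "vproj A E N x w =
    (\<Sum>i\<in>I. dy i w *\<^sub>R s i (fst x) + y i x *\<^sub>R N (s i) (fst x) (dproj A E x w))"
proof -
  define p where "p = fst x"
  have pU: "p \<in> U" using W(2,3) by (auto simp: p_def)
  have p: "p \<in> carrier_of A" using openin_mtop_subset[OF A U] pU by blast
  have xc: "x \<in> carrier_of (total_space A E)" using p by (simp add: carrier_total_space[OF A E] mem_Times_iff p_def)
  obtain U' \<Phi> where c: "triv_at E p = (U', \<Phi>)" using surj_pair[of "triv_at E p"] by blast
  note c' = triv_at[OF E p c]
  note U' = vector_bundle_triv(1)[OF E c'(1)]
  let ?W = "W \<inter> U' \<times> UNIV"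
  let ?t = "dproj A E x w"
  let ?e = "\<lambda>b q. inv (\<Phi> q) b"
  have oW: "openin (mtop (total_space A E)) ?W" using W(1) openin_total_space[OF A E U'] by blast
  have xW: "x \<in> ?W" using W(2) c'(2) by (simp add: mem_Times_iff p_def)
  let ?ds = "\<lambda>i. mdiff A (\<lambda>q. \<Phi> q (s i q)) p"
  have ds: "has_mdiff A (\<lambda>q. \<Phi> q (s i q)) (fst x) (?ds i)" if "i \<in> I" for i
  proof -
    have "openin (mtop A) (U \<inter> U')" using U U' by blast
    moreover have "p \<in> U \<inter> U'" using pU c'(2) by blast
    ultimately show ?thesis
      unfolding p_def by (rule smooth_fun_has_mdiff[OF A _ _ smooth_sectionD[OF s[OF that] c'(1)]])
  qed
  have "has_mdiff (total_space A E) (\<lambda>z. \<Sum>i\<in>I. y i z *\<^sub>R \<Phi> (fst z) (s i (fst z))) x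
      (\<lambda>w. \<Sum>i\<in>I. y i x *\<^sub>R ?ds i (dproj A E x w) + dy i w *\<^sub>R \<Phi> (fst x) (s i (fst x)))"
    by (rule has_mdiff_sum, rule has_mdiff_bilinear[OF XA xc bounded_bilinear_scaleR y
          has_mdiff_dproj[OF A E p[unfolded p_def] ds]])
  moreover have "(\<Sum>i\<in>I. y i z *\<^sub>R \<Phi> (fst z) (s i (fst z))) = \<Phi> (fst z) (snd z)" if "z \<in> ?W" for z
  proof -
    have z: "z \<in> W" "fst z \<in> U'" using that by auto
    note lin = vector_bundle_triv(2)[OF E c'(1) z(2)]
    show ?thesis unfolding eq[OF z(1)] by (simp add: linear_sum[OF lin] linear_scale[OF lin])
  qed
  ultimately have "has_mdiff (total_space A E) (\<lambda>z. \<Phi> (fst z) (snd z)) x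
      (\<lambda>w. \<Sum>i\<in>I. y i x *\<^sub>R ?ds i (dproj A E x w) + dy i w *\<^sub>R \<Phi> (fst x) (s i (fst x)))"
    by (rule has_mdiff_cong[OF XA oW xW, rotated])
  from mdiff_eqI[OF this]
  have d: "mdiff (total_space A E) (\<lambda>z. \<Phi> (fst z) (snd z)) x w
      = (\<Sum>i\<in>I. y i x *\<^sub>R ?ds i ?t + dy i w *\<^sub>R \<Phi> p (s i p))"
    unfolding p_def by metis
  note inv = vector_bundle_inv[OF E c']
  have 1: "inv (\<Phi> p) (mdiff (total_space A E) (\<lambda>z. \<Phi> (fst z) (snd z)) x w)
      = (\<Sum>i\<in>I. y i x *\<^sub>R inv (\<Phi> p) (?ds i ?t) + dy i w *\<^sub>R s i p)"
    unfolding d by (simp add: linear_sum[OF inv(3)] linear_add[OF inv(3)] linear_scale[OF inv(3)] inv(1))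
  have "\<Phi> p (snd x) = (\<Sum>i\<in>I. y i x *\<^sub>R \<Phi> p (s i p))"
    unfolding eq[OF W(2)] using vector_bundle_triv(2)[OF E c']
    by (simp add: linear_sum linear_scale p_def)
  then have 2: "(\<Sum>b\<in>Basis. (\<Phi> p (snd x) \<bullet> b) *\<^sub>R N (?e b) p ?t)
      = (\<Sum>i\<in>I. y i x *\<^sub>R (\<Sum>b\<in>Basis. (\<Phi> p (s i p) \<bullet> b) *\<^sub>R N (?e b) p ?t))"
    by (simp add: inner_sum_left scaleR_sum_left scaleR_sum_right) (rule sum.swap)
  have "vproj A E N x w = inv (\<Phi> p) (mdiff (total_space A E) (\<lambda>z. \<Phi> (fst z) (snd z)) x w)
      + (\<Sum>b\<in>Basis. (\<Phi> p (snd x) \<bullet> b) *\<^sub>R N (?e b) p ?t)"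
    by (simp add: vproj_def pullback_connection_def p_def[symmetric] c)
  \<comment> \<open>The coefficient of \<open>y i x\<close> is the trivialised formula for \<nabla>
    applied to \<open>s i\<close>, so the trivialisation chosen at \<open>p\<close>
    disappears.\<close>
  also have "\<dots> = (\<Sum>i\<in>I. dy i w *\<^sub>R s i p + y i x *\<^sub>R (inv (\<Phi> p) (?ds i ?t)
      + (\<Sum>b\<in>Basis. (\<Phi> p (s i p) \<bullet> b) *\<^sub>R N (?e b) p ?t)))"
    unfolding 1 2 by (simp add: sum.distrib scaleR_add_right)
  also have "\<dots> = (\<Sum>i\<in>I. dy i w *\<^sub>R s i p + y i x *\<^sub>R N (s i) p ?t)"
    by (rule sum.cong[OF refl]) (simp only: connection_triv[OF A E N U pU s c'])
  finally show ?thesis by (simp add: p_def)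
qed

text \<open>\<open>vproj_expand\<close> for the frame of an arbitrary trivialisation. One
  trivialisation can now be kept while the point varies, whereas \<open>triv_at\<close> may change
  from point to point.\<close>

lemma vproj_triv:
  assumes c: "(U', \<Phi>) \<in> E" and x: "fst x \<in> U'"
  shows "vproj A E N x w = inv (\<Phi> (fst x)) (mdiff (total_space A E) (\<lambda>z. \<Phi> (fst z) (snd z)) x w)
    + (\<Sum>b\<in>Basis. (\<Phi> (fst x) (snd x) \<bullet> b) *\<^sub>R N (\<lambda>q. inv (\<Phi> q) b) (fst x) (dproj A E x w))"
proof -
  note U' = vector_bundle_triv(1)[OF E c]
  have x': "x \<in> U' \<times> UNIV" using x by (simp add: mem_Times_iff)
  have d: "has_mdiff (total_space A E) (\<lambda>z. \<Phi> (fst z) (snd z) \<bullet> b) x (\<lambda>w. mdiff (total_space A E) (\<lambda>z. \<Phi> (fst z) (snd z)) x w \<bullet> b)" for b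
    by (rule has_mdiff_bounded_linear[OF bounded_linear_inner_left
          smooth_fun_has_mdiff[OF XA openin_total_space[OF A E U'] x' smooth_fun_triv_snd[OF A E c]]])
  have "vproj A E N x w = (\<Sum>b\<in>Basis. (mdiff (total_space A E) (\<lambda>z. \<Phi> (fst z) (snd z)) x w \<bullet> b) *\<^sub>R inv (\<Phi> (fst x)) b
      + (\<Phi> (fst x) (snd x) \<bullet> b) *\<^sub>R N (\<lambda>q. inv (\<Phi> q) b) (fst x) (dproj A E x w))"
  proof (rule vproj_expand[OF U' triv_section[OF E c] openin_total_space[OF A E U'] x' subset_refl d])
    show "snd z = (\<Sum>b\<in>Basis. (\<Phi> (fst z) (snd z) \<bullet> b) *\<^sub>R inv (\<Phi> (fst z)) b)" if "z \<in> U' \<times> UNIV" for z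
      using that triv_basis_expansion[OF A E c, of "fst z"] vector_bundle_inv(1)[OF E c, of "fst z"] by auto
  qed
  then show ?thesis unfolding sum.distrib triv_basis_expansion[OF A E c x] .
qed

lemma mdiff_bundle_chart:
  assumes a: "(U, \<phi>) \<in> A" and c: "(U', \<Phi>) \<in> E" and x: "fst x \<in> U" "fst x \<in> U'"
  shows "mdiff (total_space A E) (bundle_chart \<phi> \<Phi>) x w
    = (mdiff A \<phi> (fst x) (dproj A E x w), mdiff (total_space A E) (\<lambda>z. \<Phi> (fst z) (snd z)) x w)"
proof -
  let ?W = "(U \<inter> U') \<times> (UNIV :: 'v set)"
  have U: "openin (mtop A) U" using smooth_atlas_chart(3)[OF A a] .
  have o: "openin (mtop A) (U \<inter> U')" using U vector_bundle_triv(1)[OF E c] by blast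
  have xW: "x \<in> ?W" using x by (simp add: mem_Times_iff)
  have s: "smooth_fun A U \<phi>" using smooth_chart_properties(3)[OF A smooth_chart_in_atlas[OF A a]] .
  have 1: "smooth_fun (total_space A E) ?W (\<lambda>z. \<phi> (fst z))"
    by (rule smooth_fun_subset[OF smooth_fun_pullback[OF A E U s]]) blast
  have 2: "smooth_fun (total_space A E) ?W (\<lambda>z. \<Phi> (fst z) (snd z))"
    by (rule smooth_fun_subset[OF smooth_fun_triv_snd[OF A E c]]) blast
  have "bundle_chart \<phi> \<Phi> = (\<lambda>z. (\<phi> (fst z), \<Phi> (fst z) (snd z)))"
    by (simp add: bundle_chart_def split_beta')
  then show ?thesis
    using mdiff_Pair[OF XA openin_total_space[OF A E o] xW 1 2] mdiff_dproj[OF A E U x(1) s] by simp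
qed

lemma split_in_chart:
  assumes a: "(U, \<phi>) \<in> A" and c: "(U', \<Phi>) \<in> E" and x: "fst x \<in> U" "fst x \<in> U'"
  shows "mdiff A \<phi> (fst x) (dproj A E x w) = fst (mdiff (total_space A E) (bundle_chart \<phi> \<Phi>) x w)"
    "\<Phi> (fst x) (vproj A E N x w) = snd (mdiff (total_space A E) (bundle_chart \<phi> \<Phi>) x w) + connection_term N \<Phi> x (dproj A E x w)"
proof -
  note lin = vector_bundle_triv(2)[OF E c x(2)]
  show "mdiff A \<phi> (fst x) (dproj A E x w) = fst (mdiff (total_space A E) (bundle_chart \<phi> \<Phi>) x w)"
    "\<Phi> (fst x) (vproj A E N x w) = snd (mdiff (total_space A E) (bundle_chart \<phi> \<Phi>) x w) + connection_term N \<Phi> x (dproj A E x w)"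
    unfolding mdiff_bundle_chart[OF assms] vproj_triv[OF c x(2)] connection_term_def
    by (simp_all add: linear_add[OF lin] linear_sum[OF lin] linear_scale[OF lin] vector_bundle_inv(2)[OF E c x(2)])
qed

lemma linear_connection_term:
  assumes c: "(U', \<Phi>) \<in> E" and x: "fst x \<in> U'"
  shows "linear (connection_term N \<Phi> x)"
proof -
  note lin = vector_bundle_triv(2)[OF E c x]
  have "linear (N (\<lambda>q. inv (\<Phi> q) b) (fst x))" for b
    using smooth_homD(1)[OF connection_axioms(1)[OF A E N vector_bundle_triv(1)[OF E c] triv_section[OF E c]] x] .
  from linear_compose_scale_right[OF linear_compose[OF this lin]]
  have "linear (\<lambda>t. (\<Phi> (fst x) (snd x) \<bullet> b) *\<^sub>R \<Phi> (fst x) (N (\<lambda>q. inv (\<Phi> q) b) (fst x) t))" for b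
    by (simp add: o_def)
  then show ?thesis unfolding connection_term_def[abs_def] by (intro linear_compose_sum) auto
qed

lemma chart_around:
  assumes "x \<in> carrier_of (total_space A E)"
  obtains U \<phi> U' \<Phi> where "(U, \<phi>) \<in> A" "(U', \<Phi>) \<in> E" "fst x \<in> U" "fst x \<in> U'"
proof -
  have p: "fst x \<in> carrier_of A" using assms by (auto simp: carrier_total_space[OF A E])
  obtain U \<phi> where "(U, \<phi>) \<in> A" "fst x \<in> U" using p by (auto simp: carrier_of_def)
  moreover obtain U' \<Phi> where "(U', \<Phi>) \<in> E" "fst x \<in> U'" using vector_bundle_cover[OF E p] .
  ultimately show ?thesis using that by blast
qed

lemma mdiff_bundle_chart_bij:
  assumes a: "(U, \<phi>) \<in> A" and c: "(U', \<Phi>) \<in> E" and x: "fst x \<in> U" "fst x \<in> U'"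
  shows "linear (mdiff (total_space A E) (bundle_chart \<phi> \<Phi>) x)" "bij (mdiff (total_space A E) (bundle_chart \<phi> \<Phi>) x)"
proof -
  have "x \<in> (U \<inter> U') \<times> UNIV" using x by (simp add: mem_Times_iff)
  then show "linear (mdiff (total_space A E) (bundle_chart \<phi> \<Phi>) x)" "bij (mdiff (total_space A E) (bundle_chart \<phi> \<Phi>) x)"
    using mdiff_chart_bij[OF XA smooth_chart_in_atlas[OF XA bundle_chart_in[OF A E a c]]] by auto
qed

lemma tangent_split_bij:
  assumes xc: "x \<in> carrier_of (total_space A E)"
  shows "linear (tangent_split A E N x)" "bij (tangent_split A E N x)"
proof -
  obtain U \<phi> U' \<Phi> where a: "(U, \<phi>) \<in> A" and c: "(U', \<Phi>) \<in> E" and x: "fst x \<in> U" "fst x \<in> U'"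
    using chart_around[OF xc] .
  let ?c = "mdiff (total_space A E) (bundle_chart \<phi> \<Phi>) x"
  note ch = split_in_chart[OF a c x]
  note lc = mdiff_bundle_chart_bij[OF a c x]
  have pc: "fst x \<in> carrier_of A" using xc by (auto simp: carrier_total_space[OF A E])
  have ld: "linear (dproj A E x)" using linear_dproj[OF A E pc] .
  have v: "vproj A E N x w = inv (\<Phi> (fst x)) (snd (?c w) + connection_term N \<Phi> x (dproj A E x w))" for w
    unfolding ch(2)[symmetric] vector_bundle_inv(1)[OF E c x(2)] ..
  have "linear (vproj A E N x)"
    unfolding v[abs_def]
    using linear_compose[OF linear_compose_add[OF linear_compose[OF lc(1) linear_snd]
          linear_compose[OF ld linear_connection_term[OF c x(2)]]] vector_bundle_inv(3)[OF E c x(2)]]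
    by (simp add: o_def)
  then show lin: "linear (tangent_split A E N x)"
    using ld unfolding tangent_split_def[abs_def] by (simp add: linear_iff)
  have "w = 0" if "tangent_split A E N x w = 0" for w
  proof -
    have 0: "vproj A E N x w = 0" "dproj A E x w = 0"
      using that by (simp_all add: tangent_split_def zero_prod_def)
    have "fst (?c w) = 0"
      using ch(1)[of w] 0 mdiff_chart_bij(1)[OF A smooth_chart_in_atlas[OF A a] x(1)] by (simp add: linear_0)
    moreover have "snd (?c w) = 0"
      using ch(2)[of w] 0 vector_bundle_triv(2)[OF E c x(2)] linear_connection_term[OF c x(2)] by (simp add: linear_0)
    ultimately have "?c w = ?c 0" using lc(1) by (simp add: linear_0 prod_eq_iff)
    then show "w = 0" using lc(2) by (simp add: bij_is_inj inj_eq)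
  qed
  then have "inj (tangent_split A E N x)" using lin by (simp add: linear_injective_0)
  \<comment> \<open>Source and target are different types, so a preimage is written down: prescribe
    the base component and subtract the connection term from the fibre component.\<close>
  moreover have "surj (tangent_split A E N x)"
  proof (rule surjI)
    fix z :: "'v \<times> 'b"
    let ?t = "snd z"
    let ?w = "inv ?c (mdiff A \<phi> (fst x) ?t, \<Phi> (fst x) (fst z) - connection_term N \<Phi> x ?t)"
    have cw: "?c ?w = (mdiff A \<phi> (fst x) ?t, \<Phi> (fst x) (fst z) - connection_term N \<Phi> x ?t)"
      using lc(2) by (simp add: bij_is_surj surj_f_inv_f)
    have d: "dproj A E x ?w = ?t"
      using ch(1)[of ?w] cw mdiff_chart_bij(2)[OF A smooth_chart_in_atlas[OF A a] x(1)]
      by (simp add: bij_is_inj inj_eq)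
    have "\<Phi> (fst x) (vproj A E N x ?w) = \<Phi> (fst x) (fst z)" unfolding ch(2) cw d by simp
    then have "vproj A E N x ?w = fst z"
      using vector_bundle_triv(3)[OF E c x(2)] by (simp add: bij_is_inj inj_eq)
    with d show "tangent_split A E N x ?w = z" by (simp add: tangent_split_def)
  qed
  ultimately show "bij (tangent_split A E N x)" by (simp add: bij_def)
qed

text \<open>The chart chosen at \<open>x\<close> is itself a bundle chart, in which a vertical line
  is affine with velocity (0, \<Phi> u). The connection term is linear in the base component and
  vanishes there.\<close>

lemma tangent_split_vert:
  assumes xc: "x \<in> carrier_of (total_space A E)" shows "tangent_split A E N x (vert A E x u) = (u, 0)"
proof -
  obtain D f where ca: "chart_at (total_space A E) x = (D, f)" using surj_pair[of "chart_at (total_space A E) x"] by blast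
  note ca' = chart_at[OF xc ca]
  obtain U \<phi> U' \<Phi> where a: "(U, \<phi>) \<in> A" and c: "(U', \<Phi>) \<in> E"
    and Df: "(D, f) = ((U \<inter> U') \<times> UNIV, bundle_chart \<phi> \<Phi>)"
    using ca'(1) by (rule in_total_spaceE[OF A E])
  have x: "fst x \<in> U" "fst x \<in> U'" using ca'(2) Df by auto
  have f: "f = bundle_chart \<phi> \<Phi>" using Df by simp
  note lin = vector_bundle_triv(2)[OF E c x(2)]
  have "((\<lambda>t. (\<phi> (fst x), \<Phi> (fst x) (snd x) + t *\<^sub>R \<Phi> (fst x) u)) has_vector_derivative (0, \<Phi> (fst x) u)) (at 0)"
    by (auto intro!: derivative_eq_intros has_vector_derivative_Pair)
  then have v: "vert A E x u = (0, \<Phi> (fst x) u)"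
    unfolding vert_def ca f
    by (intro vector_derivative_at) (simp add: bundle_chart_def linear_add[OF lin] linear_scale[OF lin])
  have id: "mdiff (total_space A E) (bundle_chart \<phi> \<Phi>) x w = w" for w
    using mdiff_chart_at[OF XA xc ca] f by simp
  note ch = split_in_chart[OF a c x, of "vert A E x u", unfolded id v]
  have "mdiff A \<phi> (fst x) (dproj A E x (0, \<Phi> (fst x) u)) = mdiff A \<phi> (fst x) 0"
    using ch(1) mdiff_chart_bij(1)[OF A smooth_chart_in_atlas[OF A a] x(1)] by (simp add: linear_0)
  then have d: "dproj A E x (0, \<Phi> (fst x) u) = 0"
    using mdiff_chart_bij(2)[OF A smooth_chart_in_atlas[OF A a] x(1)] by (simp add: bij_is_inj inj_eq)
  have "\<Phi> (fst x) (vproj A E N x (0, \<Phi> (fst x) u)) = \<Phi> (fst x) u"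
    using ch(2) linear_connection_term[OF c x(2)] by (simp add: d linear_0)
  then have "vproj A E N x (0, \<Phi> (fst x) u) = u"
    using vector_bundle_triv(3)[OF E c x(2)] by (simp add: bij_is_inj inj_eq)
  with d show ?thesis by (simp add: v tangent_split_def)
qed

text \<open>\<open>vert\<close> and \<open>hlift\<close> are the two columns of the inverse of
  \<open>tangent_split\<close>. The pair of their transposes is therefore the transpose of that
  inverse, which is the cotangent half of \<open>splitting\<close>.\<close>

lemma vert_eq:
  assumes xc: "x \<in> carrier_of (total_space A E)" shows "vert A E x u = inv (tangent_split A E N x) (u, 0)"
  using tangent_split_vert[OF xc, of u] tangent_split_bij(2)[OF xc] by (metis bij_is_inj inv_f_f)

lemma hlift_eq:
  assumes xc: "x \<in> carrier_of (total_space A E)" shows "hlift A E N x = (\<lambda>t. inv (tangent_split A E N x) (0, t))"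
  unfolding hlift_def
proof (rule the_equality)
  note P = tangent_split_bij[OF xc]
  let ?Q = "inv (tangent_split A E N x)"
  have PQ: "tangent_split A E N x (?Q z) = z" for z using P(2) by (simp add: bij_is_surj surj_f_inv_f)
  have "linear (\<lambda>t. ?Q (0, t))"
    using linear_inv_bij[OF P] by (auto simp: linear_iff) (metis add.right_neutral add_Pair scale_zero_right scaleR_Pair)+
  moreover have "dproj A E x (?Q (0, t)) = t" "vproj A E N x (?Q (0, t)) = 0" for t
    using PQ[of "(0, t)"] by (simp_all add: tangent_split_def)
  ultimately show "linear (\<lambda>t. ?Q (0, t)) \<and> (\<forall>t. dproj A E x (?Q (0, t)) = t) \<and> (\<forall>t. vproj A E N x (?Q (0, t)) = 0)"
    by blast
  fix \<alpha> assume "linear \<alpha> \<and> (\<forall>t. dproj A E x (\<alpha> t) = t) \<and> (\<forall>t. vproj A E N x (\<alpha> t) = 0)"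
  then have "tangent_split A E N x (\<alpha> t) = (0, t)" for t by (simp add: tangent_split_def)
  then have "\<alpha> t = ?Q (0, t)" for t using P(2) by (metis bij_is_inj inv_f_f)
  then show "\<alpha> = (\<lambda>t. ?Q (0, t))" by blast
qed

lemma splitting_eq:
  assumes xc: "x \<in> carrier_of (total_space A E)"
  shows "splitting A E N x = map_prod (tangent_split A E N x) (adjoint (inv (tangent_split A E N x)))"
proof
  note P = tangent_split_bij[OF xc]
  let ?Q = "inv (tangent_split A E N x)"
  note Q = linear_inv_bij[OF P]
  have v: "linear (vert A E x)" and h: "linear (hlift A E N x)"
    unfolding vert_eq[OF xc, abs_def] hlift_eq[OF xc]
    using linear_compose[OF _ Q, of "\<lambda>u. (u, 0)"] linear_compose[OF _ Q, of "\<lambda>u. (0, u)"]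
    by (simp_all add: o_def linear_iff)
  fix z :: "('b \<times> 'v) \<times> ('b \<times> 'v)"
  have "(adjoint (vert A E x) \<xi>, adjoint (hlift A E N x) \<xi>) = adjoint ?Q \<xi>" for \<xi>
  proof (rule vector_eq_rdot[THEN iffD1], rule allI)
    fix z :: "'v \<times> 'b"
    have "?Q (u, t) = vert A E x u + hlift A E N x t" for u t
      using linear_add[OF Q, of "(u, 0)" "(0, t)"] by (simp add: vert_eq[OF xc] hlift_eq[OF xc])
    then have "adjoint ?Q \<xi> \<bullet> (u, t) = \<xi> \<bullet> vert A E x u + \<xi> \<bullet> hlift A E N x t" for u t
      by (simp add: adjoint_inner[OF Q] inner_add_right)
    then show "(adjoint (vert A E x) \<xi>, adjoint (hlift A E N x) \<xi>) \<bullet> z = adjoint ?Q \<xi> \<bullet> z"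
      by (cases z) (simp add: inner_Pair adjoint_inner[OF v] adjoint_inner[OF h])
  qed
  then show "splitting A E N x z = map_prod (tangent_split A E N x) (adjoint ?Q) z"
    by (cases z) (simp add: splitting_def tangent_split_def)
qed

end

section \<open>Lifting structures from the base\<close>

text \<open>The pointwise part of the definition, detached from smoothness. It is transported by
  linear isometries between fibres over points that may lie in different manifolds.\<close>

definition kaehler_at where
  "kaehler_at J J' p \<longleftrightarrow> (\<forall>x. J p (J' p x) = J' p (J p x)) \<and>
     (\<forall>x y. gen_pairing (gen_metric J J' p x) y = gen_pairing (gen_metric J J' p y) x) \<and>
     (\<forall>x. x \<noteq> 0 \<longrightarrow> gen_pairing (gen_metric J J' p x) x > 0)"

definition complex_at where
  "complex_at J p \<longleftrightarrow> bij (J p) \<and> (\<forall>x y. gen_pairing (J p x) (J p y) = gen_pairing x y) \<and>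
     (\<forall>x. J p (J p x) = - x)"

lemma gen_almost_complex_iff:
  "gen_almost_complex A W J \<longleftrightarrow>
     smooth_hom A (carrier_of A) (sum_bundle W (dual_bundle W)) (sum_bundle W (dual_bundle W)) J \<and>
     (\<forall>p\<in>carrier_of A. complex_at J p)"
  unfolding gen_almost_complex_def complex_at_def ..

lemma gen_almost_kaehler_iff:
  "gen_almost_kaehler A J J' \<longleftrightarrow>
     gen_almost_complex A (tangent_bundle A) J \<and> gen_almost_complex A (tangent_bundle A) J' \<and>
     (\<forall>p\<in>carrier_of A. kaehler_at J J' p)"
  unfolding gen_almost_kaehler_def kaehler_at_def ..

context
  fixes S :: "'w::euclidean_space \<times> 'w \<Rightarrow> 'u::euclidean_space \<times> 'u"
  assumes S: "linear S" "bij S" and iso: "\<And>a b. gen_pairing (S a) (S b) = gen_pairing a b"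
begin

private lemma inv_S: "inv S (S a) = a" "S (inv S c) = c" "linear (inv S)"
  using S by (auto simp: bij_is_inj bij_is_surj surj_f_inv_f linear_inv_bij)

text \<open>The isometry \<open>S\<close> will be \<open>splitting\<close> at a point of a total
  space, or \<open>swap_fibre\<close> at a point of the base.\<close>

lemma gen_metric_conj:
  assumes "J p = inv S \<circ> K q \<circ> S" "J' p = inv S \<circ> K' q \<circ> S"
  shows "gen_metric J J' p a = inv S (gen_metric K K' q (S a))"
  unfolding gen_metric_def assms by (simp add: inv_S linear_neg[OF inv_S(3)])

lemma complex_at_conj:
  assumes J: "J p = inv S \<circ> K q \<circ> S" and K: "complex_at K q"
  shows "complex_at J p"
  unfolding complex_at_def
proof (intro conjI allI)
  show "bij (J p)"
    unfolding J using S(2) K by (intro bij_comp bij_imp_bij_inv) (auto simp: complex_at_def)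
  show "gen_pairing (J p x) (J p y) = gen_pairing x y" for x y
  proof -
    have SJ: "S (J p z) = K q (S z)" for z by (simp add: J inv_S)
    have KK: "gen_pairing (K q c) (K q d) = gen_pairing c d" for c d
      using K unfolding complex_at_def by blast
    show ?thesis unfolding iso[of "J p x" "J p y", symmetric] SJ KK iso ..
  qed
  show "J p (J p x) = - x" for x
  proof -
    have "K q (K q c) = - c" for c using K unfolding complex_at_def by blast
    then show ?thesis by (simp only: J o_apply inv_S linear_neg[OF inv_S(3)])
  qed
qed

text \<open>Both directions are used: one brings the property from the total space down to the base,
  the other from the base up to the mirror. As \<open>S\<close> is onto, quantifying over all
  \<open>S a\<close> is quantifying over all vectors.\<close>

lemma kaehler_at_conj:
  assumes J: "J p = inv S \<circ> K q \<circ> S" "J' p = inv S \<circ> K' q \<circ> S"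
  shows "kaehler_at J J' p \<longleftrightarrow> kaehler_at K K' q"
proof -
  have m: "gen_pairing (gen_metric J J' p a) b = gen_pairing (gen_metric K K' q (S a)) (S b)" for a b
    using iso[of "gen_metric J J' p a" b] by (simp add: gen_metric_conj[of J p K q J' K', OF J] inv_S)
  have all: "(\<forall>a. P (S a)) \<longleftrightarrow> (\<forall>c. P c)" for P :: "'u \<times> 'u \<Rightarrow> bool"
    by (metis inv_S(2))
  have "(\<forall>x. J p (J' p x) = J' p (J p x)) \<longleftrightarrow> (\<forall>x. K q (K' q (S x)) = K' q (K q (S x)))"
    unfolding J by (simp add: inv_S) (metis inv_S(2))
  also have "\<dots> \<longleftrightarrow> (\<forall>x. K q (K' q x) = K' q (K q x))" by (rule all)
  finally have 1: "(\<forall>x. J p (J' p x) = J' p (J p x)) \<longleftrightarrow> (\<forall>x. K q (K' q x) = K' q (K q x))" .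
  have 2: "(\<forall>x y. gen_pairing (gen_metric J J' p x) y = gen_pairing (gen_metric J J' p y) x) \<longleftrightarrow>
    (\<forall>x y. gen_pairing (gen_metric K K' q x) y = gen_pairing (gen_metric K K' q y) x)"
    unfolding m by (metis inv_S(2))
  have z: "S x = 0 \<longleftrightarrow> x = 0" for x by (metis S(1) inv_S(1) linear_0)
  have 3: "(\<forall>x. x \<noteq> 0 \<longrightarrow> gen_pairing (gen_metric J J' p x) x > 0) \<longleftrightarrow>
    (\<forall>x. x \<noteq> 0 \<longrightarrow> gen_pairing (gen_metric K K' q x) x > 0)"
    unfolding m z[symmetric] by (rule all)
  show ?thesis unfolding kaehler_at_def 1 2 3 ..
qed

end

lemma smooth_hom_map_prod:
  fixes E :: "('m, 'v::euclidean_space) vbundle" and F :: "('m, 'w::euclidean_space) vbundle"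
    and E' :: "('m, 'v2::euclidean_space) vbundle" and F' :: "('m, 'w2::euclidean_space) vbundle"
  assumes A: "smooth_atlas A" and U: "openin (mtop A) U"
    and E: "vector_bundle A E" "vector_bundle A F" "vector_bundle A E'" "vector_bundle A F'"
    and L: "smooth_hom A U E F L" "smooth_hom A U E' F' L'"
  shows "smooth_hom A U (sum_bundle E E') (sum_bundle F F') (\<lambda>p. map_prod (L p) (L' p))"
proof -
  note EE = vector_bundle_sum[OF A U E(1,3)]
  note f = smooth_hom_fst_snd[OF A U E(1,3)]
  show ?thesis
    by (rule smooth_hom_cong[OF A U EE vector_bundle_sum[OF A U E(2,4)] smooth_hom_Pair[OF A U EE E(2,4)
            smooth_hom_compose[OF A U EE E(1,2) f(1) L(1)] smooth_hom_compose[OF A U EE E(3,4) f(2) L(2)]]])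
      (simp add: map_prod_def split_beta)
qed

section \<open>Smoothness of the splitting and of lifted structures\<close>

context
  fixes A :: "('m, 'b::euclidean_space) atlas" and E :: "('m, 'v::euclidean_space) vbundle"
    and N :: "('m, 'b, 'v) conn"
  assumes A: "smooth_atlas A" and E: "vector_bundle A E" and N: "connection A E N"
begin

private abbreviation P where "P \<equiv> tangent_split A E N"
private abbreviation W where "W \<equiv> sum_bundle E (tangent_bundle A)"
private lemmas XA' = smooth_atlas_total_space[OF A E]
private lemmas TX = vector_bundle_tangent[OF XA']
private lemmas Xo = openin_mtop_carrier[OF XA']
private lemmas WW = vector_bundle_sum[OF A openin_mtop_carrier[OF A] E vector_bundle_tangent[OF A]]
private lemmas PW = vector_bundle_pullback[OF A E WW]

text \<open>On the vector field with constant chart components \<open>y\<close>, the covariant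
  derivatives of the frame are smooth functions pulled back from the base; they are multiplied by
  the fibre coordinates, which are smooth too.\<close>

lemma connection_term_smooth:
  assumes a: "(U, \<phi>) \<in> A" and c: "(U', \<Phi>) \<in> E"
  shows "smooth_fun (total_space A E) ((U' \<inter> U) \<times> UNIV) (\<lambda>x. connection_term N \<Phi> x (inv (mdiff A \<phi> (fst x)) y))"
  unfolding connection_term_def
proof (rule smooth_fun_sum[OF XA'])
  note U' = vector_bundle_triv(1)[OF E c]
  have o: "openin (mtop A) (U' \<inter> U)" using U' smooth_atlas_chart(3)[OF A a] by blast
  show oX: "openin (mtop (total_space A E)) ((U' \<inter> U) \<times> UNIV)" using openin_total_space[OF A E o] .
  fix b :: 'v
  have 1: "smooth_fun (total_space A E) ((U' \<inter> U) \<times> UNIV) (\<lambda>x. \<Phi> (fst x) (snd x) \<bullet> b)"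
    by (rule smooth_fun_bounded_linear[OF XA' oX bounded_linear_inner_left
          smooth_fun_subset[OF smooth_fun_triv_snd[OF A E c]]]) blast
  have ta: "(U, mdiff A \<phi>) \<in> tangent_bundle A" using a by (force simp: tangent_bundle_def)
  have "smooth_fun A (U' \<inter> U) (\<lambda>p. \<Phi> p (N (\<lambda>q. inv (\<Phi> q) b) p (inv (mdiff A \<phi> p) y)))"
    by (rule smooth_fun_subset[OF smooth_homD(2)[OF connection_axioms(1)[OF A E N U' triv_section[OF E c]] ta c]]) blast
  from smooth_fun_bilinear[OF XA' oX bounded_bilinear_scaleR 1 smooth_fun_pullback[OF A E o this]]
  show "smooth_fun (total_space A E) ((U' \<inter> U) \<times> UNIV) (\<lambda>x. (\<Phi> (fst x) (snd x) \<bullet> b) *\<^sub>R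
      \<Phi> (fst x) (N (\<lambda>q. inv (\<Phi> q) b) (fst x) (inv (mdiff A \<phi> (fst x)) y)))" .
qed

lemma in_pullback_sumE:
  assumes "c \<in> pullback_bundle W"
  obtains U \<phi> U' \<Phi> where "(U, \<phi>) \<in> A" "(U', \<Phi>) \<in> E"
    "c = ((U' \<inter> U) \<times> UNIV, \<lambda>x. map_prod (\<Phi> (fst x)) (mdiff A \<phi> (fst x)))"
proof -
  obtain U2 \<Theta> where 1: "(U2, \<Theta>) \<in> W" "c = (U2 \<times> UNIV, \<lambda>z. \<Theta> (fst z))"
    using assms by (rule in_pullback_bundleE)
  obtain U' \<Phi> U \<Psi> where 2: "(U', \<Phi>) \<in> E" "(U, \<Psi>) \<in> tangent_bundle A" "U2 = U' \<inter> U"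
    "\<Theta> = (\<lambda>p. map_prod (\<Phi> p) (\<Psi> p))" using 1(1) by (auto simp: sum_bundle_def)
  obtain \<phi> where "(U, \<phi>) \<in> A" "\<Psi> = mdiff A \<phi>" using 2(2) by (auto simp: tangent_bundle_def)
  then show ?thesis using that 1(2) 2 by simp
qed

lemma smooth_hom_tangent_split:
  "smooth_hom (total_space A E) (carrier_of (total_space A E)) (tangent_bundle (total_space A E)) (pullback_bundle W) P"
proof (rule smooth_homI)
  show "linear (P x)" if "x \<in> carrier_of (total_space A E)" for x using tangent_split_bij(1)[OF A E N that] .
next
  fix D U2 :: "('m \<times> 'v) set" and \<Theta> \<Psi> v
  assume 1: "(D, \<Theta>) \<in> tangent_bundle (total_space A E)" "(U2, \<Psi>) \<in> pullback_bundle W"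
  obtain f where f: "(D, f) \<in> (total_space A E)" "\<Theta> = mdiff (total_space A E) f" using 1(1) by (auto simp: tangent_bundle_def)
  obtain U \<phi> U' \<Phi> where a: "(U, \<phi>) \<in> A" and c: "(U', \<Phi>) \<in> E"
    and eq: "(U2, \<Psi>) = ((U' \<inter> U) \<times> UNIV, \<lambda>x. map_prod (\<Phi> (fst x)) (mdiff A \<phi> (fst x)))"
    using 1(2) by (rule in_pullback_sumE)
  have U2: "U2 = (U' \<inter> U) \<times> UNIV" and \<Psi>: "\<Psi> = (\<lambda>x. map_prod (\<Phi> (fst x)) (mdiff A \<phi> (fst x)))"
    using eq by auto
  let ?w = "\<lambda>x. inv (mdiff (total_space A E) f x) v"
  let ?O = "carrier_of (total_space A E) \<inter> D \<inter> U2"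
  note U = smooth_atlas_chart(3)[OF A a]
  note U' = vector_bundle_triv(1)[OF E c]
  have oU: "openin (mtop (total_space A E)) (U \<times> UNIV)" "openin (mtop (total_space A E)) (U' \<times> UNIV)"
    using openin_total_space[OF A E] U U' by auto
  have "openin (mtop (total_space A E)) U2" using openin_total_space[OF A E, of "U' \<inter> U"] U U' unfolding U2 by blast
  then have o: "openin (mtop (total_space A E)) ?O" using Xo smooth_atlas_chart(3)[OF XA' f(1)] by blast
  have s: "smooth_fun A U \<phi>" using smooth_chart_properties(3)[OF A smooth_chart_in_atlas[OF A a]] .
  have x: "fst x \<in> U" "fst x \<in> U'" if "x \<in> ?O" for x using that U2 by auto
  have "smooth_fun (total_space A E) ?O (\<lambda>x. mdiff (total_space A E) (\<lambda>z. \<phi> (fst z)) x (?w x))"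
    by (rule smooth_fun_subset[OF mdiff_smooth[OF XA' oU(1) smooth_fun_pullback[OF A E U s] f(1)]])
      (auto simp: U2)
  then have d1: "smooth_fun (total_space A E) ?O (\<lambda>x. mdiff A \<phi> (fst x) (dproj A E x (?w x)))"
    by (rule smooth_fun_cong[OF XA' o, rotated]) (simp add: mdiff_dproj[OF A E U x(1) s])
  have d2: "smooth_fun (total_space A E) ?O (\<lambda>x. mdiff (total_space A E) (\<lambda>z. \<Phi> (fst z) (snd z)) x (?w x))"
    by (rule smooth_fun_subset[OF mdiff_smooth[OF XA' oU(2) smooth_fun_triv_snd[OF A E c] f(1)]])
      (auto simp: U2)
  \<comment> \<open>The vector \<open>dproj\<close> is passed through its chart components
    \<open>d1\<close>, which separates the point dependence of the connection term from the moving
    vector.\<close>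
  have d3: "smooth_fun (total_space A E) ?O (\<lambda>x. connection_term N \<Phi> x
      (inv (mdiff A \<phi> (fst x)) (mdiff A \<phi> (fst x) (dproj A E x (?w x)))))"
  proof (rule smooth_fun_apply[OF XA' o _ _ d1,
        where L = "\<lambda>x y. connection_term N \<Phi> x (inv (mdiff A \<phi> (fst x)) y)"])
    show "linear (\<lambda>y. connection_term N \<Phi> x (inv (mdiff A \<phi> (fst x)) y))" if "x \<in> ?O" for x
      using linear_compose[OF linear_inv_bij[OF mdiff_chart_bij[OF A smooth_chart_in_atlas[OF A a] x(1)[OF that]]]
          linear_connection_term[OF A E N c x(2)[OF that]]] by (simp add: o_def)
    show "smooth_fun (total_space A E) ?O (\<lambda>x. connection_term N \<Phi> x (inv (mdiff A \<phi> (fst x)) y))" for y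
      by (rule smooth_fun_subset[OF connection_term_smooth[OF a c]]) (auto simp: U2)
  qed
  show "smooth_fun (total_space A E) ?O (\<lambda>x. \<Psi> x (P x (inv (\<Theta> x) v)))"
  proof (rule smooth_fun_cong[OF XA' o _ smooth_fun_Pair[OF XA' o smooth_fun_add[OF XA' o d2 d3] d1]])
    fix x assume xO: "x \<in> ?O"
    show "(mdiff (total_space A E) (\<lambda>z. \<Phi> (fst z) (snd z)) x (?w x) + connection_term N \<Phi> x
        (inv (mdiff A \<phi> (fst x)) (mdiff A \<phi> (fst x) (dproj A E x (?w x)))),
        mdiff A \<phi> (fst x) (dproj A E x (?w x))) = \<Psi> x (P x (inv (\<Theta> x) v))"
      using split_in_chart(2)[OF A E N a c x[OF xO], of "?w x"] mdiff_bundle_chart[OF A E N a c x[OF xO], of "?w x"]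
        mdiff_chart_bij(2)[OF A smooth_chart_in_atlas[OF A a] x(1)[OF xO]]
      unfolding \<Psi> f(2) tangent_split_def by (simp add: bij_is_inj)
  qed
qed

text \<open>The triangular system of \<open>split_in_chart\<close> is solved explicitly: the base
  component is \<open>snd v\<close>, the fibre component is \<open>fst v\<close> minus the
  connection term. So no matrix has to be inverted smoothly.\<close>

lemma smooth_hom_inv_tangent_split:
  "smooth_hom (total_space A E) (carrier_of (total_space A E)) (pullback_bundle W) (tangent_bundle (total_space A E)) (\<lambda>x. inv (P x))"
proof (rule smooth_homI)
  show "linear (inv (P x))" if "x \<in> carrier_of (total_space A E)" for x
    using linear_inv_bij[OF tangent_split_bij[OF A E N that]] .
next
  fix D U2 :: "('m \<times> 'v) set" and \<Theta> \<Psi> and v :: "'v \<times> 'b"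
  assume 1: "(U2, \<Psi>) \<in> pullback_bundle W" "(D, \<Theta>) \<in> tangent_bundle (total_space A E)"
  obtain f where f: "(D, f) \<in> (total_space A E)" "\<Theta> = mdiff (total_space A E) f" using 1(2) by (auto simp: tangent_bundle_def)
  obtain U \<phi> U' \<Phi> where a: "(U, \<phi>) \<in> A" and c: "(U', \<Phi>) \<in> E"
    and eq: "(U2, \<Psi>) = ((U' \<inter> U) \<times> UNIV, \<lambda>x. map_prod (\<Phi> (fst x)) (mdiff A \<phi> (fst x)))"
    using 1(1) by (rule in_pullback_sumE)
  have U2: "U2 = (U' \<inter> U) \<times> UNIV" and \<Psi>: "\<Psi> = (\<lambda>x. map_prod (\<Phi> (fst x)) (mdiff A \<phi> (fst x)))"
    using eq by auto
  let ?O = "carrier_of (total_space A E) \<inter> U2 \<inter> D"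
  let ?c = "\<lambda>x. mdiff (total_space A E) (bundle_chart \<phi> \<Phi>) x"
  let ?z = "\<lambda>x. (inv (\<Phi> (fst x)) (fst v), inv (mdiff A \<phi> (fst x)) (snd v))"
  note U = smooth_atlas_chart(3)[OF A a]
  note U' = vector_bundle_triv(1)[OF E c]
  have "openin (mtop (total_space A E)) U2" using openin_total_space[OF A E, of "U' \<inter> U"] U U' unfolding U2 by blast
  then have o: "openin (mtop (total_space A E)) ?O" using Xo smooth_atlas_chart(3)[OF XA' f(1)] by blast
  have x: "fst x \<in> U" "fst x \<in> U'" if "x \<in> ?O" for x using that U2 by auto
  have 2: "smooth_fun (total_space A E) ?O (\<lambda>x. - connection_term N \<Phi> x (inv (mdiff A \<phi> (fst x)) (snd v)))"
    by (rule smooth_fun_bounded_linear[OF XA' o bounded_linear_minus[OF bounded_linear_ident]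
          smooth_fun_subset[OF connection_term_smooth[OF a c]]]) (auto simp: U2)
  have y: "smooth_fun (total_space A E) ?O (\<lambda>x. (snd v, fst v + - connection_term N \<Phi> x (inv (mdiff A \<phi> (fst x)) (snd v))))"
    by (rule smooth_fun_Pair[OF XA' o smooth_fun_const[OF XA' o] smooth_fun_add[OF XA' o smooth_fun_const[OF XA' o] 2]])
  have cX: "((U \<inter> U') \<times> UNIV, ?c) \<in> tangent_bundle (total_space A E)" "(D, mdiff (total_space A E) f) \<in> tangent_bundle (total_space A E)"
    unfolding tangent_bundle_def
    by (rule image_eqI[OF _ bundle_chart_in[OF A E a c]], simp) (rule image_eqI[OF _ f(1)], simp)
  have 3: "smooth_fun (total_space A E) ?O (\<lambda>x. mdiff (total_space A E) f x (inv (?c x)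
      (snd v, fst v + - connection_term N \<Phi> x (inv (mdiff A \<phi> (fst x)) (snd v)))))"
  proof (rule smooth_fun_apply[OF XA' o _ _ y, where L = "\<lambda>x y. mdiff (total_space A E) f x (inv (?c x) y)"])
    show "linear (\<lambda>y. mdiff (total_space A E) f x (inv (?c x) y))" if "x \<in> ?O" for x
      using linear_compose[OF linear_inv_bij[OF mdiff_bundle_chart_bij[OF A E N a c x[OF that]]]
          vector_bundle_triv(2)[OF TX cX(2)]] that by (simp add: o_def)
    show "smooth_fun (total_space A E) ?O (\<lambda>x. mdiff (total_space A E) f x (inv (?c x) y))" for y
      by (rule smooth_fun_subset[OF vector_bundle_triv(4)[OF TX cX]]) (auto simp: U2)
  qed
  show "smooth_fun (total_space A E) ?O (\<lambda>x. \<Theta> x (inv (P x) (inv (\<Psi> x) v)))"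
  proof (rule smooth_fun_cong[OF XA' o _ 3])
    fix x assume xO: "x \<in> ?O"
    then have xc: "x \<in> carrier_of (total_space A E)" by blast
    note bc = mdiff_bundle_chart_bij[OF A E N a c x[OF xO]]
    note b\<phi> = mdiff_chart_bij(2)[OF A smooth_chart_in_atlas[OF A a] x(1)[OF xO]]
    note b\<Phi> = vector_bundle_triv(3)[OF E c x(2)[OF xO]]
    have i: "inv (\<Psi> x) v = ?z x" unfolding \<Psi> inv_map_prod[OF b\<Phi> b\<phi>] by (simp add: map_prod_def split_beta)
    let ?w = "inv (P x) (?z x)"
    have "P x ?w = ?z x" using tangent_split_bij(2)[OF A E N xc] by (simp add: bij_is_surj surj_f_inv_f)
    then have p: "vproj A E N x ?w = fst (?z x)" "dproj A E x ?w = snd (?z x)"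
      by (simp_all add: tangent_split_def)
    note ch = split_in_chart[OF A E N a c x[OF xO], of ?w, unfolded p fst_conv snd_conv]
    have "fst (?c x ?w) = snd v" using ch(1) b\<phi> by (simp add: bij_is_surj surj_f_inv_f)
    moreover have "snd (?c x ?w) = fst v + - connection_term N \<Phi> x (inv (mdiff A \<phi> (fst x)) (snd v))"
      using add_implies_diff[OF ch(2)[symmetric]] vector_bundle_inv(2)[OF E c x(2)[OF xO]] by simp
    ultimately have "(snd v, fst v + - connection_term N \<Phi> x (inv (mdiff A \<phi> (fst x)) (snd v))) = ?c x ?w"
      by (simp add: prod_eq_iff)
    then show "mdiff (total_space A E) f x (inv (?c x) (snd v, fst v + - connection_term N \<Phi> x (inv (mdiff A \<phi> (fst x)) (snd v))))
        = \<Theta> x (inv (P x) (inv (\<Psi> x) v))"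
      unfolding f(2) i using bc(2) by (simp add: bij_is_inj)
  qed
qed

lemma splitting_isometry:
  assumes xc: "x \<in> carrier_of (total_space A E)"
  shows "linear (splitting A E N x)" "bij (splitting A E N x)"
    "inv (splitting A E N x) = map_prod (inv (P x)) (adjoint (P x))"
    "gen_pairing (splitting A E N x a) (splitting A E N x b) = gen_pairing a b"
proof -
  note P = tangent_split_bij[OF A E N xc]
  note Q = linear_inv_bij[OF P] bij_imp_bij_inv[OF P(2)]
  note eq = splitting_eq[OF A E N xc]
  show "linear (splitting A E N x)"
    unfolding eq by (rule linear_map_prod[OF P(1) adjoint_linear[OF Q(1)]])
  show "bij (splitting A E N x)"
    unfolding eq by (rule bij_map_prod[OF P(2) adjoint_bij(1)[OF Q]])
  show "inv (splitting A E N x) = map_prod (inv (P x)) (adjoint (P x))"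
    unfolding eq inv_map_prod[OF P(2) adjoint_bij(1)[OF Q]] adjoint_bij(2)[OF Q] inv_inv_eq[OF P(2)] ..
  show "gen_pairing (splitting A E N x a) (splitting A E N x b) = gen_pairing a b"
    unfolding eq using P(2)
    by (simp add: gen_pairing_def split_beta adjoint_inner[OF Q(1)] bij_is_inj)
qed

text \<open>The cotangent half of \<open>splitting\<close> is smooth because the inverse of
  \<open>tangent_split\<close> is, and that of its inverse because \<open>tangent_split\<close> is.
  The lift is then a composite of three smooth maps.\<close>

lemma gen_almost_complex_lift:
  assumes K: "gen_almost_complex A W K"
  shows "gen_almost_complex (total_space A E) (tangent_bundle (total_space A E)) (lift A E N K)"
  unfolding gen_almost_complex_iff
proof (intro conjI ballI)
  let ?T = "sum_bundle (tangent_bundle (total_space A E)) (dual_bundle (tangent_bundle (total_space A E)))"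
  let ?P = "sum_bundle (pullback_bundle W) (dual_bundle (pullback_bundle W))"
  note dT = vector_bundle_dual[OF XA' TX] and dP = vector_bundle_dual[OF XA' PW]
  note T = vector_bundle_sum[OF XA' Xo TX dT] and P = vector_bundle_sum[OF XA' Xo PW dP]
  have S: "smooth_hom (total_space A E) (carrier_of (total_space A E)) ?T ?P (splitting A E N)"
    by (rule smooth_hom_cong[OF XA' Xo T P smooth_hom_map_prod[OF XA' Xo TX PW dT dP smooth_hom_tangent_split
            smooth_hom_adjoint[OF XA' Xo PW TX smooth_hom_inv_tangent_split]]])
      (simp add: splitting_eq[OF A E N])
  have S': "smooth_hom (total_space A E) (carrier_of (total_space A E)) ?P ?T (\<lambda>x. inv (splitting A E N x))"
    by (rule smooth_hom_cong[OF XA' Xo P T smooth_hom_map_prod[OF XA' Xo PW TX dP dT smooth_hom_inv_tangent_split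
            smooth_hom_adjoint[OF XA' Xo TX PW smooth_hom_tangent_split]]])
      (simp add: splitting_isometry(3))
  note WW2 = vector_bundle_sum[OF A openin_mtop_carrier[OF A] WW vector_bundle_dual[OF A WW]]
  have "smooth_hom A (carrier_of A) (sum_bundle W (dual_bundle W)) (sum_bundle W (dual_bundle W)) K"
    using K unfolding gen_almost_complex_iff by (rule conjunct1)
  from smooth_hom_pullback[OF A E WW2 WW2 this]
  have K': "smooth_hom (total_space A E) (carrier_of (total_space A E)) ?P ?P (\<lambda>x. K (fst x))"
    unfolding dual_pullback_bundle sum_pullback_bundle .
  show "smooth_hom (total_space A E) (carrier_of (total_space A E)) ?T ?T (lift A E N K)"
    by (rule smooth_hom_cong[OF XA' Xo T T smooth_hom_compose[OF XA' Xo T P T smooth_hom_compose[OF XA' Xo T P P S K'] S']])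
      (simp add: lift_def)
  fix x assume xc: "x \<in> carrier_of (total_space A E)"
  then have "complex_at K (fst x)"
    using K by (auto simp: gen_almost_complex_iff carrier_total_space[OF A E])
  then show "complex_at (lift A E N K) x"
    by (intro complex_at_conj[OF splitting_isometry(1,2,4)[OF xc]]) (auto simp: lift_def)
qed

lemma kaehler_at_lift:
  assumes "x \<in> carrier_of (total_space A E)"
  shows "kaehler_at (lift A E N K) (lift A E N K') x \<longleftrightarrow> kaehler_at K K' (fst x)"
  by (rule kaehler_at_conj[OF splitting_isometry(1,2,4)[OF assms]]) (simp_all add: lift_def)

lemma gen_metric_lift:
  assumes "x \<in> carrier_of (total_space A E)"
  shows "gen_metric (lift A E N K) (lift A E N K') x a
    = inv (splitting A E N x) (gen_metric K K' (fst x) (splitting A E N x a))"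
  by (rule gen_metric_conj[OF splitting_isometry(1,2,4)[OF assms]]) (simp_all add: lift_def)

end

section \<open>The mirror structure on the base\<close>

lemma swap_fibre_props:
  fixes S :: "('v::euclidean_space \<times> 'b::euclidean_space) \<times> ('v \<times> 'b) \<Rightarrow> ('v \<times> 'b) \<times> ('v \<times> 'b)"
  defines "S \<equiv> swap_fibre"
  shows "S (S z) = z" "inv S = S" "linear S" "bij S" "gen_pairing (S a) (S b) = gen_pairing a b"
proof -
  have SS: "S (S z) = z" for z by (cases z) (auto simp: S_def swap_fibre_def split_beta)
  show "S (S z) = z" "inv S = S" using SS inv_equality[of S S] by auto
  show "linear S" by (auto simp: S_def swap_fibre_def linear_iff split_beta)
  show "bij S" using SS by (intro o_bij[of S]) auto
  show "gen_pairing (S a) (S b) = gen_pairing a b"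
    by (auto simp: S_def swap_fibre_def gen_pairing_def split_beta inner_prod_def inner_commute)
qed

lemma mirror_base_eq:
  fixes K :: "'m \<Rightarrow> ('v::euclidean_space \<times> 'b::euclidean_space) \<times> ('v \<times> 'b) \<Rightarrow> ('v \<times> 'b) \<times> ('v \<times> 'b)"
  shows "mirror_base K p = inv swap_fibre \<circ> K p \<circ> swap_fibre"
  by (simp add: mirror_base_def swap_fibre_props(2))

context
  fixes A :: "('m, 'b::euclidean_space) atlas" and U :: "'m set"
    and E E' :: "('m, 'v::euclidean_space) vbundle" and T :: "('m, 'w::euclidean_space) vbundle"
  assumes A: "smooth_atlas A" and U: "openin (mtop A) U"
    and E: "vector_bundle A E" and T: "vector_bundle A T"
begin

private abbreviation ET where "ET \<equiv> sum_bundle E T"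
private lemmas dE = vector_bundle_dual[OF A E]
private lemmas dT = vector_bundle_dual[OF A T]
private lemmas ETb = vector_bundle_sum[OF A U E T]
private lemmas dETb = vector_bundle_dual[OF A ETb]
private lemmas ET2 = vector_bundle_sum[OF A U ETb dETb]
private lemmas id = smooth_hom_id[where U = U]

lemma smooth_hom_zero:
  "vector_bundle A F \<Longrightarrow> vector_bundle A G \<Longrightarrow> smooth_hom A U F G (\<lambda>p v. 0)"
  for F :: "('m, 'u::euclidean_space) vbundle" and G :: "('m, 'u'::euclidean_space) vbundle"
proof (rule smooth_homI)
  fix U1 \<Phi> U2 \<Psi> v assume F: "vector_bundle A F" "vector_bundle A G" and c: "(U1, \<Phi>) \<in> F" "(U2, \<Psi>) \<in> G"
  note o = openin_triv2[OF A U F c]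
  show "smooth_fun A (U \<inter> U1 \<inter> U2) (\<lambda>p. \<Psi> p 0)"
    by (rule smooth_fun_cong[OF A o _ smooth_fun_const[OF A o, of 0]])
      (simp add: linear_0[OF vector_bundle_triv(2)[OF F(2) c(2)]])
qed (simp add: linear_iff)

lemma smooth_hom_incl:
  "smooth_hom A U E ET (\<lambda>p v. (v, 0))" "smooth_hom A U T ET (\<lambda>p v. (0, v))"
  using smooth_hom_Pair[OF A U E E T id[OF E] smooth_hom_zero[OF E T]]
    smooth_hom_Pair[OF A U T E T smooth_hom_zero[OF T E] id[OF T]] by simp_all

private lemma adjoint_incl:
  "adjoint (\<lambda>v::'v. (v, 0::'w)) = fst" "adjoint (\<lambda>v::'w. (0::'v, v)) = snd"
  "adjoint (fst :: 'v \<times> 'w \<Rightarrow> 'v) = (\<lambda>v. (v, 0))" "adjoint (snd :: 'v \<times> 'w \<Rightarrow> 'w) = (\<lambda>v. (0, v))"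
  by (intro adjoint_unique allI, simp add: inner_prod_def inner_commute)+

text \<open>The dual of a sum need not be literally the sum of the duals. Its projections are
  therefore obtained as transposes of inclusions, and below its inclusions as transposes of
  projections.\<close>

lemma smooth_hom_dual_fst_snd:
  "smooth_hom A U (dual_bundle ET) (dual_bundle E) (\<lambda>p. fst)"
  "smooth_hom A U (dual_bundle ET) (dual_bundle T) (\<lambda>p. snd)"
  using smooth_hom_adjoint[OF A U E ETb smooth_hom_incl(1)] smooth_hom_adjoint[OF A U T ETb smooth_hom_incl(2)]
  by (simp_all add: adjoint_incl)

lemma smooth_hom_dual_incl:
  "smooth_hom A U (dual_bundle E) (dual_bundle ET) (\<lambda>p v. (v, 0))"
  "smooth_hom A U (dual_bundle T) (dual_bundle ET) (\<lambda>p v. (0, v))"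
  using smooth_hom_adjoint[OF A U ETb E smooth_hom_fst_snd(1)[OF A U E T]]
    smooth_hom_adjoint[OF A U ETb T smooth_hom_fst_snd(2)[OF A U E T]]
  by (simp_all add: adjoint_incl)

lemma smooth_hom_components:
  "smooth_hom A U (sum_bundle ET (dual_bundle ET)) E (\<lambda>p z. fst (fst z))"
  "smooth_hom A U (sum_bundle ET (dual_bundle ET)) T (\<lambda>p z. snd (fst z))"
  "smooth_hom A U (sum_bundle ET (dual_bundle ET)) (dual_bundle E) (\<lambda>p z. fst (snd z))"
  "smooth_hom A U (sum_bundle ET (dual_bundle ET)) (dual_bundle T) (\<lambda>p z. snd (snd z))"
  by (rule smooth_hom_compose[OF A U ET2 ETb E smooth_hom_fst_snd(1)[OF A U ETb dETb] smooth_hom_fst_snd(1)[OF A U E T]])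
    (rule smooth_hom_compose[OF A U ET2 ETb T smooth_hom_fst_snd(1)[OF A U ETb dETb] smooth_hom_fst_snd(2)[OF A U E T]],
     rule smooth_hom_compose[OF A U ET2 dETb dE smooth_hom_fst_snd(2)[OF A U ETb dETb] smooth_hom_dual_fst_snd(1)],
     rule smooth_hom_compose[OF A U ET2 dETb dT smooth_hom_fst_snd(2)[OF A U ETb dETb] smooth_hom_dual_fst_snd(2)])

lemma smooth_hom_inclusions:
  "smooth_hom A U E (sum_bundle ET (dual_bundle ET)) (\<lambda>p v. ((v, 0), (0, 0)))"
  "smooth_hom A U T (sum_bundle ET (dual_bundle ET)) (\<lambda>p t. ((0, t), (0, 0)))"
  "smooth_hom A U (dual_bundle E) (sum_bundle ET (dual_bundle ET)) (\<lambda>p f. ((0, 0), (f, 0)))"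
  "smooth_hom A U (dual_bundle T) (sum_bundle ET (dual_bundle ET)) (\<lambda>p k. ((0, 0), (0, k)))"
  using smooth_hom_Pair[OF A U E ETb dETb smooth_hom_incl(1) smooth_hom_zero[OF E dETb]]
    smooth_hom_Pair[OF A U T ETb dETb smooth_hom_incl(2) smooth_hom_zero[OF T dETb]]
    smooth_hom_Pair[OF A U dE ETb dETb smooth_hom_zero[OF dE ETb] smooth_hom_dual_incl(1)]
    smooth_hom_Pair[OF A U dT ETb dETb smooth_hom_zero[OF dT ETb] smooth_hom_dual_incl(2)]
  by (simp_all add: zero_prod_def)

end

text \<open>\<open>swap_fibre\<close> is the sum of four paths through single summands, two of which
  use the identities \<open>id\<close>. With \<open>E'\<close> as a parameter the lemma covers both
  the passage from V to its dual and the way back, where V is the double dual only up to a smooth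
  identity map.\<close>

lemma smooth_hom_swap:
  fixes A :: "('m, 'b::euclidean_space) atlas" and E E' :: "('m, 'v::euclidean_space) vbundle"
    and T :: "('m, 'w::euclidean_space) vbundle"
  assumes A: "smooth_atlas A" and U: "openin (mtop A) U"
    and E: "vector_bundle A E" and E': "vector_bundle A E'" and T: "vector_bundle A T"
    and id: "smooth_hom A U (dual_bundle E) E' (\<lambda>p v. v)" "smooth_hom A U E (dual_bundle E') (\<lambda>p v. v)"
  shows "smooth_hom A U (sum_bundle (sum_bundle E T) (dual_bundle (sum_bundle E T)))
    (sum_bundle (sum_bundle E' T) (dual_bundle (sum_bundle E' T))) (\<lambda>p. swap_fibre)"
proof -
  note W = vector_bundle_sum[OF A U E T] and W' = vector_bundle_sum[OF A U E' T]
  note dW = vector_bundle_dual[OF A W] and dW' = vector_bundle_dual[OF A W']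
  note WW = vector_bundle_sum[OF A U W dW] and WW' = vector_bundle_sum[OF A U W' dW']
  note dE = vector_bundle_dual[OF A E] and dE' = vector_bundle_dual[OF A E'] and dT = vector_bundle_dual[OF A T]
  note c = smooth_hom_components[OF A U E T]
  note i = smooth_hom_inclusions[OF A U E' T]
  note 1 = smooth_hom_compose[OF A U WW E' WW' smooth_hom_compose[OF A U WW dE E' c(3) id(1)] i(1)]
  note 2 = smooth_hom_compose[OF A U WW T WW' c(2) i(2)]
  note 3 = smooth_hom_compose[OF A U WW dE' WW' smooth_hom_compose[OF A U WW E dE' c(1) id(2)] i(3)]
  note 4 = smooth_hom_compose[OF A U WW dT WW' c(4) i(4)]
  show ?thesis
    by (rule smooth_hom_cong[OF A U WW WW' smooth_hom_add[OF A U WW WW' smooth_hom_add[OF A U WW WW' 1 2]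
            smooth_hom_add[OF A U WW WW' 3 4]]])
      (simp add: swap_fibre_def split_beta)
qed

lemma gen_almost_complex_mirror_base:
  assumes A: "smooth_atlas A" and E: "vector_bundle A E"
    and K: "gen_almost_complex A (sum_bundle E (tangent_bundle A)) K"
  shows "gen_almost_complex A (sum_bundle (dual_bundle E) (tangent_bundle A)) (mirror_base K)"
  unfolding gen_almost_complex_iff
proof (intro conjI ballI)
  note U = openin_mtop_carrier[OF A] and dE = vector_bundle_dual[OF A E] and T = vector_bundle_tangent[OF A]
  note W = vector_bundle_sum[OF A U E T] and W' = vector_bundle_sum[OF A U dE T]
  note WW = vector_bundle_sum[OF A U W vector_bundle_dual[OF A W]]
  note WW' = vector_bundle_sum[OF A U W' vector_bundle_dual[OF A W']]
  note dd = smooth_hom_double_dual[OF A U E]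
  note s1 = smooth_hom_swap[OF A U E dE T smooth_hom_id[OF dE] dd(1)]
  note s2 = smooth_hom_swap[OF A U dE E T dd(2) smooth_hom_id[OF dE]]
  note K' = conjunct1[OF K[unfolded gen_almost_complex_iff]]
  show "smooth_hom A (carrier_of A)
      (sum_bundle (sum_bundle (dual_bundle E) (tangent_bundle A)) (dual_bundle (sum_bundle (dual_bundle E) (tangent_bundle A))))
      (sum_bundle (sum_bundle (dual_bundle E) (tangent_bundle A)) (dual_bundle (sum_bundle (dual_bundle E) (tangent_bundle A))))
      (mirror_base K)"
    by (rule smooth_hom_cong[OF A U WW' WW' smooth_hom_compose[OF A U WW' WW WW'
            smooth_hom_compose[OF A U WW' WW WW s2 K'] s1]])
      (simp add: mirror_base_def swap_fibre_props(2))
  fix p assume "p \<in> carrier_of A"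
  then have "complex_at K p" using K by (simp add: gen_almost_complex_iff)
  then show "complex_at (mirror_base K) p"
    by (rule complex_at_conj[OF swap_fibre_props(3-5), where K = K and q = p, rotated]) (rule mirror_base_eq)
qed

section \<open>Linear algebra of generalized metrics\<close>

lemma pos_def_bij:
  fixes f :: "'v::euclidean_space \<Rightarrow> 'v"
  assumes lin: "linear f" and pos: "\<And>v. v \<noteq> 0 \<Longrightarrow> f v \<bullet> v > 0"
  shows "bij f"
proof -
  have "v = 0" if "f v = 0" for v using pos[of v] that by fastforce
  then have "inj f" using lin by (simp add: linear_injective_0)
  then show ?thesis using lin linear_injective_imp_surjective by (auto simp: bij_def)
qed

text \<open>The block [a b; c a^\<or>] of G on a summand W \<oplus> W^\<or>. Symmetry for the
  pairing makes \<open>b\<close> and \<open>c\<close> self-adjoint and the last entry the transpose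
  of \<open>a\<close>; \<open>pos\<close> is positivity on W^\<or> and on W, and
  \<open>square\<close> lists the entries of G^2 = 1.\<close>

locale block_metric =
  fixes a b c :: "'v::euclidean_space \<Rightarrow> 'v"
  assumes lin: "linear a" "linear b" "linear c"
    and sym: "adjoint b = b" "adjoint c = c"
    and pos: "v \<noteq> 0 \<Longrightarrow> b v \<bullet> v > 0" "v \<noteq> 0 \<Longrightarrow> c v \<bullet> v > 0"
    and square: "a (a v) + b (c v) = v" "a (b v) + b (adjoint a v) = 0"
      "c (a v) + adjoint a (c v) = 0" "c (b v) + adjoint a (adjoint a v) = v"
begin

lemma mirror: "block_metric (adjoint a) c b"
proof -
  note aa = adjoint_adjoint[OF lin(1)]
  show ?thesis
    unfolding block_metric_def aa
    using lin sym pos square adjoint_linear[OF lin(1)] by (simp add: add.commute)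
qed

lemma bij_b: "bij b" using pos_def_bij[OF lin(2) pos(1)] .
lemma bij_c: "bij c" using pos_def_bij[OF lin(3) pos(2)] .

lemma inv_b: "b (inv b v) = v" "inv b (b v) = v" "linear (inv b)"
  using bij_b linear_inv_bij[OF lin(2) bij_b] by (auto simp: bij_is_inj bij_is_surj surj_f_inv_f)

lemma inv_c: "c (inv c v) = v" "inv c (c v) = v" "linear (inv c)"
  using bij_c linear_inv_bij[OF lin(3) bij_c] by (auto simp: bij_is_inj bij_is_surj surj_f_inv_f)

lemma b_inner: "b u \<bullet> v = u \<bullet> b v" using adjoint_inner[OF lin(2)] by (simp add: sym)

lemma metric_sym: "inv b u \<bullet> v = inv b v \<bullet> u"
  using b_inner[of "inv b u" "inv b v"] by (simp add: inv_b(1) inner_commute)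

lemma metric_pos: assumes "v \<noteq> 0" shows "inv b v \<bullet> v > 0"
proof -
  have "inv b v \<noteq> 0" using assms inv_b(1)[of v] lin(2) linear_0 by metis
  from pos(1)[OF this] show ?thesis by (simp add: inv_b(1) inner_commute)
qed

text \<open>The upper right entry of G^2 = 1 reads a b = - b a^\<or>. Multiplying by
  \<open>inv b\<close> on both sides trades the transpose of \<open>a\<close> for \<open>a\<close>;
  skewness of the form and the cancellations in \<open>eigen_iff\<close> and \<open>buscher\<close>
  rest on this.\<close>

lemma adjoint_metric: "adjoint a (inv b v) = - inv b (a v)"
proof -
  have "a v + b (adjoint a (inv b v)) = 0" using square(2)[of "inv b v"] by (simp add: inv_b(1))
  then have "b (adjoint a (inv b v)) = b (- inv b (a v))"
    by (simp add: linear_neg[OF lin(2)] inv_b(1) eq_neg_iff_add_eq_0 add.commute)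
  then show ?thesis using bij_b by (simp add: bij_is_inj inj_eq)
qed

lemma form_skew: "adjoint a (inv b u) \<bullet> v = - (adjoint a (inv b v) \<bullet> u)"
proof -
  have "adjoint a (inv b u) \<bullet> v = inv b (a v) \<bullet> u"
    by (simp add: adjoint_inner[OF lin(1)] metric_sym)
  then show ?thesis by (simp add: adjoint_metric)
qed

text \<open>The first row of the eigenvector equation determines \<open>f\<close>, because
  \<open>b\<close> is invertible. The second row then follows: after applying \<open>b\<close> it
  reduces to the first by the two upper entries of G^2 = 1.\<close>

lemma eigen_iff: "a v + b f = v \<and> c v + adjoint a f = f \<longleftrightarrow> f = inv b v + adjoint a (inv b v)"
proof
  assume "a v + b f = v \<and> c v + adjoint a f = f"
  then have "b f = v - a v" by (metis add_diff_cancel_left')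
  then have "f = inv b (v - a v)" using inv_b(2)[of f] by simp
  then show "f = inv b v + adjoint a (inv b v)"
    by (simp add: adjoint_metric linear_diff[OF inv_b(3)])
next
  assume f: "f = inv b v + adjoint a (inv b v)"
  then have "f = inv b (v - a v)" by (simp add: adjoint_metric linear_diff[OF inv_b(3)])
  then have bf: "b f = v - a v" by (simp add: inv_b(1))
  then have 1: "a v + b f = v" by simp
  have "b (c v + adjoint a f) = b f"
  proof -
    have "b (c v) = v - a (a v)" using square(1)[of v] by (metis add_diff_cancel_left')
    moreover have "b (adjoint a f) = - a (b f)"
      using square(2)[of f] by (simp add: eq_neg_iff_add_eq_0 add.commute)
    ultimately show ?thesis by (simp add: linear_add[OF lin(2)] bf linear_diff[OF lin(1)])
  qed
  then have "c v + adjoint a f = f" using bij_b by (simp add: bij_is_inj inj_eq)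
  with 1 show "a v + b f = v \<and> c v + adjoint a f = f" by blast
qed

text \<open>With \<open>h = b\<^sup>-\<^sup>1\<close> and \<open>\<beta> = a\<^sup>\<or> b\<^sup>-\<^sup>1 = -b\<^sup>-\<^sup>1 a\<close> one has \<open>h - \<beta> = h (1 + a)\<close>, \<open>h + \<beta> = h (1 - a)\<close>
  and \<open>c\<^sup>-\<^sup>1 h = (1 - a\<^sup>2)\<^sup>-\<^sup>1\<close>; the factors commute and cancel.\<close>

lemma buscher:
  defines "h \<equiv> inv b" and "\<beta> \<equiv> \<lambda>v. adjoint a (inv b v)"
    and "hh \<equiv> inv c" and "\<beta>h \<equiv> \<lambda>f. a (inv c f)"
  shows "h (hh (h u - \<beta> u)) + \<beta> (hh (h u - \<beta> u)) = h u"
    "h (\<beta>h (h u - \<beta> u)) + \<beta> (\<beta>h (h u - \<beta> u)) = - \<beta> u"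
proof -
  define r where "r = hh (h u - \<beta> u)"
  have hb: "h u - \<beta> u = h (u + a u)" for u
    by (simp add: h_def \<beta>_def adjoint_metric linear_add[OF inv_b(3)])
  have hb': "h u + \<beta> u = h (u - a u)" for u
    by (simp add: h_def \<beta>_def adjoint_metric linear_diff[OF inv_b(3)])
  have "b (c r) = u + a u"
    unfolding r_def hb unfolding hh_def h_def by (simp add: inv_b(1) inv_c(1))
  then have r: "r - a (a r) = u + a u" using square(1)[of r] by (metis add_diff_cancel_left')
  \<comment> \<open>\<open>q\<close> measures the failure of r - a r = u. It is killed by 1 + a,
    hence by b c = 1 - a^2, and so vanishes; this cancels the common factor 1 + a.\<close>
  define q where "q = r - a r - u"
  have "q + a q = 0"
    using r by (simp add: q_def linear_diff[OF lin(1)] linear_add[OF lin(1)] algebra_simps)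
  then have aq: "a q = - q" by (simp add: eq_neg_iff_add_eq_0 add.commute)
  have "b (c q) = 0" using square(1)[of q] by (simp add: aq linear_neg[OF lin(1)])
  then have "c q = 0" using inv_b(2)[of "c q"] by (simp add: linear_0[OF inv_b(3)])
  then have q0: "q = 0" using inv_c(2)[of q] by (simp add: linear_0[OF inv_c(3)])
  then have ru: "r - a r = u" by (simp add: q_def)
  show "h (hh (h u - \<beta> u)) + \<beta> (hh (h u - \<beta> u)) = h u"
    unfolding r_def[symmetric] hb' ru ..
  have bh: "\<beta>h (h u - \<beta> u) = a r" by (simp add: \<beta>h_def r_def hh_def)
  have "a r - a (a r) = a u" using ru linear_diff[OF lin(1), of r "a r"] by simp
  then show "h (\<beta>h (h u - \<beta> u)) + \<beta> (\<beta>h (h u - \<beta> u)) = - \<beta> u"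
    unfolding bh hb' by (simp add: h_def \<beta>_def adjoint_metric)
qed

end

section \<open>Decomposition of the generalized metric into two blocks\<close>

definition block_diagonal ::
  "(('v::euclidean_space \<times> 'b::euclidean_space) \<times> ('v \<times> 'b) \<Rightarrow> ('v \<times> 'b) \<times> ('v \<times> 'b)) \<Rightarrow>
   ('v \<Rightarrow> 'v) \<Rightarrow> ('v \<Rightarrow> 'v) \<Rightarrow> ('v \<Rightarrow> 'v) \<Rightarrow> ('b \<Rightarrow> 'b) \<Rightarrow> ('b \<Rightarrow> 'b) \<Rightarrow> ('b \<Rightarrow> 'b) \<Rightarrow> bool" where
  "block_diagonal G a b c a' b' c' \<longleftrightarrow> block_metric a b c \<and> block_metric a' b' c' \<and>
     (\<forall>v t f k. G ((v, t), (f, k)) =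
       ((a v + b f, a' t + b' k), (c v + adjoint a f, c' t + adjoint a' k)))"

text \<open>The blocks are given as explicit entries of G, so that their smoothness in the point can
  later be deduced from that of G.\<close>

lemma adapted_block_diagonal:
  fixes K K' :: "'m \<Rightarrow> ('v::euclidean_space \<times> 'b::euclidean_space) \<times> ('v \<times> 'b) \<Rightarrow> ('v \<times> 'b) \<times> ('v \<times> 'b)"
  assumes p: "p \<in> carrier_of A" and lin: "linear (K p)" "linear (K' p)"
    and c: "complex_at K p" "complex_at K' p" and k: "kaehler_at K K' p"
    and ad: "adapted A K" "adapted A K'"
  defines "G \<equiv> gen_metric K K' p"
  shows "block_diagonal G
    (\<lambda>v. fst (fst (G ((v, 0), (0, 0))))) (\<lambda>f. fst (fst (G ((0, 0), (f, 0))))) (\<lambda>v. fst (snd (G ((v, 0), (0, 0)))))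
    (\<lambda>t. snd (fst (G ((0, t), (0, 0))))) (\<lambda>k. snd (fst (G ((0, 0), (0, k))))) (\<lambda>t. snd (snd (G ((0, t), (0, 0)))))"
proof -
  let ?F = "range (\<lambda>(v, f). ((v, 0), (f, 0))) :: (('v \<times> 'b) \<times> ('v \<times> 'b)) set"
  let ?B = "range (\<lambda>(t, k). ((0, t), (0, k))) :: (('v \<times> 'b) \<times> ('v \<times> 'b)) set"
  have F: "z \<in> ?F \<longleftrightarrow> snd (fst z) = 0 \<and> snd (snd z) = 0" for z by (cases z) force
  have B: "z \<in> ?B \<longleftrightarrow> fst (fst z) = 0 \<and> fst (snd z) = 0" for z by (cases z) force
  have neg: "- z \<in> ?F \<longleftrightarrow> z \<in> ?F" "- z \<in> ?B \<longleftrightarrow> z \<in> ?B" for z unfolding F B by simp_all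
  have KF: "K p ` ?F = ?B" "K' p ` ?F = ?B" using ad p unfolding adapted_def by auto
  have sq: "K p (K p z) = - z" "K' p (K' p z) = - z" for z using c unfolding complex_at_def by blast+
  \<comment> \<open>\<open>adapted\<close> provides one direction of the exchange; that the
    structures square to -1 provides the other.\<close>
  have KB: "L z \<in> ?F" if L: "L ` ?F = ?B" "\<And>z. L (L z) = - z" "z \<in> ?B" for L z
  proof -
    have "z \<in> L ` ?F" using L(1,3) by simp
    then obtain y where "y \<in> ?F" "z = L y" by (rule imageE) simp
    then show ?thesis using neg(1)[of y] by (simp only: L(2))
  qed
  have GF: "G z \<in> ?F" if "z \<in> ?F" for z
  proof -
    have "K' p z \<in> ?B" using KF(2) that by blast
    from KB[OF KF(1) sq(1) this] show ?thesis unfolding G_def gen_metric_def neg .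
  qed
  have GB: "G z \<in> ?B" if "z \<in> ?B" for z
  proof -
    have "K' p z \<in> ?F" using KB[OF KF(2) sq(2) that] .
    then have "K p (K' p z) \<in> ?B" using KF(1) by blast
    then show ?thesis unfolding G_def gen_metric_def neg .
  qed
  have lG: "linear G"
    unfolding G_def gen_metric_def[abs_def]
    using linear_compose_neg[OF linear_compose[OF lin(2,1)]] by (simp add: o_def)
  have com: "K p (K' p z) = K' p (K p z)" for z using k unfolding kaehler_at_def by blast
  \<comment> \<open>As the two structures commute, (J J')^2 = J^2 J'^2 = 1.\<close>
  have GG: "G (G z) = z" for z
    unfolding G_def gen_metric_def
    by (simp only: linear_neg[OF lin(1)] linear_neg[OF lin(2)] com sq minus_minus)
  have symG: "gen_pairing (G x) y = gen_pairing (G y) x" for x y using k unfolding kaehler_at_def G_def by blast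
  have posG: "x \<noteq> 0 \<Longrightarrow> gen_pairing (G x) x > 0" for x using k unfolding kaehler_at_def G_def by blast
  define a b c d where "a v = fst (fst (G ((v, 0), (0, 0))))" and "b f = fst (fst (G ((0, 0), (f, 0))))"
    and "c v = fst (snd (G ((v, 0), (0, 0))))" and "d f = fst (snd (G ((0, 0), (f, 0))))" for v f
  define a' b' c' d' where "a' t = snd (fst (G ((0, t), (0, 0))))" and "b' k = snd (fst (G ((0, 0), (0, k))))"
    and "c' t = snd (snd (G ((0, t), (0, 0))))" and "d' k = snd (snd (G ((0, 0), (0, k))))" for t k
  note defs = a_def b_def c_def d_def a'_def b'_def c'_def d'_def
  have l1: "linear (\<lambda>v. G ((v, 0), (0, 0)))" "linear (\<lambda>f. G ((0, 0), (f, 0)))"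
    "linear (\<lambda>t. G ((0, t), (0, 0)))" "linear (\<lambda>k. G ((0, 0), (0, k)))"
    using linear_compose[OF _ lG, of "\<lambda>v. ((v, 0), (0, 0))"] linear_compose[OF _ lG, of "\<lambda>f. ((0, 0), (f, 0))"]
      linear_compose[OF _ lG, of "\<lambda>t. ((0, t), (0, 0))"] linear_compose[OF _ lG, of "\<lambda>k. ((0, 0), (0, k))"]
    by (simp_all add: o_def linear_iff)
  have lins: "linear a" "linear b" "linear c" "linear d" "linear a'" "linear b'" "linear c'" "linear d'"
    using l1 unfolding linear_iff defs by simp_all
  have Fz: "snd (fst (G ((v, 0), (0, 0)))) = 0" "snd (snd (G ((v, 0), (0, 0)))) = 0"
    "snd (fst (G ((0, 0), (f, 0)))) = 0" "snd (snd (G ((0, 0), (f, 0)))) = 0" for v f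
    using GF[of "((v, 0), (0, 0))"] GF[of "((0, 0), (f, 0))"] unfolding F by simp_all
  have Bz: "fst (fst (G ((0, t), (0, 0)))) = 0" "fst (snd (G ((0, t), (0, 0)))) = 0"
    "fst (fst (G ((0, 0), (0, k)))) = 0" "fst (snd (G ((0, 0), (0, k)))) = 0" for t k
    using GB[of "((0, t), (0, 0))"] GB[of "((0, 0), (0, k))"] unfolding B by simp_all
  have col: "G ((v, 0), (0, 0)) = ((a v, 0), (c v, 0))" "G ((0, 0), (f, 0)) = ((b f, 0), (d f, 0))"
    "G ((0, t), (0, 0)) = ((0, a' t), (0, c' t))" "G ((0, 0), (0, k)) = ((0, b' k), (0, d' k))" for v f t k
    using Fz Bz by (simp_all add: prod_eq_iff defs)
  have G: "G ((v, t), (f, k)) = ((a v + b f, a' t + b' k), (c v + d f, c' t + d' k))" for v t f k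
  proof -
    have e: "((v, t), (f, k)) = ((v, 0), (0, 0)) + ((0, 0), (f, 0)) + ((0, t), (0, 0)) + ((0, 0), (0, k))" by simp
    show ?thesis unfolding e linear_add[OF lG] col by simp
  qed
  \<comment> \<open>Symmetry of (Gx, y) is tested on vectors that lie in a single summand, which
    isolates one entry at a time.\<close>
  have adj: "adjoint a = d" "adjoint b = b" "adjoint c = c" "adjoint a' = d'" "adjoint b' = b'" "adjoint c' = c'"
  proof -
    show "adjoint a = d"
      using symG[of "((_, 0), (0, 0))" "((0, 0), (_, 0))"]
      by (intro adjoint_unique) (simp add: col gen_pairing_def inner_commute)
    show "adjoint b = b"
      using symG[of "((0, 0), (_, 0))" "((0, 0), (_, 0))"]
      by (intro adjoint_unique) (simp add: col gen_pairing_def inner_commute)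
    show "adjoint c = c"
      using symG[of "((_, 0), (0, 0))" "((_, 0), (0, 0))"]
      by (intro adjoint_unique) (simp add: col gen_pairing_def inner_commute)
    show "adjoint a' = d'"
      using symG[of "((0, _), (0, 0))" "((0, 0), (0, _))"]
      by (intro adjoint_unique) (simp add: col gen_pairing_def inner_commute)
    show "adjoint b' = b'"
      using symG[of "((0, 0), (0, _))" "((0, 0), (0, _))"]
      by (intro adjoint_unique) (simp add: col gen_pairing_def inner_commute)
    show "adjoint c' = c'"
      using symG[of "((0, _), (0, 0))" "((0, _), (0, 0))"]
      by (intro adjoint_unique) (simp add: col gen_pairing_def inner_commute)
  qed
  have pos: "v \<noteq> 0 \<Longrightarrow> b v \<bullet> v > 0" "v \<noteq> 0 \<Longrightarrow> c v \<bullet> v > 0"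
    "t \<noteq> 0 \<Longrightarrow> b' t \<bullet> t > 0" "t \<noteq> 0 \<Longrightarrow> c' t \<bullet> t > 0" for v t
    using posG[of "((0, 0), (v, 0))"] posG[of "((v, 0), (0, 0))"] posG[of "((0, 0), (0, t))"] posG[of "((0, t), (0, 0))"]
    by (simp_all add: col gen_pairing_def inner_commute zero_prod_def)
  have sq: "a (a v) + b (c v) = v" "c (a v) + d (c v) = 0" "a (b v) + b (d v) = 0" "c (b v) + d (d v) = v"
    "a' (a' t) + b' (c' t) = t" "c' (a' t) + d' (c' t) = 0" "a' (b' t) + b' (d' t) = 0" "c' (b' t) + d' (d' t) = t" for v t
    using GG[of "((v, 0), (0, 0))"] GG[of "((0, 0), (v, 0))"] GG[of "((0, t), (0, 0))"] GG[of "((0, 0), (0, t))"]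
    by (simp_all add: col G lins[THEN linear_0])
  have "block_metric a b c" "block_metric a' b' c'"
    unfolding block_metric_def using lins adj pos sq by simp_all
  then have "block_diagonal G a b c a' b' c'" unfolding block_diagonal_def using G adj by simp
  then show ?thesis unfolding defs[abs_def] .
qed

lemma block_diagonal_mirror:
  assumes bd: "block_diagonal (gen_metric K K' p) a b c a' b' c'"
  shows "block_diagonal (gen_metric (mirror_base K) (mirror_base K') p) (adjoint a) c b a' b' c'"
proof -
  have bm: "block_metric a b c" "block_metric a' b' c'"
    and G: "gen_metric K K' p ((v, t), (f, k)) =
       ((a v + b f, a' t + b' k), (c v + adjoint a f, c' t + adjoint a' k))" for v t f k
    using bd unfolding block_diagonal_def by blast+
  have aa: "adjoint (adjoint a) = a" using adjoint_adjoint[OF block_metric.lin(1)[OF bm(1)]] .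
  have "gen_metric (mirror_base K) (mirror_base K') p ((v, t), (f, k)) =
      ((adjoint a v + c f, a' t + b' k), (b v + adjoint (adjoint a) f, c' t + adjoint a' k))" for v t f k
    using gen_metric_conj[OF swap_fibre_props(3-5), of "mirror_base K" p K p "mirror_base K'" K' "((v, t), (f, k))",
        OF mirror_base_eq mirror_base_eq]
    unfolding swap_fibre_props(2) by (simp add: swap_fibre_def G aa add.commute)
  then show ?thesis
    unfolding block_diagonal_def using bm(2) block_metric.mirror[OF bm(1)] by blast
qed

text \<open>The eigenspace, being a graph, determines the sum of metric and form; the symmetric and
  the skew part of a bilinear form are unique.\<close>

lemma metric_and_form_unique:
  assumes "metric_and_form G g b" "metric_and_form G g' b'"
  shows "g = g'" "b = b'"
proof -
  have "range (\<lambda>v. (v, g v + b v)) = range (\<lambda>v. (v, g' v + b' v))"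
    using assms unfolding metric_and_form_def by blast
  then have eq: "g v + b v = g' v + b' v" for v
    by (metis (no_types, lifting) Pair_inject rangeE rangeI)
  have s: "g v \<bullet> w = g w \<bullet> v" "g' v \<bullet> w = g' w \<bullet> v" "b v \<bullet> w = - (b w \<bullet> v)" "b' v \<bullet> w = - (b' w \<bullet> v)" for v w
    using assms unfolding metric_and_form_def by blast+
  have "g v \<bullet> w = g' v \<bullet> w" for v w
  proof -
    have "g v \<bullet> w + b v \<bullet> w = g' v \<bullet> w + b' v \<bullet> w" "g w \<bullet> v + b w \<bullet> v = g' w \<bullet> v + b' w \<bullet> v"
      using arg_cong[OF eq[of v], of "\<lambda>x. x \<bullet> w"] arg_cong[OF eq[of w], of "\<lambda>x. x \<bullet> v"]
      by (simp_all add: inner_add_left)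
    then show ?thesis using s(1)[of w v] s(2)[of w v] s(3)[of w v] s(4)[of w v] by linarith
  qed
  then show gg: "g = g'" using vector_eq_rdot by blast
  show "b = b'" using eq by (auto simp: gg)
qed

lemma metric_form_of_eqI:
  assumes "metric_and_form (gen_metric J J' p) g b"
  shows "metric_of J J' p = g" "form_of J J' p = b"
  unfolding metric_of_def form_of_def
  by (rule the_equality; use assms metric_and_form_unique in blast)+

section \<open>Metric and 2-form of a lifted pair\<close>

context
  fixes A :: "('m, 'b::euclidean_space) atlas" and E :: "('m, 'v::euclidean_space) vbundle"
    and N :: "('m, 'b, 'v) conn"
  assumes A: "smooth_atlas A" and E: "vector_bundle A E" and N: "connection A E N"
begin

text \<open>The +1 eigenvectors on the total space correspond under F to those of the base
  structure. \<open>eigen_iff\<close> for both blocks gives a covector on V \<oplus> T_M, and the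
  transpose of \<open>tangent_split\<close> carries it back, producing the factors
  \<open>adjoint D\<close> and \<open>adjoint dpi\<close>.\<close>

lemma metric_and_form_lift:
  assumes xc: "x \<in> carrier_of (total_space A E)"
    and J: "J x = lift A E N K x" "J' x = lift A E N K' x"
    and bd: "block_diagonal (gen_metric K K' (fst x)) a b c a' b' c'"
  defines "D \<equiv> vproj A E N x" and "dpi \<equiv> dproj A E x"
  defines "g \<equiv> \<lambda>w. adjoint D (inv b (D w)) + adjoint dpi (inv b' (dpi w))"
    and "\<beta> \<equiv> \<lambda>w. adjoint D (adjoint a (inv b (D w))) + adjoint dpi (adjoint a' (inv b' (dpi w)))"
  shows "metric_of J J' x = g" "form_of J J' x = \<beta>"
    "g w \<bullet> w' = inv b (D w) \<bullet> D w' + inv b' (dpi w) \<bullet> dpi w'"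
    "\<beta> w \<bullet> w' = adjoint a (inv b (D w)) \<bullet> D w' + adjoint a' (inv b' (dpi w)) \<bullet> dpi w'"
proof -
  let ?P = "tangent_split A E N x"
  let ?S = "splitting A E N x"
  let ?G = "gen_metric K K' (fst x)"
  interpret m: block_metric a b c using bd unfolding block_diagonal_def by blast
  interpret m': block_metric a' b' c' using bd unfolding block_diagonal_def by blast
  have G: "?G ((v, t), (f, k)) = ((a v + b f, a' t + b' k), (c v + adjoint a f, c' t + adjoint a' k))" for v t f k
    using bd unfolding block_diagonal_def by blast
  note P = tangent_split_bij[OF A E N xc]
  have Pw: "?P w = (D w, dpi w)" for w by (simp add: tangent_split_def D_def dpi_def)
  have lin: "linear D" "linear dpi" using P(1) by (simp_all add: linear_iff Pw)
  have g: "g w \<bullet> w' = inv b (D w) \<bullet> D w' + inv b' (dpi w) \<bullet> dpi w'" for w w'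
    by (simp add: g_def inner_add_left adjoint_inner[OF lin(1)] adjoint_inner[OF lin(2)])
  have \<beta>: "\<beta> w \<bullet> w' = adjoint a (inv b (D w)) \<bullet> D w' + adjoint a' (inv b' (dpi w)) \<bullet> dpi w'" for w w'
    by (simp add: \<beta>_def inner_add_left adjoint_inner[OF lin(1)] adjoint_inner[OF lin(2)])
  show "g w \<bullet> w' = inv b (D w) \<bullet> D w' + inv b' (dpi w) \<bullet> dpi w'"
    "\<beta> w \<bullet> w' = adjoint a (inv b (D w)) \<bullet> D w' + adjoint a' (inv b' (dpi w)) \<bullet> dpi w'" by (rule g, rule \<beta>)
  have adjP: "adjoint ?P (f, k) = adjoint D f + adjoint dpi k" for f k
  proof (rule vector_eq_rdot[THEN iffD1], rule allI)
    show "adjoint ?P (f, k) \<bullet> z = (adjoint D f + adjoint dpi k) \<bullet> z" for z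
      by (simp add: adjoint_inner[OF P(1)] Pw inner_add_left adjoint_inner[OF lin(1)] adjoint_inner[OF lin(2)])
  qed
  have "metric_and_form (gen_metric J J' x) g \<beta>"
    unfolding metric_and_form_def
  proof (intro conjI allI impI)
    note adj = adjoint_linear[OF lin(1)] adjoint_linear[OF lin(2)] adjoint_linear[OF m.lin(1)] adjoint_linear[OF m'.lin(1)]
    show "linear g"
      unfolding g_def using linear_compose_add[OF linear_compose[OF linear_compose[OF lin(1) m.inv_b(3)] adj(1)]
          linear_compose[OF linear_compose[OF lin(2) m'.inv_b(3)] adj(2)]] by (simp add: o_def)
    show "linear \<beta>"
      unfolding \<beta>_def using linear_compose_add[OF
          linear_compose[OF linear_compose[OF linear_compose[OF lin(1) m.inv_b(3)] adj(3)] adj(1)]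
          linear_compose[OF linear_compose[OF linear_compose[OF lin(2) m'.inv_b(3)] adj(4)] adj(2)]] by (simp add: o_def)
    show "g v \<bullet> w = g w \<bullet> v" for v w unfolding g using m.metric_sym m'.metric_sym by metis
    show "\<beta> v \<bullet> w = - (\<beta> w \<bullet> v)" for v w
      unfolding \<beta> using m.form_skew[of "D v" "D w"] m'.form_skew[of "dpi v" "dpi w"] by simp
    show "g v \<bullet> v > 0" if "v \<noteq> 0" for v
    proof -
      \<comment> \<open>Both terms of the metric are nonnegative; injectivity of
        \<open>tangent_split\<close> ensures that one of them is positive.\<close>
      have "?P v \<noteq> ?P 0" using injD[OF bij_is_inj[OF P(2)]] that by blast
      then have "?P v \<noteq> 0" unfolding linear_0[OF P(1)] .
      then have n: "D v \<noteq> 0 \<or> dpi v \<noteq> 0" unfolding Pw by (auto simp: zero_prod_def)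
      have "inv b (D v) \<bullet> D v \<ge> 0" "inv b' (dpi v) \<bullet> dpi v \<ge> 0"
        using m.metric_pos[of "D v"] m'.metric_pos[of "dpi v"] by (cases "D v = 0"; cases "dpi v = 0"; force)+
      then show ?thesis unfolding g using n m.metric_pos[of "D v"] m'.metric_pos[of "dpi v"] by fastforce
    qed
    have "gen_metric J J' x = gen_metric (lift A E N K) (lift A E N K') x"
      by (simp add: gen_metric_def[abs_def] J)
    then have GJ: "gen_metric J J' x z = inv ?S (?G (?S z))" for z
      using gen_metric_lift[OF A E N xc] by metis
    note S = splitting_isometry[OF A E N xc]
    have "gen_metric J J' x (w, \<xi>) = (w, \<xi>) \<longleftrightarrow> \<xi> = g w + \<beta> w" for w \<xi>
    proof -
      obtain f k where fk: "adjoint (inv ?P) \<xi> = (f, k)" by (cases "adjoint (inv ?P) \<xi>")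
      have Sw: "?S (w, \<xi>) = ((D w, dpi w), (f, k))" by (simp add: splitting_eq[OF A E N xc] fk Pw)
      have "gen_metric J J' x (w, \<xi>) = (w, \<xi>) \<longleftrightarrow> ?G (?S (w, \<xi>)) = ?S (w, \<xi>)"
        unfolding GJ using S(2) by (metis bij_inv_eq_iff)
      also have "\<dots> \<longleftrightarrow> (f = inv b (D w) + adjoint a (inv b (D w)) \<and>
          k = inv b' (dpi w) + adjoint a' (inv b' (dpi w)))"
        unfolding Sw G using m.eigen_iff[of "D w" f] m'.eigen_iff[of "dpi w" k] by auto
      also have "\<dots> \<longleftrightarrow> adjoint (inv ?P) \<xi> = (inv b (D w) + adjoint a (inv b (D w)),
          inv b' (dpi w) + adjoint a' (inv b' (dpi w)))" unfolding fk by simp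
      also have "\<dots> \<longleftrightarrow> \<xi> = adjoint ?P (inv b (D w) + adjoint a (inv b (D w)),
          inv b' (dpi w) + adjoint a' (inv b' (dpi w)))"
        using adjoint_bij[OF P] by (metis bij_inv_eq_iff)
      also have "\<dots> \<longleftrightarrow> \<xi> = g w + \<beta> w"
        unfolding adjP g_def \<beta>_def
        by (simp add: linear_add[OF adj(1)] linear_add[OF adj(2)] algebra_simps)
      finally show ?thesis .
    qed
    then show "{x'. gen_metric J J' x x' = x'} = range (\<lambda>v. (v, g v + \<beta> v))" by auto
  qed
  then show "metric_of J J' x = g" "form_of J J' x = \<beta>" by (rule metric_form_of_eqI)+
qed

lemma split_vert_hlift:
  assumes xc: "x \<in> carrier_of (total_space A E)"
  shows "vproj A E N x (vert A E x u) = u" "dproj A E x (vert A E x u) = 0"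
    "vproj A E N x (hlift A E N x t) = 0" "dproj A E x (hlift A E N x t) = t"
proof -
  have "tangent_split A E N x (hlift A E N x t) = (0, t)"
    unfolding hlift_eq[OF A E N xc] using tangent_split_bij(2)[OF A E N xc] by (simp add: bij_is_surj surj_f_inv_f)
  then show "vproj A E N x (vert A E x u) = u" "dproj A E x (vert A E x u) = 0"
    "vproj A E N x (hlift A E N x t) = 0" "dproj A E x (hlift A E N x t) = t"
    using tangent_split_vert[OF A E N xc, of u] by (simp_all add: tangent_split_def)
qed

end

section \<open>Frames and fibre coordinates\<close>

lemma differentiable_prod:
  fixes f :: "'i \<Rightarrow> 'a::real_normed_vector \<Rightarrow> real"
  assumes "\<And>i. i \<in> I \<Longrightarrow> f i differentiable (at x)"
  shows "(\<lambda>x. \<Prod>i\<in>I. f i x) differentiable (at x)"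
  using assms by (induction I rule: infinite_finite_induct) auto

lemma det_differentiable:
  fixes M :: "'a::real_normed_vector \<Rightarrow> real ^ 'n ^ 'n"
  assumes "\<And>i j. (\<lambda>x. M x $ i $ j) differentiable (at x)"
  shows "(\<lambda>x. det (M x)) differentiable (at x)"
  unfolding det_def
  by (rule differentiable_sum) (auto intro!: differentiable_mult differentiable_prod assms)

text \<open>By Cramer's rule the components of \<open>y\<close> are quotients of determinants, which
  are polynomials in the coefficients. The formula has to represent \<open>y\<close> on a whole
  neighbourhood, hence the open set \<open>S\<close>.\<close>

lemma solution_differentiable:
  fixes M :: "'a::real_normed_vector \<Rightarrow> real ^ 'n ^ 'n" and c y :: "'a \<Rightarrow> real ^ 'n"
  assumes M: "\<And>i j. (\<lambda>x. M x $ i $ j) differentiable (at x)"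
    and c: "\<And>i. (\<lambda>x. c x $ i) differentiable (at x)"
    and S: "open S" "x \<in> S" and det: "\<And>x. x \<in> S \<Longrightarrow> det (M x) \<noteq> 0"
    and eq: "\<And>x. x \<in> S \<Longrightarrow> M x *v y x = c x"
  shows "y differentiable (at x)"
proof -
  let ?M = "\<lambda>k x. \<chi> i j. if j = k then c x $ i else M x $ i $ j"
  let ?y = "\<lambda>x. \<Sum>k\<in>UNIV. (det (?M k x) / det (M x)) *\<^sub>R (axis k 1 :: real ^ 'n)"
  have 1: "(\<lambda>x. det (?M k x)) differentiable (at x)" for k
  proof (rule det_differentiable)
    show "(\<lambda>x. ?M k x $ i $ j) differentiable (at x)" for i j
      using M c by (cases "j = k") simp_all
  qed
  have "?y differentiable (at x)"
    by (rule differentiable_sum)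
      (auto intro!: differentiable_scaleR differentiable_divide 1 det_differentiable M det S(2))
  moreover have "?y x = y x" if "x \<in> S" for x
  proof -
    have y: "y x = (\<chi> k. det (?M k x) / det (M x))"
      using cramer[OF det[OF that], of "y x" "c x"] eq[OF that] by simp
    show ?thesis unfolding y by (simp add: vec_eq_iff axis_def if_distrib cong: if_cong)
  qed
  ultimately show ?thesis
    unfolding differentiable_def using has_derivative_transform_within_open[OF _ S] by blast
qed

text \<open>Here \<open>q\<close> maps a space to its dual. Column \<open>c\<close> holds the image
  of \<open>e c\<close>, so the matrix product corresponds to composition and the index order is
  that of \<open>coord_form\<close>.\<close>

definition form_matrix :: "('v::euclidean_space \<Rightarrow> 'v) \<Rightarrow> ('n::finite \<Rightarrow> 'v) \<Rightarrow> real ^ 'n ^ 'n" where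
  "form_matrix q e = (\<chi> a c. q (e c) \<bullet> e a)"

lemma form_matrix_eval:
  assumes "linear q"
  shows "q (\<Sum>c\<in>UNIV. y c *\<^sub>R e c) \<bullet> (\<Sum>a\<in>UNIV. y' a *\<^sub>R e a)
    = (\<Sum>a\<in>UNIV. \<Sum>c\<in>UNIV. form_matrix q e $ a $ c * y' a * y c)"
  by (simp add: form_matrix_def linear_sum[OF assms] linear_scale[OF assms] inner_sum_left inner_sum_right
      sum_distrib_left algebra_simps)

lemma form_matrix_add: "form_matrix (\<lambda>v. q v + r v) e = form_matrix q e + form_matrix r e"
  by (simp add: form_matrix_def vec_eq_iff inner_add_left)

lemma form_matrix_diff: "form_matrix (\<lambda>v. q v - r v) e = form_matrix q e - form_matrix r e"
  by (simp add: form_matrix_def vec_eq_iff inner_diff_left)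

lemma form_matrix_minus: "form_matrix (\<lambda>v. - q v) e = - form_matrix q e"
  by (simp add: form_matrix_def vec_eq_iff)

text \<open>The middle map starts on the dual space and is taken in the dual frame, so the
  expansions in the two dual frames collapse the sums over intermediate indices.\<close>

lemma form_matrix_product:
  assumes lin: "linear q" "linear r" and e: "\<And>v. v = (\<Sum>c\<in>UNIV. (v \<bullet> f c) *\<^sub>R e c)"
    "\<And>v. v = (\<Sum>c\<in>UNIV. (v \<bullet> e c) *\<^sub>R f c)"
  shows "form_matrix q e ** form_matrix r f ** form_matrix s e = form_matrix (\<lambda>v. q (r (s v))) e"
proof -
  have 1: "(\<Sum>c\<in>UNIV. (q (e c) \<bullet> x) * (v \<bullet> f c)) = q v \<bullet> x" for v x
    by (subst (2) e(1)[of v]) (simp add: linear_sum[OF lin(1)] linear_scale[OF lin(1)] inner_sum_left mult.commute)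
  have 2: "(\<Sum>c\<in>UNIV. (q (r (f c)) \<bullet> x) * (v \<bullet> e c)) = q (r v) \<bullet> x" for v x
    by (subst (2) e(2)[of v])
      (simp add: linear_sum[OF lin(1)] linear_scale[OF lin(1)] linear_sum[OF lin(2)] linear_scale[OF lin(2)]
        inner_sum_left mult.commute)
  show ?thesis
    by (simp add: vec_eq_iff form_matrix_def matrix_matrix_mult_def 1 2)
qed

section \<open>A frame at a single point, its coordinates and its dual\<close>

context
  fixes e :: "'n::finite \<Rightarrow> 'm \<Rightarrow> real ^ 'n" and p :: 'm
  assumes inj: "inj (\<lambda>a. e a p)" and ind: "independent (range (\<lambda>a. e a p))"
begin

private abbreviation L where "L \<equiv> \<lambda>y :: real ^ 'n. \<Sum>a\<in>UNIV. (y $ a) *\<^sub>R e a p"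

lemma frame_bij: "linear L" "bij L"
proof -
  show lin: "linear L" by (simp add: linear_iff scaleR_left_distrib sum.distrib scaleR_sum_right)
  have "y = 0" if "L y = 0" for y
  proof -
    let ?u = "\<lambda>x. y $ (inv (\<lambda>a. e a p) x)"
    have "(\<Sum>x\<in>range (\<lambda>a. e a p). ?u x *\<^sub>R x) = L y"
      by (simp add: sum.reindex[OF inj] inv_f_f[OF inj])
    then have "?u (e a p) = 0" for a
      using independentD[OF ind finite_imageI[OF finite_class.finite_UNIV] subset_refl, of ?u "e a p"] that by simp
    then have "y $ a = 0" for a using inv_f_f[OF inj, of a] by metis
    then show ?thesis by (simp add: vec_eq_iff)
  qed
  then have "inj L" using lin by (simp add: linear_injective_0)
  then show "bij L" using lin linear_injective_imp_surjective by (auto simp: bij_def)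
qed

lemma fibre_coord_frame: "(\<Sum>a\<in>UNIV. (fibre_coord e (p, v) $ a) *\<^sub>R e a p) = v"
  and fibre_coord_eqI: "v = (\<Sum>a\<in>UNIV. (y $ a) *\<^sub>R e a p) \<Longrightarrow> fibre_coord e (p, v) = y"
proof -
  have eq: "fibre_coord e (p, v) = y" if "v = L y" for v y
    unfolding fibre_coord_def fst_conv snd_conv
  proof (rule the_equality)
    show "v = L y" by (rule that)
    show "y' = y" if "v = L y'" for y'
      using injD[OF bij_is_inj[OF frame_bij(2)], of y' y] that \<open>v = L y\<close> by simp
  qed
  then show "v = L y \<Longrightarrow> fibre_coord e (p, v) = y" .
  have "v = L (inv L v)" by (rule surj_f_inv_f[OF bij_is_surj[OF frame_bij(2)], symmetric])
  from eq[OF this] this show "L (fibre_coord e (p, v)) = v" by simp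
qed

text \<open>The coordinate functionals of the frame, that is the images of the unit vectors under
  the transpose of \<open>inv L\<close>, solve the equations defining \<open>dual_frame\<close>.
  Biorthogonality then yields both expansions, and coordinates in the dual frame are pairings with
  the frame.\<close>

lemma dual_frame_expand: "v = (\<Sum>c\<in>UNIV. (v \<bullet> dual_frame e c p) *\<^sub>R e c p)"
    "v = (\<Sum>c\<in>UNIV. (v \<bullet> e c p) *\<^sub>R dual_frame e c p)"
  and fibre_coord_dual_frame: "fibre_coord (dual_frame e) (p, v) = (\<chi> a. v \<bullet> e a p)"
proof -
  have ext: "f = f'" if "\<And>c. f \<bullet> e c p = f' \<bullet> e c p" for f f'
  proof -
    have "f \<bullet> v = f' \<bullet> v" for v
      by (subst (1 2) fibre_coord_frame[of v, symmetric]) (simp add: inner_sum_right that)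
    then show ?thesis using vector_eq_rdot by blast
  qed
  have Le: "L (axis c 1) = e c p" for c
    by (simp add: axis_def if_distrib[of "\<lambda>x. x *\<^sub>R _"] cong: if_cong)
  have inv: "inv L (e c p) = axis c 1" for c
    using inv_f_f[OF bij_is_inj[OF frame_bij(2)], of "axis c 1"] unfolding Le .
  have d: "dual_frame e a p \<bullet> e c p = (if a = c then 1 else 0)" for a c
  proof -
    let ?P = "\<lambda>f. \<forall>c. f \<bullet> e c p = (if a = c then 1 else 0)"
    have "?P (adjoint (inv L) (axis a 1))"
      by (simp add: adjoint_inner[OF linear_inv_bij[OF frame_bij]] inv inner_axis_axis)
    moreover have "f = adjoint (inv L) (axis a 1)" if "?P f" for f
      by (rule ext) (use that \<open>?P (adjoint (inv L) (axis a 1))\<close> in simp)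
    ultimately have "?P (THE f. ?P f)" by (rule theI)
    then show ?thesis by (simp add: dual_frame_def)
  qed
  have e2: "v = (\<Sum>c\<in>UNIV. (v \<bullet> e c p) *\<^sub>R dual_frame e c p)" for v
    by (rule ext) (simp add: inner_sum_left d if_distrib cong: if_cong)
  show "v = (\<Sum>c\<in>UNIV. (v \<bullet> e c p) *\<^sub>R dual_frame e c p)" by (rule e2)
  have "v \<bullet> dual_frame e a p = fibre_coord e (p, v) $ a" for a
  proof -
    have "L (fibre_coord e (p, v)) \<bullet> dual_frame e a p = fibre_coord e (p, v) $ a"
      by (simp add: inner_sum_left inner_commute[of "e _ p"] d if_distrib cong: if_cong)
    then show ?thesis unfolding fibre_coord_frame .
  qed
  then show "v = (\<Sum>c\<in>UNIV. (v \<bullet> dual_frame e c p) *\<^sub>R e c p)"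
    using fibre_coord_frame[of v] by simp
  show "fibre_coord (dual_frame e) (p, v) = (\<chi> a. v \<bullet> e a p)"
    unfolding fibre_coord_def fst_conv snd_conv
  proof (rule the_equality)
    show "v = (\<Sum>a\<in>UNIV. ((\<chi> a. v \<bullet> e a p) $ a) *\<^sub>R dual_frame e a p)" using e2[of v] by simp
    show "y = (\<chi> a. v \<bullet> e a p)" if "v = (\<Sum>a\<in>UNIV. (y $ a) *\<^sub>R dual_frame e a p)" for y
      by (subst that) (simp add: vec_eq_iff inner_sum_left d if_distrib cong: if_cong)
  qed
qed

end

section \<open>Coordinate expressions for a flat frame\<close>

lemma has_mdiff_vector:
  fixes f :: "'m \<Rightarrow> real ^ 'n"
  assumes A: "smooth_atlas A" and U: "openin (mtop A) U" "p \<in> U"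
    and f: "\<And>a. has_mdiff A (\<lambda>q. f q $ a) p (D a)"
  shows "has_mdiff A f p (\<lambda>w. \<chi> a. D a w)"
proof -
  have sum: "(\<Sum>a\<in>UNIV. (g a) *\<^sub>R (axis a 1 :: real ^ 'n)) = (\<chi> a. g a)" for g
    by (simp add: vec_eq_iff axis_def if_distrib cong: if_cong)
  have "has_mdiff A (\<lambda>q. \<Sum>a\<in>UNIV. (f q $ a) *\<^sub>R (axis a 1 :: real ^ 'n)) p
      (\<lambda>w. \<Sum>a\<in>UNIV. D a w *\<^sub>R axis a 1)"
    by (rule has_mdiff_sum, rule has_mdiff_bounded_linear[OF bounded_linear_scaleR_left f])
  then show ?thesis unfolding sum by simp
qed

context
  fixes A :: "('m, 'b::euclidean_space) atlas" and E :: "('m, 'v::euclidean_space) vbundle"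
    and N :: "('m, 'b, 'v) conn"
  assumes A: "smooth_atlas A" and E: "vector_bundle A E" and N: "connection A E N"
begin

private lemmas dE' = vector_bundle_dual[OF A E]
private abbreviation Xh where "Xh \<equiv> total_space A (dual_bundle E)"
private lemmas XhA = smooth_atlas_total_space[OF A dE']

text \<open>For the sections of a frame these functions are the dual fibre coordinates, so their
  differentials become available without discussing the dual frame as a family of sections.\<close>

lemma dual_pairing_smooth:
  assumes U: "openin (mtop A) U" and s: "smooth_section A U E s"
  shows "smooth_fun Xh (U \<times> UNIV) (\<lambda>z. snd z \<bullet> s (fst z))"
proof (rule smooth_fun_local[OF XhA])
  fix x assume x: "x \<in> U \<times> (UNIV :: 'v set)"
  then have "fst x \<in> carrier_of A" using openin_mtop_subset[OF A U] by auto
  then obtain U' \<Phi> where c: "(U', \<Phi>) \<in> E" "fst x \<in> U'" using vector_bundle_cover[OF E] by blast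
  let ?W = "(U \<inter> U') \<times> (UNIV :: 'v set)"
  have o: "openin (mtop A) (U \<inter> U')" using U vector_bundle_triv(1)[OF E c(1)] by blast
  note oX = openin_total_space[OF A dE' o]
  have "(U', \<lambda>p. inv (adjoint (\<Phi> p))) \<in> dual_bundle E"
    unfolding dual_bundle_def by (rule image_eqI[OF _ c(1)]) simp
  from smooth_fun_triv_snd[OF A dE' this]
  have 1: "smooth_fun Xh ?W (\<lambda>z. inv (adjoint (\<Phi> (fst z))) (snd z))" by (rule smooth_fun_subset) blast
  have "smooth_fun Xh ?W (\<lambda>z. snd z \<bullet> s (fst z))"
    by (rule smooth_fun_cong[OF XhA oX _ smooth_fun_bilinear[OF XhA oX bounded_bilinear_inner 1
            smooth_fun_pullback[OF A dE' o smooth_sectionD[OF s c(1)]]]])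
      (use triv_inner(1)[OF A E c(1)] in auto)
  then show "\<exists>W. openin (mtop Xh) W \<and> x \<in> W \<and> smooth_fun Xh W (\<lambda>z. snd z \<bullet> s (fst z))"
    using oX x c(2) by (intro exI[of _ ?W]) auto
qed

text \<open>The product rule for the pulled back dual connection, with the tautological section
  paired with a pulled back section. For parallel \<open>s\<close> the last term drops out, so the
  components of the dual vertical projection are differentials of pairings.\<close>

lemma vproj_dual_inner:
  assumes U: "openin (mtop A) U" "fst z \<in> U" and s: "smooth_section A U E s"
  shows "vproj A (dual_bundle E) (dual_connection A E N) z w \<bullet> s (fst z)
    = mdiff Xh (\<lambda>z. snd z \<bullet> s (fst z)) z w - snd z \<bullet> N s (fst z) (dproj A (dual_bundle E) z w)"
proof -
  define p where "p = fst z"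
  have pU: "p \<in> U" using U(2) by (simp add: p_def)
  have p: "p \<in> carrier_of A" using openin_mtop_subset[OF A U(1)] pU by blast
  have zc: "z \<in> carrier_of Xh" using p by (simp add: carrier_total_space[OF A dE'] mem_Times_iff p_def)
  obtain U' \<Phi> where c: "(U', \<Phi>) \<in> E" "p \<in> U'" using vector_bundle_cover[OF E p] .
  let ?F = "\<lambda>p. inv (adjoint (\<Phi> p))"
  let ?e = "\<lambda>b q. inv (?F q) b"
  let ?t = "dproj A (dual_bundle E) z"
  let ?N = "dual_connection A E N"
  have c': "(U', ?F) \<in> dual_bundle E"
    unfolding dual_bundle_def by (rule image_eqI[OF _ c(1)]) simp
  note U' = vector_bundle_triv(1)[OF E c(1)]
  have o: "openin (mtop A) (U \<inter> U')" using U U' by blast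
  have zU: "z \<in> U' \<times> UNIV" "z \<in> (U \<inter> U') \<times> UNIV" using c(2) pU by (simp_all add: mem_Times_iff p_def)
  let ?y = "\<lambda>b z. ?F (fst z) (snd z) \<bullet> b"
  let ?dy = "\<lambda>b w. mdiff Xh (\<lambda>z. ?F (fst z) (snd z)) z w \<bullet> b"
  have dy: "has_mdiff Xh (?y b) z (?dy b)" for b
    by (rule has_mdiff_bounded_linear[OF bounded_linear_inner_left
          smooth_fun_has_mdiff[OF XhA openin_total_space[OF A dE' U'] zU(1) smooth_fun_triv_snd[OF A dE' c']]])
  have expand: "snd z = (\<Sum>b\<in>Basis. ?y b z *\<^sub>R ?e b (fst z))" if "z \<in> U' \<times> UNIV" for z
    using that triv_basis_expansion[OF A dE' c', of "fst z"] vector_bundle_inv(1)[OF dE' c', of "fst z"] by auto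
  have v: "vproj A (dual_bundle E) ?N z w
    = (\<Sum>b\<in>Basis. ?dy b w *\<^sub>R ?e b (fst z) + ?y b z *\<^sub>R ?N (?e b) (fst z) (?t w))"
    by (rule vproj_expand[OF A dE' connection_dual[OF A E N] U' triv_section[OF dE' c']
          openin_total_space[OF A dE' U'] zU(1) subset_refl dy expand])
  have Ne: "?N (?e b) (fst z) (?t w) \<bullet> s (fst z)
      = mdiff A (\<lambda>q. ?e b q \<bullet> s q) p (?t w) - ?e b p \<bullet> N s p (?t w)" for b
    unfolding p_def[symmetric]
    by (rule dual_connection_inner[OF A E N U' c(2) triv_section[OF dE' c'] U(1) pU s])
  have "smooth_fun A (U \<inter> U') (\<lambda>q. ?e b q \<bullet> s q)" for b
    by (rule section_inner_smooth[OF A E o smooth_section_subset[OF s] smooth_section_subset[OF triv_section[OF dE' c']]]) blast+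
  from smooth_fun_has_mdiff[OF A o _ this]
  have ds: "has_mdiff A (\<lambda>q. ?e b q \<bullet> s q) (fst z) (mdiff A (\<lambda>q. ?e b q \<bullet> s q) p)" for b
    using pU c(2) by (simp add: p_def)
  have "has_mdiff Xh (\<lambda>z. \<Sum>b\<in>Basis. ?y b z * (?e b (fst z) \<bullet> s (fst z))) z
      (\<lambda>w. \<Sum>b\<in>Basis. ?y b z * mdiff A (\<lambda>q. ?e b q \<bullet> s q) p (?t w) + ?dy b w * (?e b (fst z) \<bullet> s (fst z)))"
    by (rule has_mdiff_sum, rule has_mdiff_bilinear[OF XhA zc bounded_bilinear_mult dy
          has_mdiff_dproj[OF A dE' p[unfolded p_def] ds]])
  then have "has_mdiff Xh (\<lambda>z. snd z \<bullet> s (fst z)) z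
      (\<lambda>w. \<Sum>b\<in>Basis. ?y b z * mdiff A (\<lambda>q. ?e b q \<bullet> s q) p (?t w) + ?dy b w * (?e b (fst z) \<bullet> s (fst z)))"
  proof (rule has_mdiff_cong[OF XhA openin_total_space[OF A dE' U'] zU(1), rotated])
    show "(\<Sum>b\<in>Basis. ?y b z * (?e b (fst z) \<bullet> s (fst z))) = snd z \<bullet> s (fst z)" if "z \<in> U' \<times> UNIV" for z
      using arg_cong[OF expand[OF that], of "\<lambda>v. v \<bullet> s (fst z)"] by (simp add: inner_sum_left)
  qed
  from mdiff_eqI[OF this]
  have d: "mdiff Xh (\<lambda>z. snd z \<bullet> s (fst z)) z w
      = (\<Sum>b\<in>Basis. ?y b z * mdiff A (\<lambda>q. ?e b q \<bullet> s q) p (?t w) + ?dy b w * (?e b (fst z) \<bullet> s (fst z)))"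
    by metis
  have f: "snd z \<bullet> N s p (?t w) = (\<Sum>b\<in>Basis. ?y b z * (?e b p \<bullet> N s p (?t w)))"
    using arg_cong[OF expand[OF zU(1)], of "\<lambda>v. v \<bullet> N s p (?t w)"] by (simp add: inner_sum_left p_def)
  show ?thesis
    unfolding d v p_def[symmetric] f
    unfolding inner_sum_left inner_add_left inner_scaleR_left Ne[unfolded p_def[symmetric]] sum_subtractf[symmetric]
    by (rule sum.cong[OF refl]) (simp add: algebra_simps)
qed

end

context
  fixes A :: "('m, 'b::euclidean_space) atlas" and E :: "('m, real ^ 'n) vbundle"
    and N :: "('m, 'b, real ^ 'n) conn" and U :: "'m set" and e :: "'n \<Rightarrow> 'm \<Rightarrow> real ^ 'n"
  assumes A: "smooth_atlas A" and E: "vector_bundle A E" and N: "connection A E N"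
    and U: "openin (mtop A) U" and e: "local_frame A U E e"
    and flat: "\<And>a p w. p \<in> U \<Longrightarrow> N (e a) p w = 0"
begin

lemma frame_section: "smooth_section A U E (e a)"
  using e by (simp add: local_frame_def)

lemma frame_at:
  assumes "p \<in> U" shows "inj (\<lambda>a. e a p)" "independent (range (\<lambda>a. e a p))"
  using e assms by (simp_all add: local_frame_def)

lemma frame_expansions:
  assumes "p \<in> U"
  shows "bij (\<lambda>y :: real ^ 'n. \<Sum>a\<in>UNIV. (y $ a) *\<^sub>R e a p)"
    "(\<Sum>a\<in>UNIV. (fibre_coord e (p, v) $ a) *\<^sub>R e a p) = v"
    "fibre_coord (dual_frame e) (p, v) = (\<chi> a. v \<bullet> e a p)"
    "v = (\<Sum>c\<in>UNIV. (v \<bullet> dual_frame e c p) *\<^sub>R e c p)"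
    "v = (\<Sum>c\<in>UNIV. (v \<bullet> e c p) *\<^sub>R dual_frame e c p)"
  by (rule frame_bij(2)[where e = e and p = p] fibre_coord_frame[where e = e and p = p]
      fibre_coord_dual_frame[where e = e and p = p] dual_frame_expand(1)[where e = e and p = p]
      dual_frame_expand(2)[where e = e and p = p];
      rule frame_at[OF assms])+

text \<open>Locally the fibre coordinates solve a linear system whose matrix is the frame written in
  a trivialisation and whose right hand side is the trivialised fibre component, so Cramer's rule
  applies.\<close>

lemma fibre_coord_has_mdiff:
  assumes z: "fst z \<in> U"
  shows "has_mdiff (total_space A E) (fibre_coord e) z (mdiff (total_space A E) (fibre_coord e) z)"
proof -
  define p where "p = fst z"
  have p: "p \<in> carrier_of A" using openin_mtop_subset[OF A U] z by (auto simp: p_def)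
  have zc: "z \<in> carrier_of (total_space A E)" using p by (simp add: carrier_total_space[OF A E] mem_Times_iff p_def)
  obtain U' \<Phi> where c: "(U', \<Phi>) \<in> E" "p \<in> U'" using vector_bundle_cover[OF E p] .
  note U' = vector_bundle_triv(1)[OF E c(1)]
  have o: "openin (mtop A) (U \<inter> U')" using U U' by blast
  let ?W = "(U \<inter> U') \<times> (UNIV :: (real ^ 'n) set)"
  note oX = openin_total_space[OF A E o]
  have zW: "z \<in> ?W" using z c(2) by (simp add: mem_Times_iff p_def)
  obtain D f where ca: "chart_at (total_space A E) z = (D, f)" using surj_pair[of "chart_at (total_space A E) z"] by blast
  note ca' = chart_at[OF zc ca]
  let ?i = "inv_into D f"
  have i: "?i (f x) = x" if "x \<in> D" for x using that smooth_atlas_chart(1)[OF smooth_atlas_total_space[OF A E] ca'(1)] by simp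
  let ?S = "f ` (?W \<inter> D)"
  have S: "open ?S" "f z \<in> ?S" using openin_mtop_image[OF smooth_atlas_total_space[OF A E] ca'(1) oX] zW ca'(2) by auto
  let ?M = "\<lambda>u. \<chi> k a. \<Phi> (fst (?i u)) (e a (fst (?i u))) $ k"
  let ?c = "\<lambda>u. \<Phi> (fst (?i u)) (snd (?i u))"
  have 1: "smooth_fun (total_space A E) ?W (\<lambda>z. \<Phi> (fst z) (e a (fst z)))" for a
    by (rule smooth_fun_pullback[OF A E o smooth_sectionD[OF frame_section c(1)]])
  have 2: "smooth_fun (total_space A E) ?W (\<lambda>z. \<Phi> (fst z) (snd z))"
    by (rule smooth_fun_subset[OF smooth_fun_triv_snd[OF A E c(1)]]) blast
  have nth: "(\<lambda>u. g (?i u) $ k) differentiable (at (f z))" if "smooth_fun (total_space A E) ?W g" for g :: "_ \<Rightarrow> real ^ 'n" and k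
  proof -
    have "((g \<circ> ?i) has_derivative frechet_derivative (g \<circ> ?i) (at (f z))) (at (f z))"
      by (rule smooth_on_has_derivative[OF smooth_funD[OF that ca'(1)] S(2)])
    from bounded_linear.has_derivative[OF bounded_linear_vec_nth this]
    show ?thesis by (auto simp: differentiable_def o_def)
  qed
  \<comment> \<open>The matrix is the frame map followed by the trivialisation. As a composite of
    two bijections it is invertible, which is used for the determinant below.\<close>
  have Mv: "?M u *v y = \<Phi> q (\<Sum>a\<in>UNIV. (y $ a) *\<^sub>R e a q)" if "u \<in> ?S" "q = fst (?i u)" for u y q
  proof -
    have "q \<in> U'" using that i by auto
    note lin = vector_bundle_triv(2)[OF E c(1) this]
    show ?thesis
      unfolding matrix_mult_sum linear_sum[OF lin] linear_scale[OF lin] that(2)[symmetric]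
      by (simp add: vec_eq_iff column_def)
  qed
  have "(fibre_coord e \<circ> ?i) differentiable (at (f z))"
  proof (rule solution_differentiable[of ?M _ ?c, OF _ _ S])
    show "(\<lambda>u. ?M u $ k $ a) differentiable (at (f z))" for k a using nth[OF 1] by simp
    show "(\<lambda>u. ?c u $ k) differentiable (at (f z))" for k using nth[OF 2] .
    fix u assume u: "u \<in> ?S"
    have q: "fst (?i u) \<in> U" "fst (?i u) \<in> U'" using u i by auto
    show "?M u *v (fibre_coord e \<circ> ?i) u = ?c u"
      using frame_expansions(2)[OF q(1), of "snd (?i u)"] by (simp add: Mv[OF u refl])
    have "inj ((*v) (?M u))"
    proof (rule injI)
      fix y y' assume "?M u *v y = ?M u *v y'"
      then show "y = y'"
        unfolding Mv[OF u refl]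
        using injD[OF bij_is_inj[OF vector_bundle_triv(3)[OF E c(1) q(2)]]]
          injD[OF bij_is_inj[OF frame_expansions(1)[OF q(1)]]] by blast
    qed
    then show "det (?M u) \<noteq> 0"
      using matrix_left_invertible_injective[of "?M u"] invertible_left_inverse[of "?M u"]
        invertible_det_nz[of "?M u"] by blast
  qed
  then show ?thesis
    unfolding has_mdiff_def mdiff_def ca prod.case by (simp add: frechet_derivative_works)
qed

text \<open>The coefficients of the tautological section in the frame are the fibre coordinates, and
  the covariant derivatives of the frame vanish.\<close>

lemma vproj_flat_frame:
  assumes z: "fst z \<in> U"
  shows "vproj A E N z w = (\<Sum>a\<in>UNIV. (mdiff (total_space A E) (fibre_coord e) z w $ a) *\<^sub>R e a (fst z))"
proof -
  have zU: "z \<in> U \<times> UNIV" using z by (simp add: mem_Times_iff)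
  have "vproj A E N z w = (\<Sum>a\<in>UNIV. (mdiff (total_space A E) (fibre_coord e) z w $ a) *\<^sub>R e a (fst z)
      + (fibre_coord e z $ a) *\<^sub>R N (e a) (fst z) (dproj A E z w))"
  proof (rule vproj_expand[OF A E N U frame_section openin_total_space[OF A E U] zU subset_refl,
        where y = "\<lambda>a z. fibre_coord e z $ a" and dy = "\<lambda>a w. mdiff (total_space A E) (fibre_coord e) z w $ a"])
    show "has_mdiff (total_space A E) (\<lambda>z. fibre_coord e z $ a) z (\<lambda>w. mdiff (total_space A E) (fibre_coord e) z w $ a)" for a
      by (rule has_mdiff_bounded_linear[OF bounded_linear_vec_nth fibre_coord_has_mdiff[OF z]])
    show "snd y = (\<Sum>a\<in>UNIV. (fibre_coord e y $ a) *\<^sub>R e a (fst y))" if "y \<in> U \<times> UNIV" for y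
      using that frame_expansions(2)[of "fst y" "snd y"] by auto
  qed
  then show ?thesis by (simp add: flat[OF z])
qed

text \<open>The components in the dual frame are pairings with \<open>e a\<close>, and
  \<open>vproj_dual_inner\<close> identifies these with the differentials of the dual fibre
  coordinates.\<close>

lemma vproj_dual_flat_frame:
  assumes z: "fst z \<in> U"
  shows "vproj A (dual_bundle E) (dual_connection A E N) z w
    = (\<Sum>a\<in>UNIV. (mdiff (total_space A (dual_bundle E)) (fibre_coord (dual_frame e)) z w $ a) *\<^sub>R dual_frame e a (fst z))"
proof -
  let ?v = "vproj A (dual_bundle E) (dual_connection A E N) z w"
  have zU: "z \<in> U \<times> UNIV" using z by (simp add: mem_Times_iff)
  note oU = openin_total_space[OF A vector_bundle_dual[OF A E] U]
  let ?d = "\<lambda>a. mdiff (total_space A (dual_bundle E)) (\<lambda>z. snd z \<bullet> e a (fst z)) z"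
  have "has_mdiff (total_space A (dual_bundle E)) (\<lambda>z. (\<chi> a. snd z \<bullet> e a (fst z)) $ a) z (?d a)" for a
    using smooth_fun_has_mdiff[OF smooth_atlas_total_space[OF A vector_bundle_dual[OF A E]] oU zU dual_pairing_smooth[OF A E N U frame_section]] by simp
  from has_mdiff_vector[OF smooth_atlas_total_space[OF A vector_bundle_dual[OF A E]] oU zU this]
  have "has_mdiff (total_space A (dual_bundle E)) (fibre_coord (dual_frame e)) z (\<lambda>w. \<chi> a. ?d a w)"
  proof (rule has_mdiff_cong[OF smooth_atlas_total_space[OF A vector_bundle_dual[OF A E]] oU zU, rotated])
    show "(\<chi> a. snd y \<bullet> e a (fst y)) = fibre_coord (dual_frame e) y" if "y \<in> U \<times> UNIV" for y
      using that frame_expansions(3)[of "fst y" "snd y"] by auto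
  qed
  from mdiff_eqI[OF this]
  have "mdiff (total_space A (dual_bundle E)) (fibre_coord (dual_frame e)) z w $ a = ?v \<bullet> e a (fst z)" for a
    using vproj_dual_inner[OF A E N U z frame_section, of w a] by (simp add: flat[OF z])
  then show ?thesis using frame_expansions(5)[OF z, of ?v] by simp
qed

end

text \<open>The coefficients are those of \<open>q\<close> and \<open>r\<close> in the frame and the
  coordinate vectors at the base point, so they depend on x alone. Hypothesis \<open>D\<close> says
  that the differentials of the fibre coordinates are the components of the vertical
  projection.\<close>

lemma coord_form_eq:
  fixes \<xi> :: "'m \<Rightarrow> real ^ 'n" and e :: "'r::finite \<Rightarrow> 'm \<Rightarrow> 'v::euclidean_space"
    and A :: "('m, real ^ 'n) atlas"
  assumes A: "smooth_atlas A" and E: "vector_bundle A E" and c: "smooth_chart A (U, \<xi>)" and z: "fst z \<in> U"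
    and D: "\<And>w. D w = (\<Sum>a\<in>UNIV. (mdiff (total_space A E) (fibre_coord e) z w $ a) *\<^sub>R e a (fst z))"
    and lin: "linear q" "linear r"
    and P: "P (\<xi> (fst z)) = form_matrix r (\<lambda>i. inv (mdiff A \<xi> (fst z)) (axis i 1))"
    and Q: "Q (\<xi> (fst z)) = form_matrix q (\<lambda>a. e a (fst z))"
  shows "coord_form A E \<xi> e P Q z w w'
    = q (D w) \<bullet> D w' + r (dproj A E z w) \<bullet> dproj A E z w'"
proof -
  let ?R = "mdiff A \<xi> (fst z)"
  let ?dx = "mdiff (total_space A E) (\<xi> \<circ> fst) z"
  note R = mdiff_chart_bij[OF A c z]
  have dx: "?dx w = ?R (dproj A E z w)" for w
    using mdiff_dproj[OF A E smooth_chart_properties(1)[OF A c] z smooth_chart_properties(3)[OF A c]]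
    by (simp add: o_def)
  \<comment> \<open>The vectors \<open>inv ?R (axis i 1)\<close> are the coordinate vectors of the
    chart, and \<open>?dx w\<close> holds the components of d\<pi> w in them.\<close>
  have dp: "dproj A E z w = (\<Sum>i\<in>UNIV. (?dx w $ i) *\<^sub>R inv ?R (axis i 1))" for w
  proof -
    note li = linear_inv_bij[OF R]
    have "?dx w = (\<Sum>i\<in>UNIV. (?dx w $ i) *\<^sub>R axis i 1)"
      using basis_expansion[of "?dx w"] by (simp add: scalar_mult_eq_scaleR)
    from arg_cong[OF this, of "inv ?R"]
    have "inv ?R (?dx w) = (\<Sum>i\<in>UNIV. (?dx w $ i) *\<^sub>R inv ?R (axis i 1))"
      unfolding linear_sum[OF li] linear_scale[OF li] .
    then show ?thesis using R(2) by (simp add: dx bij_is_inj)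
  qed
  have "r (dproj A E z w) \<bullet> dproj A E z w'
    = (\<Sum>i\<in>UNIV. \<Sum>j\<in>UNIV. P (\<xi> (fst z)) $ i $ j * (?dx w' $ i) * (?dx w $ j))"
    unfolding P dp[of w] dp[of w'] by (rule form_matrix_eval[OF lin(2)])
  moreover have "q (D w) \<bullet> D w' = (\<Sum>a\<in>UNIV. \<Sum>c\<in>UNIV. Q (\<xi> (fst z)) $ a $ c
      * (mdiff (total_space A E) (fibre_coord e) z w' $ a) * (mdiff (total_space A E) (fibre_coord e) z w $ c))"
    unfolding Q D[of w] D[of w'] by (rule form_matrix_eval[OF lin(1)])
  ultimately show ?thesis unfolding coord_form_def Let_def by simp
qed

text \<open>Maps between a space and its dual compose to products of matrices taken alternately in a
  frame and its dual frame, so the operator identities \<open>buscher\<close> turn into matrix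
  identities.\<close>

lemma form_matrix_buscher:
  fixes e :: "'n::finite \<Rightarrow> 'v::euclidean_space"
  assumes bm: "block_metric a b c" and ef: "\<And>v. v = (\<Sum>c\<in>UNIV. (v \<bullet> f c) *\<^sub>R e c)"
    "\<And>v. v = (\<Sum>c\<in>UNIV. (v \<bullet> e c) *\<^sub>R f c)"
  defines "h \<equiv> form_matrix (inv b) e" and "B \<equiv> form_matrix (\<lambda>v. adjoint a (inv b v)) e"
    and "hh \<equiv> form_matrix (inv c) f" and "Bh \<equiv> form_matrix (\<lambda>v. a (inv c v)) f"
  shows "(h + B) ** hh ** (h - B) = h" "(h + B) ** Bh ** (h - B) = - B"
proof -
  interpret block_metric a b c by (rule bm)
  have l1: "linear (\<lambda>v. adjoint a (inv b v))"
    using linear_compose[OF inv_b(3) adjoint_linear[OF lin(1)]] by (simp add: o_def)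
  have l2: "linear (\<lambda>v. inv b v + adjoint a (inv b v))" by (rule linear_compose_add[OF inv_b(3) l1])
  have l3: "linear (\<lambda>v. a (inv c v))" using linear_compose[OF inv_c(3) lin(1)] by (simp add: o_def)
  show "(h + B) ** hh ** (h - B) = h" "(h + B) ** Bh ** (h - B) = - B"
    unfolding h_def B_def hh_def Bh_def form_matrix_add[symmetric] form_matrix_diff[symmetric]
      form_matrix_product[OF l2 inv_c(3) ef] form_matrix_product[OF l2 l3 ef] form_matrix_minus[symmetric] buscher
    by (rule refl)+
qed

theorem mainTheorem8:
  fixes A :: "('m, real ^ 'n) atlas"
    and V :: "('m, real ^ 'n) vbundle"
    and N :: "('m, real ^ 'n, real ^ 'n) conn"
    and J J' :: "'m \<times> (real ^ 'n) \<Rightarrow>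
      ((real ^ 'n) \<times> (real ^ 'n)) \<times> ((real ^ 'n) \<times> (real ^ 'n)) \<Rightarrow>
      ((real ^ 'n) \<times> (real ^ 'n)) \<times> ((real ^ 'n) \<times> (real ^ 'n))"
    and K K' :: "'m \<Rightarrow>
      ((real ^ 'n) \<times> (real ^ 'n)) \<times> ((real ^ 'n) \<times> (real ^ 'n)) \<Rightarrow>
      ((real ^ 'n) \<times> (real ^ 'n)) \<times> ((real ^ 'n) \<times> (real ^ 'n))"
  defines "M \<equiv> carrier_of A"
    and "T \<equiv> tangent_bundle A"
    and "X \<equiv> total_space A V"
    and "D \<equiv> vproj A V N"
    and "dpi \<equiv> dproj A V"
    and "Vh \<equiv> dual_bundle V"
    and "Nh \<equiv> dual_connection A V N"
    and "Xh \<equiv> total_space A (dual_bundle V)"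
    and "Dh \<equiv> vproj A (dual_bundle V) (dual_connection A V N)"
    and "dpih \<equiv> dproj A (dual_bundle V)"
    and "Jh \<equiv> mirror A V N K"
    and "Jh' \<equiv> mirror A V N K'"
    and "g \<equiv> metric_of J J'"
    and "b \<equiv> form_of J J'"
    and "gh \<equiv> metric_of (mirror A V N K) (mirror A V N K')"
    and "bh \<equiv> form_of (mirror A V N K) (mirror A V N K')"
  assumes "smooth_manifold A" and "vector_bundle A V" and "connection A V N"
    and "gen_almost_kaehler X J J'"
    and "lifted_from A V N J K" and "adapted A K"
    and "lifted_from A V N J' K'" and "adapted A K'"
  shows
    "gen_almost_kaehler Xh Jh Jh' \<and>
     (\<exists>G11 G14 G21 G24 G31 G34.
        smooth_hom A M V V G11 \<and> smooth_hom A M T T G14 \<and>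
        smooth_hom A M Vh V G21 \<and> smooth_hom A M (dual_bundle T) T G24 \<and>
        smooth_hom A M V Vh G31 \<and> smooth_hom A M T (dual_bundle T) G34 \<and>
        (\<forall>p\<in>M.
           (\<forall>v t f k. gen_metric K K' p ((v, t), (f, k)) =
              ((G11 p v + G21 p f, G14 p t + G24 p k),
               (G31 p v + adjoint (G11 p) f, G34 p t + adjoint (G14 p) k))) \<and>
           adjoint (G21 p) = G21 p \<and> adjoint (G24 p) = G24 p \<and>
           adjoint (G31 p) = G31 p \<and> adjoint (G34 p) = G34 p \<and>
           (\<forall>f t v k. gen_metric (mirror_base K) (mirror_base K') p ((f, t), (v, k)) =
              ((adjoint (G11 p) f + G31 p v, G14 p t + G24 p k),
               (G21 p f + G11 p v, G34 p t + adjoint (G14 p) k))) \<and>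
           bij (G21 p) \<and> bij (G24 p) \<and> bij (G31 p)) \<and>
        (\<forall>z\<in>carrier_of X. \<forall>w.
           g z w = adjoint (D z) (inv (G21 (fst z)) (D z w))
                 + adjoint (dpi z) (inv (G24 (fst z)) (dpi z w)) \<and>
           b z w = adjoint (D z) (adjoint (G11 (fst z)) (inv (G21 (fst z)) (D z w)))
                 + adjoint (dpi z) (adjoint (G14 (fst z)) (inv (G24 (fst z)) (dpi z w)))) \<and>
        (\<forall>z\<in>carrier_of Xh. \<forall>w.
           gh z w = adjoint (Dh z) (inv (G31 (fst z)) (Dh z w))
                  + adjoint (dpih z) (inv (G24 (fst z)) (dpih z w)) \<and>
           bh z w = adjoint (Dh z) (G11 (fst z) (inv (G31 (fst z)) (Dh z w)))
                  + adjoint (dpih z) (adjoint (G14 (fst z)) (inv (G24 (fst z)) (dpih z w)))) \<and>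
        (\<forall>p\<in>M. \<forall>u.
           (let h = inv (G21 p); \<beta> = (\<lambda>v. adjoint (G11 p) (inv (G21 p) v));
                hh = inv (G31 p); \<beta>h = (\<lambda>f. G11 p (inv (G31 p) f))
            in h (hh (h u - \<beta> u)) + \<beta> (hh (h u - \<beta> u)) = h u \<and>
               h (\<beta>h (h u - \<beta> u)) + \<beta> (\<beta>h (h u - \<beta> u)) = - \<beta> u))) \<and>
     (\<forall>z\<in>carrier_of X. \<forall>u t.
        g z (vert A V z u) \<bullet> hlift A V N z t = 0 \<and> b z (vert A V z u) \<bullet> hlift A V N z t = 0) \<and>
     (flat_connection A V N \<longrightarrow>
        (\<forall>U \<xi> (e :: 'n \<Rightarrow> 'm \<Rightarrow> real ^ 'n).
           smooth_chart A (U, \<xi>) \<and> local_frame A U V e \<and> (\<forall>a. \<forall>p\<in>U. \<forall>w. N (e a) p w = 0) \<longrightarrow>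
           (\<exists>(gm :: real ^ 'n \<Rightarrow> real ^ 'n ^ 'n) bm
             (h :: real ^ 'n \<Rightarrow> real ^ 'n ^ 'n) B
             (hh :: real ^ 'n \<Rightarrow> real ^ 'n ^ 'n) Bh.
              (\<forall>z\<in>U \<times> UNIV. \<forall>w w'.
                 g z w \<bullet> w' = coord_form A V \<xi> e gm h z w w' \<and>
                 b z w \<bullet> w' = coord_form A V \<xi> e bm B z w w' \<and>
                 gh z w \<bullet> w' = coord_form A Vh \<xi> (dual_frame e) gm hh z w w' \<and>
                 bh z w \<bullet> w' = coord_form A Vh \<xi> (dual_frame e) bm Bh z w w') \<and>
              (\<forall>x\<in>\<xi> ` U.
                 (h x + B x) ** hh x ** (h x - B x) = h x \<and>
                 (h x + B x) ** Bh x ** (h x - B x) = - B x))))"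
proof -
  have A: "smooth_atlas A" using assms(17) by (simp add: smooth_manifold_def)
  note V = assms(18) and N = assms(19)
  note dV = vector_bundle_dual[OF A V] and dN = connection_dual[OF A V N] and T' = vector_bundle_tangent[OF A]
  note Mo = openin_mtop_carrier[OF A]
  have gK: "gen_almost_complex A (sum_bundle V (tangent_bundle A)) K"
    "gen_almost_complex A (sum_bundle V (tangent_bundle A)) K'"
    and J: "\<And>x. x \<in> carrier_of X \<Longrightarrow> J x = lift A V N K x" "\<And>x. x \<in> carrier_of X \<Longrightarrow> J' x = lift A V N K' x"
    using assms(21,23) unfolding lifted_from_def X_def by blast+
  have carr: "carrier_of X = M \<times> UNIV" "carrier_of Xh = M \<times> UNIV"
    unfolding X_def Xh_def M_def by (rule carrier_total_space[OF A V], rule carrier_total_space[OF A dV])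
  define G where "G = gen_metric K K'"
  \<comment> \<open>Any point over \<open>p\<close> would serve to bring the property down from the
    total space; the zero vector is one.\<close>
  have kK: "kaehler_at K K' p" if "p \<in> M" for p
  proof -
    have x: "(p, 0) \<in> carrier_of X" using that by (simp add: carr)
    then have "kaehler_at J J' (p, 0)" using assms(20) unfolding gen_almost_kaehler_iff by blast
    then have "kaehler_at (lift A V N K) (lift A V N K') (p, 0)"
      unfolding kaehler_at_def gen_metric_def J[OF x] .
    then show ?thesis using kaehler_at_lift[OF A V N x[unfolded X_def]] by simp
  qed
  let ?W = "sum_bundle V (tangent_bundle A)"
  let ?WW = "sum_bundle ?W (dual_bundle ?W)"
  note W = vector_bundle_sum[OF A Mo V T']
  note WW = vector_bundle_sum[OF A Mo W vector_bundle_dual[OF A W]]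
  have sK: "smooth_hom A M ?WW ?WW K" "smooth_hom A M ?WW ?WW K'"
    and cK: "\<And>p. p \<in> M \<Longrightarrow> complex_at K p" "\<And>p. p \<in> M \<Longrightarrow> complex_at K' p"
    using gK unfolding gen_almost_complex_iff M_def by blast+
  have sG: "smooth_hom A M ?WW ?WW G"
    unfolding M_def
    by (rule smooth_hom_cong[OF A Mo WW WW smooth_hom_scale[OF A Mo WW WW
            smooth_hom_compose[OF A Mo WW WW WW sK(2,1)[unfolded M_def]], of "-1"]])
      (simp add: G_def gen_metric_def)
  define G11 G21 G31 where "G11 p v = fst (fst (G p ((v, 0), (0, 0))))"
    and "G21 p f = fst (fst (G p ((0, 0), (f, 0))))" and "G31 p v = fst (snd (G p ((v, 0), (0, 0))))" for p v f
  define G14 G24 G34 where "G14 p t = snd (fst (G p ((0, t), (0, 0))))"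
    and "G24 p k = snd (fst (G p ((0, 0), (0, k))))" and "G34 p t = snd (snd (G p ((0, t), (0, 0))))" for p t k
  note Gdefs = G11_def G21_def G31_def G14_def G24_def G34_def
  have bd: "block_diagonal (G p) (G11 p) (G21 p) (G31 p) (G14 p) (G24 p) (G34 p)" if p: "p \<in> M" for p
    using adapted_block_diagonal[OF p[unfolded M_def] smooth_homD(1)[OF sK(1) p] smooth_homD(1)[OF sK(2) p]
        cK[OF p] kK[OF p] assms(22,24)]
    unfolding Gdefs[abs_def] G_def .
  have bdh: "block_diagonal (gen_metric (mirror_base K) (mirror_base K') p)
      (adjoint (G11 p)) (G31 p) (G21 p) (G14 p) (G24 p) (G34 p)" if "p \<in> M" for p
    using block_diagonal_mirror[OF bd[OF that, unfolded G_def]] .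
  have bm: "block_metric (G11 p) (G21 p) (G31 p)" "block_metric (G14 p) (G24 p) (G34 p)" if "p \<in> M" for p
    using bd[OF that] unfolding block_diagonal_def by blast+
  note Geq = bd[unfolded block_diagonal_def, THEN conjunct2, THEN conjunct2, rule_format]
  note Gheq = bdh[unfolded block_diagonal_def, THEN conjunct2, THEN conjunct2, rule_format]
  have aa: "adjoint (adjoint (G11 p)) = G11 p" if "p \<in> M" for p
    using adjoint_adjoint[OF block_metric.lin(1)[OF bm(1)[OF that]]] .
  note i = smooth_hom_inclusions[OF A Mo V T'] and c = smooth_hom_components[OF A Mo V T']
  \<comment> \<open>Each block is a fixed inclusion of a summand, followed by G and a fixed
    projection.\<close>
  have comp: "smooth_hom A M E F (\<lambda>p v. r (G p (j v)))"
    if "vector_bundle A E" "vector_bundle A F" "smooth_hom A M E ?WW (\<lambda>p. j)" "smooth_hom A M ?WW F (\<lambda>p. r)"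
    for E F :: "('m, real ^ 'n) vbundle" and j r
    using smooth_hom_compose[OF A Mo that(1) WW that(2) smooth_hom_compose[OF A Mo that(1) WW WW that(3)[unfolded M_def]
          sG[unfolded M_def]] that(4)[unfolded M_def]] by (simp add: M_def)
  have smooth: "smooth_hom A M V V G11" "smooth_hom A M T T G14" "smooth_hom A M Vh V G21"
    "smooth_hom A M (dual_bundle T) T G24" "smooth_hom A M V Vh G31" "smooth_hom A M T (dual_bundle T) G34"
    unfolding Gdefs[abs_def] T_def Vh_def
    using comp[OF V V i(1)[folded M_def] c(1)[folded M_def]] comp[OF T' T' i(2)[folded M_def] c(2)[folded M_def]]
      comp[OF dV V i(3)[folded M_def] c(1)[folded M_def]]
      comp[OF vector_bundle_dual[OF A T'] T' i(4)[folded M_def] c(2)[folded M_def]]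
      comp[OF V dV i(1)[folded M_def] c(3)[folded M_def]]
      comp[OF T' vector_bundle_dual[OF A T'] i(2)[folded M_def] c(4)[folded M_def]] by simp_all
  note Kh = gen_almost_complex_mirror_base[OF A V gK(1)] gen_almost_complex_mirror_base[OF A V gK(2)]
  \<comment> \<open>The mirror pair is the lift of the swapped base pair along the dual connection,
    so the results on lifts apply to (V^\<or>, \<nabla>^\<or>).\<close>
  have kh: "gen_almost_kaehler Xh Jh Jh'"
    unfolding gen_almost_kaehler_iff
  proof (intro conjI ballI)
    show "gen_almost_complex Xh (tangent_bundle Xh) Jh" "gen_almost_complex Xh (tangent_bundle Xh) Jh'"
      unfolding Xh_def Jh_def Jh'_def mirror_def
      using gen_almost_complex_lift[OF A dV dN Kh(1)] gen_almost_complex_lift[OF A dV dN Kh(2)] by simp_all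
    fix x assume x: "x \<in> carrier_of Xh"
    then have p: "fst x \<in> M" by (auto simp: carr)
    have "kaehler_at (mirror_base K) (mirror_base K') (fst x)"
      using kaehler_at_conj[OF swap_fibre_props(3-5), of "mirror_base K" "fst x" K "fst x" "mirror_base K'" K',
          OF mirror_base_eq mirror_base_eq] kK[OF p] by blast
    then show "kaehler_at Jh Jh' x"
      unfolding Jh_def Jh'_def mirror_def using kaehler_at_lift[OF A dV dN x[unfolded Xh_def]] by blast
  qed
  have X: "g z w = adjoint (D z) (inv (G21 (fst z)) (D z w)) + adjoint (dpi z) (inv (G24 (fst z)) (dpi z w))" (is ?g)
    "b z w = adjoint (D z) (adjoint (G11 (fst z)) (inv (G21 (fst z)) (D z w)))
       + adjoint (dpi z) (adjoint (G14 (fst z)) (inv (G24 (fst z)) (dpi z w)))" (is ?b)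
    "g z w \<bullet> w' = inv (G21 (fst z)) (D z w) \<bullet> D z w' + inv (G24 (fst z)) (dpi z w) \<bullet> dpi z w'" (is ?gi)
    "b z w \<bullet> w' = adjoint (G11 (fst z)) (inv (G21 (fst z)) (D z w)) \<bullet> D z w'
       + adjoint (G14 (fst z)) (inv (G24 (fst z)) (dpi z w)) \<bullet> dpi z w'" (is ?bi)
    if z: "z \<in> carrier_of X" for z w w'
  proof -
    have p: "fst z \<in> M" using z by (auto simp: carr)
    note m = metric_and_form_lift[where J = J and J' = J' and K = K and K' = K', OF A V N z[unfolded X_def]
        J[OF z] bd[OF p, unfolded G_def], folded g_def b_def D_def dpi_def]
    show ?g ?b using m(1,2) by simp_all
    show ?gi ?bi using m(3,4) unfolding m(1,2) by simp_all
  qed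
  have Xh: "gh z w = adjoint (Dh z) (inv (G31 (fst z)) (Dh z w)) + adjoint (dpih z) (inv (G24 (fst z)) (dpih z w))" (is ?g)
    "bh z w = adjoint (Dh z) (G11 (fst z) (inv (G31 (fst z)) (Dh z w)))
       + adjoint (dpih z) (adjoint (G14 (fst z)) (inv (G24 (fst z)) (dpih z w)))" (is ?b)
    "gh z w \<bullet> w' = inv (G31 (fst z)) (Dh z w) \<bullet> Dh z w' + inv (G24 (fst z)) (dpih z w) \<bullet> dpih z w'" (is ?gi)
    "bh z w \<bullet> w' = G11 (fst z) (inv (G31 (fst z)) (Dh z w)) \<bullet> Dh z w'
       + adjoint (G14 (fst z)) (inv (G24 (fst z)) (dpih z w)) \<bullet> dpih z w'" (is ?bi)
    if z: "z \<in> carrier_of Xh" for z w w'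
  proof -
    have p: "fst z \<in> M" using z by (auto simp: carr)
    \<comment> \<open>The upper left entry of the mirror block is the transpose of
      \<open>G11\<close>, so the transpose in the formula for the 2-form returns \<open>G11\<close>,
      by \<open>aa\<close>.\<close>
    note m = metric_and_form_lift[where K = "mirror_base K" and K' = "mirror_base K'"
        and J = "lift A (dual_bundle V) (dual_connection A V N) (mirror_base K)"
        and J' = "lift A (dual_bundle V) (dual_connection A V N) (mirror_base K')",
        OF A dV dN z[unfolded Xh_def] refl refl bdh[OF p], unfolded aa[OF p],
        folded mirror_def, folded gh_def bh_def Dh_def dpih_def]
    show ?g ?b using m(1,2) by simp_all
    show ?gi ?bi using m(3,4) unfolding m(1,2) by simp_all
  qed
  \<comment> \<open>Each term applies the same projection to both vectors, and each projection kills
    one of the two.\<close>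
  have orth: "g z (vert A V z u) \<bullet> hlift A V N z t = 0" "b z (vert A V z u) \<bullet> hlift A V N z t = 0"
    if z: "z \<in> carrier_of X" for z u t
  proof -
    have p: "fst z \<in> M" using z by (auto simp: carr)
    note l = block_metric.inv_b(3)[OF bm(2)[OF p]] adjoint_linear[OF block_metric.lin(1)[OF bm(2)[OF p]]]
    show "g z (vert A V z u) \<bullet> hlift A V N z t = 0" "b z (vert A V z u) \<bullet> hlift A V N z t = 0"
      unfolding X(3,4)[OF z] D_def dpi_def split_vert_hlift[OF A V N z[unfolded X_def]]
      by (simp_all add: linear_0[OF l(1)] linear_0[OF l(2)])
  qed
  have flat: "\<exists>(gm :: real ^ 'n \<Rightarrow> real ^ 'n ^ 'n) bm (h :: real ^ 'n \<Rightarrow> real ^ 'n ^ 'n) B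
             (hh :: real ^ 'n \<Rightarrow> real ^ 'n ^ 'n) Bh.
              (\<forall>z\<in>U \<times> UNIV. \<forall>w w'.
                 g z w \<bullet> w' = coord_form A V \<xi> e gm h z w w' \<and>
                 b z w \<bullet> w' = coord_form A V \<xi> e bm B z w w' \<and>
                 gh z w \<bullet> w' = coord_form A Vh \<xi> (dual_frame e) gm hh z w w' \<and>
                 bh z w \<bullet> w' = coord_form A Vh \<xi> (dual_frame e) bm Bh z w w') \<and>
              (\<forall>x\<in>\<xi> ` U.
                 (h x + B x) ** hh x ** (h x - B x) = h x \<and>
                 (h x + B x) ** Bh x ** (h x - B x) = - B x)"
    if ch: "smooth_chart A (U, \<xi>)" and e: "local_frame A U V e" and par: "\<And>a p w. p \<in> U \<Longrightarrow> N (e a) p w = 0"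
    for U \<xi> and e :: "'n \<Rightarrow> 'm \<Rightarrow> real ^ 'n"
  proof -
    note U = smooth_chart_properties(1,2)[OF A ch]
    \<comment> \<open>The coefficients have to be functions of the coordinates, so the base point is
      recovered from \<open>x\<close> by the inverse of the chart.\<close>
    define q where "q = inv_into U \<xi>"
    define r where "r p i = inv (mdiff A \<xi> p) (axis i 1)" for p and i :: 'n
    \<comment> \<open>\<open>gm\<close> and \<open>bm'\<close> come from the T_M-block, which the
      mirror leaves unchanged; hence the same two functions serve both total spaces.\<close>
    define gm where "gm x = form_matrix (inv (G24 (q x))) (r (q x))" for x
    define bm' where "bm' x = form_matrix (\<lambda>t. adjoint (G14 (q x)) (inv (G24 (q x)) t)) (r (q x))" for x
    define h where "h x = form_matrix (inv (G21 (q x))) (\<lambda>a. e a (q x))" for x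
    define B where "B x = form_matrix (\<lambda>v. adjoint (G11 (q x)) (inv (G21 (q x)) v)) (\<lambda>a. e a (q x))" for x
    define hh where "hh x = form_matrix (inv (G31 (q x))) (\<lambda>a. dual_frame e a (q x))" for x
    define Bh where "Bh x = form_matrix (\<lambda>f. G11 (q x) (inv (G31 (q x)) f)) (\<lambda>a. dual_frame e a (q x))" for x
    have qx: "q (\<xi> p) = p" if "p \<in> U" for p using U(2) that by (simp add: q_def)
    have UM: "p \<in> M" if "p \<in> U" for p using openin_mtop_subset[OF A U(1)] that by (auto simp: M_def)
    have "g z w \<bullet> w' = coord_form A V \<xi> e gm h z w w' \<and>
        b z w \<bullet> w' = coord_form A V \<xi> e bm' B z w w' \<and>
        gh z w \<bullet> w' = coord_form A Vh \<xi> (dual_frame e) gm hh z w w' \<and>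
        bh z w \<bullet> w' = coord_form A Vh \<xi> (dual_frame e) bm' Bh z w w'"
      if "z \<in> U \<times> UNIV" for z w w'
    proof -
      have z: "fst z \<in> U" using that by auto
      note p = UM[OF z]
      have zX: "z \<in> carrier_of X" "z \<in> carrier_of Xh" using p by (auto simp: carr mem_Times_iff)
      note m1 = bm(1)[OF p] and m2 = bm(2)[OF p]
      note l = block_metric.inv_b(3)[OF m1] block_metric.inv_b(3)[OF m2] block_metric.inv_c(3)[OF m1]
      have l': "linear (\<lambda>v. adjoint (G11 (fst z)) (inv (G21 (fst z)) v))"
        "linear (\<lambda>v. adjoint (G14 (fst z)) (inv (G24 (fst z)) v))" "linear (\<lambda>v. G11 (fst z) (inv (G31 (fst z)) v))"
        using linear_compose[OF l(1) adjoint_linear[OF block_metric.lin(1)[OF m1]]]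
          linear_compose[OF l(2) adjoint_linear[OF block_metric.lin(1)[OF m2]]]
          linear_compose[OF l(3) block_metric.lin(1)[OF m1]] by (simp_all add: o_def)
      have Dw: "vproj A V N z w = (\<Sum>a\<in>UNIV. (mdiff (total_space A V) (fibre_coord e) z w $ a) *\<^sub>R e a (fst z))" for w
        by (rule vproj_flat_frame[OF A V N U(1) e _ z]) (rule par)
      have Dhw: "vproj A (dual_bundle V) (dual_connection A V N) z w = (\<Sum>a\<in>UNIV.
          (mdiff (total_space A (dual_bundle V)) (fibre_coord (dual_frame e)) z w $ a) *\<^sub>R dual_frame e a (fst z))" for w
        by (rule vproj_dual_flat_frame[OF A V N U(1) e _ z]) (rule par)
      note coord = coord_form_eq[OF A V ch z Dw] and coordh = coord_form_eq[OF A dV ch z Dhw]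
      have "coord_form A V \<xi> e gm h z w w' = g z w \<bullet> w'"
        unfolding X(3)[OF zX(1)] D_def dpi_def
        by (rule coord[OF l(1,2)]) (simp_all add: gm_def h_def qx[OF z] r_def[abs_def])
      moreover have "coord_form A V \<xi> e bm' B z w w' = b z w \<bullet> w'"
        unfolding X(4)[OF zX(1)] D_def dpi_def
        by (rule coord[OF l'(1,2)]) (simp_all add: bm'_def B_def qx[OF z] r_def[abs_def])
      moreover have "coord_form A Vh \<xi> (dual_frame e) gm hh z w w' = gh z w \<bullet> w'"
        unfolding Xh(3)[OF zX(2)] Dh_def dpih_def Vh_def
        by (rule coordh[OF l(3,2)]) (simp_all add: gm_def hh_def qx[OF z] r_def[abs_def])
      moreover have "coord_form A Vh \<xi> (dual_frame e) bm' Bh z w w' = bh z w \<bullet> w'"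
        unfolding Xh(4)[OF zX(2)] Dh_def dpih_def Vh_def
        by (rule coordh[OF l'(3,2)]) (simp_all add: bm'_def Bh_def qx[OF z] r_def[abs_def])
      ultimately show ?thesis by simp
    qed
    moreover have "(h x + B x) ** hh x ** (h x - B x) = h x \<and> (h x + B x) ** Bh x ** (h x - B x) = - B x"
      if "x \<in> \<xi> ` U" for x
    proof -
      have p: "q x \<in> U" using that qx by auto
      have fe: "v = (\<Sum>c\<in>UNIV. (v \<bullet> dual_frame e c (q x)) *\<^sub>R e c (q x))"
        "v = (\<Sum>c\<in>UNIV. (v \<bullet> e c (q x)) *\<^sub>R dual_frame e c (q x))" for v
        by (rule frame_expansions(4,5)[OF A V N U(1) e _ p], rule par, assumption)+
      show ?thesis
        unfolding h_def B_def hh_def Bh_def using form_matrix_buscher[OF bm(1)[OF UM[OF p]] fe] by simp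
    qed
    ultimately show ?thesis by blast
  qed
  have buscher: "let h = inv (G21 p); \<beta> = (\<lambda>v. adjoint (G11 p) (inv (G21 p) v));
                hh = inv (G31 p); \<beta>h = (\<lambda>f. G11 p (inv (G31 p) f))
            in h (hh (h u - \<beta> u)) + \<beta> (hh (h u - \<beta> u)) = h u \<and>
               h (\<beta>h (h u - \<beta> u)) + \<beta> (\<beta>h (h u - \<beta> u)) = - \<beta> u" if "p \<in> M" for p u
    unfolding Let_def using block_metric.buscher[OF bm(1)[OF that], of u] by blast
  have blocks: "(\<forall>v t f k. gen_metric K K' p ((v, t), (f, k)) =
        ((G11 p v + G21 p f, G14 p t + G24 p k),
         (G31 p v + adjoint (G11 p) f, G34 p t + adjoint (G14 p) k))) \<and>
     adjoint (G21 p) = G21 p \<and> adjoint (G24 p) = G24 p \<and>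
     adjoint (G31 p) = G31 p \<and> adjoint (G34 p) = G34 p \<and>
     (\<forall>f t v k. gen_metric (mirror_base K) (mirror_base K') p ((f, t), (v, k)) =
        ((adjoint (G11 p) f + G31 p v, G14 p t + G24 p k),
         (G21 p f + G11 p v, G34 p t + adjoint (G14 p) k))) \<and>
     bij (G21 p) \<and> bij (G24 p) \<and> bij (G31 p)" if "p \<in> M" for p
    using Geq[OF that] Gheq[OF that] block_metric.sym[OF bm(1)[OF that]] block_metric.sym[OF bm(2)[OF that]]
      block_metric.bij_b[OF bm(1)[OF that]] block_metric.bij_b[OF bm(2)[OF that]] block_metric.bij_c[OF bm(1)[OF that]]
    by (simp add: G_def aa[OF that])
  show ?thesis
    by (rule conjI[OF kh], rule conjI[rotated], rule conjI, use orth in blast, use flat in blast, rule exI[of _ G11], rule exI[of _ G14],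
        rule exI[of _ G21], rule exI[of _ G24], rule exI[of _ G31], rule exI[of _ G34], intro conjI ballI allI)
      (fact smooth | rule blocks[THEN conjunct1, rule_format] | (rule X Xh buscher, assumption) | (use blocks in blast))+
qed

end
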